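(* Given a sequence of integrable graphexes of the form $\mathcal W_n=(W_n,0,0,\mathbf\Omega_n)$, the following are equivalent. (1) The sequence $W_n$ converges to an (integrable) graphon $W$ in the cut metric $\delta_\square$. (2) The sequence $W_n$ is uniformly tail regular, and in the weak kernel metric $\delta_\diamond$, the sequence $\mathcal W_n$ converges to a graphex of the form $\mathcal W=(W,0,0,\mathbf\Omega)$. (3) The sequence $W_n$ is uniformly tail regular, and in the weak kernel metric $\delta_\diamond$, the sequence $\mathcal W_n$ converges to some graphex $\mathcal W$.
   Context: A graphex $\mathcal W=(W,S,I,\mathbf\Omega)$ consists of a $\sigma$-finite measure space $\mathbf\Omega=(\Omega,\mathcal F,\mu)$, a symmetric measurable $W\colon\Omega\times\Omega\to[0,1]$ (called a graphon over $\mathbf\Omega$), a measurable $S\colon\Omega\to\mathbb R_+=[0,\infty)$ and $I\in\mathbb R_+$, such that (1) $W(\cdot,x)$ is integrable for almost all $x$, and (2) there is a measurable $\Omega'\subseteq\Omega$ with $\mu(\Omega\setminus\Omega')<\infty$ and $\int_{\Omega'\times\Omega'}W+2\int_{\Omega'}S+2I<\infty$. $\mathcal W$ is integrable if $\|\mathcal W\|_1=\int W+2\int S+2I<\infty$. The marginal is $D_{\mathcal W}(x)=\int_\Omega W(x,y)\,d\mu(y)+S(x)$. $\mathcal W$ is in $L^1\cap L^2$ if both $W$ and $D_{\mathcal W}$ are in $L^1\cap L^2$. Put $\rho(\mathcal W)=\int W+2\int S+2I$. A set of integrable graphons is uniformly tail regular if for every $\varepsilon>0$ there is an $M$ such that for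 each graphon $W$ in the set, over $(\Omega,\mathcal F,\mu)$ say, there is a measurable $\Omega_0\subseteq\Omega$ with $\mu(\Omega_0)\le M$ and $\|W\|_1-\|W|_{\Omega_0\times\Omega_0}\|_1\le\varepsilon$. A coupling of $\mu_1,\mu_2$ is a measure on $(\Omega_1\times\Omega_2,\mathcal F_1\times\mathcal F_2)$ with marginals $\mu_1,\mu_2$; $\pi_i\colon\Omega_1\times\Omega_2\to\Omega_i$ denotes the projection. A trivial extension of $\mathcal W$ is obtained by enlarging the $\sigma$-finite measure space $\Omega$ to a $\sigma$-finite $\Omega'\supseteq\Omega$ (with $\Omega$ measurable in $\Omega'$, $\sigma$-algebra and measure restricting to those of $\Omega$), extending $W$ by $0$ off $\Omega\times\Omega$ and $S$ by $0$ off $\Omega$, and keeping $I$ (and similarly for graphons). Cut metric: $\|U\|_\square=\sup_{S,T}|\int_{S\times T}U\,d\mu\,d\mu|$ over measurable $S,T\subseteq\Omega$. For integrable graphons $W_1,W_2$, $\delta_\square(W_1,W_2)=\inf_\mu\|W_1'(\pi_1(\cdot),\pi_1(\cdot))-W_2'(\pi_2(\cdot),\pi_2(\cdot))\|_{\square}$, where $W_i'$ are trivial extensions of $W_i$ to spaces of infinite total mass, the infimum is over all couplings $\mu$ of the two extended measures, and the cut norm is with respect to $\mu$ (the value does not depend on the choice of extensions). Weak kernel metric: $\|U\|_{2\to2}=\sup\{\int f(x)U(x,y)g(y)\,d\mu(x)\,d\mu(y):\|f\|_2=\|g\|_2=1\}$. For graphexes in $L^1\cap L^2$ on the same measure space,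 $$d_{2\to2}(\mathcal W_1,\mathcal W_2)=\max\Big(\|W_1-W_2\|_{2\to2},\ \sqrt{\|D_{\mathcal W_1}-D_{\mathcal W_2}\|_2},\ \sqrt[3]{|\rho(\mathcal W_1)-\rho(\mathcal W_2)|}\Big).$$ For $\mu_1(\Omega_1)=\mu_2(\Omega_2)$, $\widetilde\delta_{2\to2}(\mathcal W_1,\mathcal W_2)=\inf_\mu d_{2\to2}(\mathcal W_1^{\pi_1,\mu},\mathcal W_2^{\pi_2,\mu})$ over all couplings $\mu$, where $\mathcal W_i^{\pi_i,\mu}=(W_i(\pi_i(\cdot),\pi_i(\cdot)),S_i\circ\pi_i,I_i)$ over $(\Omega_1\times\Omega_2,\mathcal F_1\times\mathcal F_2,\mu)$. Then $\delta_{2\to2}(\mathcal W_1,\mathcal W_2)=\widetilde\delta_{2\to2}(\mathcal W_1',\mathcal W_2')$ where $\mathcal W_i'$ are trivial extensions of $\mathcal W_i$ to spaces of infinite total mass (the value does not depend on the choice of these extensions). For measures on the same measurable space and $r\ge0$, $\mu-r\le\mu'\le\mu$ means $\mu(B)-r\le\mu'(B)\le\mu(B)$ for all measurable $B$. For graphexes $\mathcal W_i$ over $(\Omega_i,\mathcal F_i,\mu_i)$, $\delta_\diamond(\mathcal W_1,\mathcal W_2)$ is the infimum of all real $c$ for which there exist measures $\widetilde\mu_i$ on $(\Omega_i,\mathcal F_i)$ such that the graphexes $\widetilde{\mathcal W}_i$ obtained from $\mathcal W_i$ by replacing $\mu_i$ by $\widetilde\mu_i$ are in $L^1\cap L^2$,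 $\mu_i-c^2\le\widetilde\mu_i\le\mu_i$ for $i=1,2$, and $\delta_{2\to2}(\widetilde{\mathcal W}_1,\widetilde{\mathcal W}_2)\le c$. *)

theory Defs
  imports "HOL-Analysis.Analysis"
begin

definition graphon :: "'a measure \<Rightarrow> ('a \<Rightarrow> 'a \<Rightarrow> real) \<Rightarrow> bool" where
  "graphon M W \<longleftrightarrow>
     sigma_finite_measure M \<and>
     (\<lambda>(x, y). W x y) \<in> borel_measurable (M \<Otimes>\<^sub>M M) \<and>
     (\<forall>x\<in>space M. \<forall>y\<in>space M. W x y = W y x \<and> 0 \<le> W x y \<and> W x y \<le> 1)"

definition integrable_graphon :: "'a measure \<Rightarrow> ('a \<Rightarrow> 'a \<Rightarrow> real) \<Rightarrow> bool" where
  "integrable_graphon M W \<longleftrightarrow> graphon M W \<and> integrable (M \<Otimes>\<^sub>M M) (\<lambda>(x, y). W x y)"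

record 'a graphex =
  kernel :: "'a \<Rightarrow> 'a \<Rightarrow> real"
  star :: "'a \<Rightarrow> real"
  isolated :: real
  base :: "'a measure"

definition weight_on :: "'a graphex \<Rightarrow> 'a set \<Rightarrow> ennreal" where
  "weight_on G A =
     (\<integral>\<^sup>+ z\<in>A \<times> A. ennreal (kernel G (fst z) (snd z)) \<partial>(base G \<Otimes>\<^sub>M base G))
     + 2 * (\<integral>\<^sup>+ x\<in>A. ennreal (star G x) \<partial>base G) + 2 * ennreal (isolated G)"

definition is_graphex :: "'a graphex \<Rightarrow> bool" where
  "is_graphex G \<longleftrightarrow>
     graphon (base G) (kernel G) \<and>
     star G \<in> borel_measurable (base G) \<and> (\<forall>x\<in>space (base G). 0 \<le> star G x) \<and>
     0 \<le> isolated G \<and>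
     (AE x in base G. integrable (base G) (\<lambda>y. kernel G y x)) \<and>
     (\<exists>A\<in>sets (base G). emeasure (base G) (space (base G) - A) < \<infinity> \<and> weight_on G A < \<infinity>)"

definition integrable_graphex :: "'a graphex \<Rightarrow> bool" where
  "integrable_graphex G \<longleftrightarrow> is_graphex G \<and> weight_on G (space (base G)) < \<infinity>"

text \<open>
  For a graphex, the section \<open>kernel G x\<close> is integrable for almost every \<open>x\<close>; on the exceptional
  null set the Bochner integral below is \<open>0\<close>, which affects none of the norms of the marginal.
\<close>
definition marginal :: "'a graphex \<Rightarrow> 'a \<Rightarrow> real" where
  "marginal G x = (\<integral>y. kernel G x y \<partial>base G) + star G x"

definition rho :: "'a graphex \<Rightarrow> real" where
  "rho G = (\<integral>(x, y). kernel G x y \<partial>(base G \<Otimes>\<^sub>M base G))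
     + 2 * (\<integral>x. star G x \<partial>base G) + 2 * isolated G"

definition in_L1_L2 :: "'a measure \<Rightarrow> ('a \<Rightarrow> real) \<Rightarrow> bool" where
  "in_L1_L2 M f \<longleftrightarrow> integrable M f \<and> integrable M (\<lambda>x. (f x)\<^sup>2)"

definition L1_L2_graphex :: "'a graphex \<Rightarrow> bool" where
  "L1_L2_graphex G \<longleftrightarrow>
     is_graphex G \<and>
     in_L1_L2 (base G \<Otimes>\<^sub>M base G) (\<lambda>(x, y). kernel G x y) \<and>
     in_L1_L2 (base G) (marginal G)"

definition uniformly_tail_regular :: "('a measure \<times> ('a \<Rightarrow> 'a \<Rightarrow> real)) set \<Rightarrow> bool" where
  "uniformly_tail_regular \<W> \<longleftrightarrow>
     (\<forall>\<epsilon>>0. \<exists>C::real. \<forall>(M, W)\<in>\<W>. \<exists>A\<in>sets M. emeasure M A \<le> ennreal C \<and>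
        (\<integral>(x, y). W x y \<partial>(M \<Otimes>\<^sub>M M))
          - (LINT z:A \<times> A|M \<Otimes>\<^sub>M M. W (fst z) (snd z)) \<le> \<epsilon>)"

definition sum_measure :: "'a measure \<Rightarrow> 'b measure \<Rightarrow> ('a + 'b) measure" where
  "sum_measure M N =
     measure_of (space M <+> space N) {A <+> B |A B. A \<in> sets M \<and> B \<in> sets N}
       (\<lambda>X. emeasure M (Inl -` X) + emeasure N (Inr -` X))"

lemma vimage_Inl_Plus [simp]: "Inl -` (A <+> B) = A"
  and vimage_Inr_Plus [simp]: "Inr -` (A <+> B) = B"
  by auto

lemma sigma_algebra_Plus:
  "sigma_algebra (space M <+> space N) {A <+> B |A B. A \<in> sets M \<and> B \<in> sets N}"
    (is "sigma_algebra ?\<Omega> ?S")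
proof -
  have 1: "?S \<subseteq> Pow ?\<Omega>"
  proof
    fix X assume "X \<in> ?S"
    then obtain A B where X: "X = A <+> B" "A \<in> sets M" "B \<in> sets N" by blast
    then have "A \<subseteq> space M" "B \<subseteq> space N"
      by (simp_all add: sets.sets_into_space)
    then have "A <+> B \<subseteq> ?\<Omega>"
      unfolding Plus_def by (intro Un_mono image_mono)
    then show "X \<in> Pow ?\<Omega>" using X by simp
  qed
  have "{} <+> {} \<in> ?S"
    using sets.empty_sets[of M] sets.empty_sets[of N] by blast
  then have 2: "{} \<in> ?S" by (simp only: Plus_def image_empty Un_empty_left)
  have 3: "?\<Omega> - X \<in> ?S" if mem: "X \<in> ?S" for X
  proof -
    obtain A B where X: "X = A <+> B" "A \<in> sets M" "B \<in> sets N"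
      using mem by blast
    have "?\<Omega> - X = (space M - A) <+> (space N - B)"
      unfolding X(1) Plus_def by blast
    moreover have "space M - A \<in> sets M" "space N - B \<in> sets N"
      using X by (simp_all add: sets.compl_sets)
    ultimately show ?thesis by blast
  qed
  have 4: "(\<Union>i. F i) \<in> ?S" if "range F \<subseteq> ?S" for F :: "nat \<Rightarrow> _"
  proof -
    define A B where "A i = Inl -` F i" and "B i = Inr -` F i" for i
    have AB: "F i = A i <+> B i" "A i \<in> sets M" "B i \<in> sets N" for i
    proof -
      have "F i \<in> ?S" using that by blast
      then obtain A' B' where "F i = A' <+> B'" "A' \<in> sets M" "B' \<in> sets N" by blast
      then show "F i = A i <+> B i" "A i \<in> sets M" "B i \<in> sets N"
        by (simp_all add: A_def B_def)
    qed
    have "(\<Union>i. F i) = (\<Union>i. A i) <+> (\<Union>i. B i)"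
      unfolding AB(1) Plus_def by blast
    moreover have "(\<Union>i. A i) \<in> sets M" "(\<Union>i. B i) \<in> sets N"
      using AB(2,3) by (intro sets.countable_UN; blast)+
    ultimately show ?thesis by blast
  qed
  show ?thesis
    unfolding sigma_algebra_iff2 using 1 2 3 4 by (intro conjI ballI allI impI)
qed

lemma space_sum_measure [simp]: "space (sum_measure M N) = space M <+> space N"
  using sigma_algebra.space_measure_of_eq[OF sigma_algebra_Plus[of M N]]
  by (simp only: sum_measure_def)

lemma sets_sum_measure:
  "sets (sum_measure M N) = {A <+> B |A B. A \<in> sets M \<and> B \<in> sets N}"
  using sigma_algebra.sets_measure_of_eq[OF sigma_algebra_Plus[of M N]]
  by (simp only: sum_measure_def)

lemma emeasure_sum_measure:
  assumes "A \<in> sets M" "B \<in> sets N"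
  shows "emeasure (sum_measure M N) (A <+> B) = emeasure M A + emeasure N B"
proof -
  let ?S = "{A <+> B |A B. A \<in> sets M \<and> B \<in> sets N}"
  let ?m = "\<lambda>X. emeasure M (Inl -` X) + emeasure N (Inr -` X)"
  have "countably_additive ?S ?m"
  proof (rule countably_additiveI)
    fix F :: "nat \<Rightarrow> _"
    assume F: "range F \<subseteq> ?S" and disj: "disjoint_family F"
    have mem: "Inl -` F i \<in> sets M" "Inr -` F i \<in> sets N" for i
    proof -
      have "F i \<in> ?S" using F by blast
      then obtain A B where "F i = A <+> B" "A \<in> sets M" "B \<in> sets N" by blast
      then show "Inl -` F i \<in> sets M" "Inr -` F i \<in> sets N" by simp_all
    qed
    have d: "disjoint_family (\<lambda>i. Inl -` F i)" "disjoint_family (\<lambda>i. Inr -` F i)"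
      using disj unfolding disjoint_family_on_def by blast+
    have "(\<Sum>i. ?m (F i)) = (\<Sum>i. emeasure M (Inl -` F i)) + (\<Sum>i. emeasure N (Inr -` F i))"
      by (rule suminf_add[symmetric]; rule summableI)
    also have "\<dots> = emeasure M (\<Union>i. Inl -` F i) + emeasure N (\<Union>i. Inr -` F i)"
      using suminf_emeasure[OF _ d(1), of M] suminf_emeasure[OF _ d(2), of N] mem
      by (simp add: image_subset_iff)
    finally show "(\<Sum>i. ?m (F i)) = ?m (\<Union>i. F i)"
      by (simp add: vimage_UN)
  qed
  moreover have "positive ?S ?m"
    by (simp add: positive_def)
  moreover have "A <+> B \<in> ?S" using assms by blast
  ultimately have "emeasure (measure_of (space M <+> space N) ?S ?m) (A <+> B) = ?m (A <+> B)"
    by (intro emeasure_measure_of_sigma[OF sigma_algebra_Plus])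
  then show ?thesis by (simp only: sum_measure_def vimage_Inl_Plus vimage_Inr_Plus)
qed

text \<open>
  Up to isomorphism, every enlargement of a measure space \<open>M\<close> in which \<open>space M\<close> is measurable is
  \<open>sum_measure M N\<close> for some \<open>N\<close>.  Among the extensions of infinite total mass, on the choice of
  which the distances below do not depend, we fix the one that adds the real line with
  Lebesgue measure on its Borel sets.
\<close>
definition extend_base :: "'a measure \<Rightarrow> ('a + real) measure" where
  "extend_base M = sum_measure M lborel"

definition extend_kernel :: "('a \<Rightarrow> 'a \<Rightarrow> real) \<Rightarrow> 'a + 'b \<Rightarrow> 'a + 'b \<Rightarrow> real" where
  "extend_kernel W z w = (case (z, w) of (Inl x, Inl y) \<Rightarrow> W x y | _ \<Rightarrow> 0)"

definition extend_graphex :: "'a graphex \<Rightarrow> ('a + real) graphex" where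
  "extend_graphex G =
     \<lparr>kernel = extend_kernel (kernel G),
      star = (\<lambda>z. case z of Inl x \<Rightarrow> star G x | Inr _ \<Rightarrow> 0),
      isolated = isolated G,
      base = extend_base (base G)\<rparr>"

definition couplings :: "'a measure \<Rightarrow> 'b measure \<Rightarrow> ('a \<times> 'b) measure set" where
  "couplings M1 M2 =
     {\<mu>. sets \<mu> = sets (M1 \<Otimes>\<^sub>M M2) \<and> distr \<mu> M1 fst = M1 \<and> distr \<mu> M2 snd = M2}"

definition pullback :: "('b \<Rightarrow> 'a) \<Rightarrow> 'b measure \<Rightarrow> 'a graphex \<Rightarrow> 'b graphex" where
  "pullback \<pi> \<mu> G =
     \<lparr>kernel = (\<lambda>x y. kernel G (\<pi> x) (\<pi> y)),
      star = (\<lambda>x. star G (\<pi> x)),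
      isolated = isolated G,
      base = \<mu>\<rparr>"

definition cut_norm :: "'a measure \<Rightarrow> ('a \<Rightarrow> 'a \<Rightarrow> real) \<Rightarrow> ereal" where
  "cut_norm M U =
     (SUP (A, B)\<in>sets M \<times> sets M. ereal \<bar>LINT z:A \<times> B|M \<Otimes>\<^sub>M M. U (fst z) (snd z)\<bar>)"

definition cut_dist ::
    "'a measure \<Rightarrow> ('a \<Rightarrow> 'a \<Rightarrow> real) \<Rightarrow> 'b measure \<Rightarrow> ('b \<Rightarrow> 'b \<Rightarrow> real) \<Rightarrow> ereal" where
  "cut_dist M1 W1 M2 W2 =
     (INF \<mu>\<in>couplings (extend_base M1) (extend_base M2).
        cut_norm \<mu> (\<lambda>z w. extend_kernel W1 (fst z) (fst w) - extend_kernel W2 (snd z) (snd w)))"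

definition L2_norm :: "'a measure \<Rightarrow> ('a \<Rightarrow> real) \<Rightarrow> real" where
  "L2_norm M f = sqrt (\<integral>x. (f x)\<^sup>2 \<partial>M)"

text \<open>
  If \<open>f\<^sup>2\<close> is not integrable then \<open>L2_norm M f = 0\<close>, so the condition \<open>L2_norm M f = 1\<close> below
  entails that \<open>f\<close> is square-integrable.
\<close>
definition kernel_norm :: "'a measure \<Rightarrow> ('a \<Rightarrow> 'a \<Rightarrow> real) \<Rightarrow> ereal" where
  "kernel_norm M U =
     (SUP (f, g)\<in>{(f, g). f \<in> borel_measurable M \<and> g \<in> borel_measurable M \<and>
                         L2_norm M f = 1 \<and> L2_norm M g = 1}.
        ereal (\<integral>(x, y). f x * U x y * g y \<partial>(M \<Otimes>\<^sub>M M)))"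

text \<open>The two graphexes are understood to have the same base.\<close>
definition kernel_d :: "'a graphex \<Rightarrow> 'a graphex \<Rightarrow> ereal" where
  "kernel_d G1 G2 =
     max (kernel_norm (base G1) (\<lambda>x y. kernel G1 x y - kernel G2 x y))
       (max (ereal (sqrt (L2_norm (base G1) (\<lambda>x. marginal G1 x - marginal G2 x))))
            (ereal (root 3 \<bar>rho G1 - rho G2\<bar>)))"

definition kernel_dist_coupled :: "'a graphex \<Rightarrow> 'b graphex \<Rightarrow> ereal" where
  "kernel_dist_coupled G1 G2 =
     (INF \<mu>\<in>couplings (base G1) (base G2). kernel_d (pullback fst \<mu> G1) (pullback snd \<mu> G2))"

definition kernel_dist :: "'a graphex \<Rightarrow> 'b graphex \<Rightarrow> ereal" where
  "kernel_dist G1 G2 = kernel_dist_coupled (extend_graphex G1) (extend_graphex G2)"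

definition measure_within :: "real \<Rightarrow> 'a measure \<Rightarrow> 'a measure \<Rightarrow> bool" where
  "measure_within r M M' \<longleftrightarrow>
     sets M' = sets M \<and>
     (\<forall>B\<in>sets M. emeasure M B - ennreal r \<le> emeasure M' B \<and> emeasure M' B \<le> emeasure M B)"

definition weak_kernel_dist :: "'a graphex \<Rightarrow> 'b graphex \<Rightarrow> ereal" where
  "weak_kernel_dist G1 G2 =
     (INF c\<in>{c::real. \<exists>M1 M2.
          L1_L2_graphex (G1\<lparr>base := M1\<rparr>) \<and> L1_L2_graphex (G2\<lparr>base := M2\<rparr>) \<and>
          measure_within (c\<^sup>2) (base G1) M1 \<and> measure_within (c\<^sup>2) (base G2) M2 \<and>
          kernel_dist (G1\<lparr>base := M1\<rparr>) (G2\<lparr>base := M2\<rparr>) \<le> ereal c}.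
        ereal c)"

definition graphex_of_graphon :: "'a measure \<Rightarrow> ('a \<Rightarrow> 'a \<Rightarrow> real) \<Rightarrow> 'a graphex" where
  "graphex_of_graphon M W = \<lparr>kernel = W, star = (\<lambda>_. 0), isolated = 0, base = M\<rparr>"

end

theory Submission
  imports Defs
begin

text \<open>
  For kernels bounded by \<open>1\<close> with degrees at most \<open>\<Lambda>\<close>, the cube of the kernel norm is at most
  \<open>4 \<Lambda>\<close> times the cut norm. A cut-convergent sequence is therefore kernel-convergent once
  the few points of large degree are removed from the coupling. Conversely, on a set of bounded measure
  the kernel norm dominates the cut norm, and uniform tail regularity together with the convergence of
  \<open>rho\<close> makes everything outside such a set negligible; the same comparison bounds the mass of the
  kernel of the limit. Removing mass from a coupling leaves a partial coupling, which
  is completed using room freed in the added copies of the real line, where the kernels vanish.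
\<close>

text \<open>The two metrics treat removed mass differently: the weak kernel metric lets measure
  \<open>c\<^sup>2\<close> be dropped for free, while the cut metric charges for the kernel mass
  carried by whatever is dropped. Tail regularity closes the gap: up to \<open>\<epsilon>\<close> a
  kernel lives over a set of measure at most \<open>C\<close>, and dropping measure \<open>r\<close>
  there costs at most \<open>2 * C * r\<close>. In the other direction the removal is what makes the
  graphexes comparable at all: the degrees of an integrable graphon need not be square-integrable,
  but by Markov those above \<open>l\<close> occur on a set of measure at most \<open>K / l\<close>,
  with \<open>K\<close> a bound on the masses. The points are removed in the coupling and not in
  each graphon separately, because restricting a measure never increases a cut norm and takes
  matching mass from both sides. The limit in (3) may have a star and an isolated part. Both only
  increase \<open>rho\<close>, so a one-sided comparison of masses suffices, and the kernel of the
  limit alone is already a cut limit. The cycle (1), (2), (3), (1) thus closes without computing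
  these two parts.\<close>

section \<open>Disjoint sums of measure spaces and the extension by a line\<close>

lemma Inl_measurable [measurable]: "Inl \<in> measurable M (sum_measure M N)"
  and Inr_measurable [measurable]: "Inr \<in> measurable N (sum_measure M N)"
proof -
  show "Inl \<in> measurable M (sum_measure M N)"
  proof (rule measurableI)
    fix X assume "X \<in> sets (sum_measure M N)"
    then obtain A B where "X = A <+> B" "A \<in> sets M" "B \<in> sets N"
      unfolding sets_sum_measure by blast
    then show "Inl -` X \<inter> space M \<in> sets M" by simp
  qed auto
  show "Inr \<in> measurable N (sum_measure M N)"
  proof (rule measurableI)
    fix X assume "X \<in> sets (sum_measure M N)"
    then obtain A B where "X = A <+> B" "A \<in> sets M" "B \<in> sets N"
      unfolding sets_sum_measure by blast
    then show "Inr -` X \<inter> space N \<in> sets N" by simp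
  qed auto
qed

lemma measurable_case_sum_measure [measurable (raw)]:
  assumes f: "f \<in> measurable M K" and g: "g \<in> measurable N K"
  shows "case_sum f g \<in> measurable (sum_measure M N) K"
proof (rule measurableI)
  fix x assume "x \<in> space (sum_measure M N)"
  then show "case_sum f g x \<in> space K"
    using measurable_space[OF f] measurable_space[OF g] by auto
next
  fix X assume X: "X \<in> sets K"
  have "case_sum f g -` X \<inter> space (sum_measure M N)
      = (f -` X \<inter> space M) <+> (g -` X \<inter> space N)"
    by (auto split: sum.splits)
  then show "case_sum f g -` X \<inter> space (sum_measure M N) \<in> sets (sum_measure M N)"
    unfolding sets_sum_measure using measurable_sets[OF f X] measurable_sets[OF g X] by blast
qed

lemma Plus_in_sets_sum_measure [measurable (raw)]:
  "A \<in> sets M \<Longrightarrow> B \<in> sets N \<Longrightarrow> A <+> B \<in> sets (sum_measure M N)"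
  unfolding sets_sum_measure by blast

lemma nn_integral_sum_measure:
  assumes [measurable]: "f \<in> borel_measurable (sum_measure M N)"
  shows "(\<integral>\<^sup>+z. f z \<partial>sum_measure M N) = (\<integral>\<^sup>+x. f (Inl x) \<partial>M) + (\<integral>\<^sup>+y. f (Inr y) \<partial>N)"
proof -
  let ?X = "sum_measure M N"
  let ?L = "space M <+> {}" and ?R = "{} <+> space N"
  have [measurable]: "?L \<in> sets ?X" "?R \<in> sets ?X"
    by (auto intro!: Plus_in_sets_sum_measure)
  \<comment> \<open>Restricted to one summand, the sum measure is an image measure; this turns the
    two halves of the integral into integrals over \<open>M\<close> and \<open>N\<close>.\<close>
  have L: "density ?X (indicator ?L) = distr M ?X Inl"
  proof (rule measure_eqI)
    fix X assume "X \<in> sets (density ?X (indicator ?L))"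
    then have X: "X \<in> sets ?X" by simp
    then obtain A B where AB: "X = A <+> B" "A \<in> sets M" "B \<in> sets N"
      unfolding sets_sum_measure by blast
    have "?L \<inter> X = A <+> {}"
      using sets.sets_into_space[OF AB(2)] unfolding AB by auto
    then show "emeasure (density ?X (indicator ?L)) X = emeasure (distr M ?X Inl) X"
      using X AB by (simp add: emeasure_restricted emeasure_distr emeasure_sum_measure)
  qed simp
  have R: "density ?X (indicator ?R) = distr N ?X Inr"
  proof (rule measure_eqI)
    fix X assume "X \<in> sets (density ?X (indicator ?R))"
    then have X: "X \<in> sets ?X" by simp
    then obtain A B where AB: "X = A <+> B" "A \<in> sets M" "B \<in> sets N"
      unfolding sets_sum_measure by blast
    have "?R \<inter> X = {} <+> B"
      using sets.sets_into_space[OF AB(3)] unfolding AB by auto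
    then show "emeasure (density ?X (indicator ?R)) X = emeasure (distr N ?X Inr) X"
      using X AB by (simp add: emeasure_restricted emeasure_distr emeasure_sum_measure)
  qed simp
  have "(\<integral>\<^sup>+z. f z \<partial>?X) = (\<integral>\<^sup>+z. indicator ?L z * f z + indicator ?R z * f z \<partial>?X)"
    by (intro nn_integral_cong) (auto split: split_indicator)
  also have "\<dots> = (\<integral>\<^sup>+z. indicator ?L z * f z \<partial>?X) + (\<integral>\<^sup>+z. indicator ?R z * f z \<partial>?X)"
    by (rule nn_integral_add) auto
  also have "(\<integral>\<^sup>+z. indicator ?L z * f z \<partial>?X) = (\<integral>\<^sup>+z. f z \<partial>density ?X (indicator ?L))"
    by (simp add: nn_integral_density)
  also have "(\<integral>\<^sup>+z. indicator ?R z * f z \<partial>?X) = (\<integral>\<^sup>+z. f z \<partial>density ?X (indicator ?R))"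
    by (simp add: nn_integral_density)
  finally show ?thesis
    by (simp add: L R nn_integral_distr)
qed

lemma sigma_finite_sum_measure:
  assumes "sigma_finite_measure M" "sigma_finite_measure N"
  shows "sigma_finite_measure (sum_measure M N)"
proof -
  obtain A where A: "countable A" "A \<subseteq> sets M" "\<Union>A = space M" "\<forall>a\<in>A. emeasure M a \<noteq> \<infinity>"
    using assms(1) unfolding sigma_finite_measure_def by metis
  obtain B where B: "countable B" "B \<subseteq> sets N" "\<Union>B = space N" "\<forall>a\<in>B. emeasure N a \<noteq> \<infinity>"
    using assms(2) unfolding sigma_finite_measure_def by metis
  let ?C = "(\<lambda>a. a <+> {}) ` A \<union> (\<lambda>b. {} <+> b) ` B"
  have "countable ?C" using A(1) B(1) by (intro countable_Un countable_image)
  moreover have "?C \<subseteq> sets (sum_measure M N)"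
  proof (intro Un_least image_subsetI)
    fix a assume "a \<in> A"
    then have "a \<in> sets M" using A(2) by blast
    then show "a <+> {} \<in> sets (sum_measure M N)" by (intro Plus_in_sets_sum_measure) simp_all
  next
    fix b assume "b \<in> B"
    then have "b \<in> sets N" using B(2) by blast
    then show "{} <+> b \<in> sets (sum_measure M N)" by (intro Plus_in_sets_sum_measure) simp_all
  qed
  moreover have "\<Union>?C = space (sum_measure M N)"
  proof -
    have "z \<in> \<Union>?C \<longleftrightarrow> z \<in> \<Union>A <+> \<Union>B" for z
      by (cases z) auto
    then have "\<Union>?C = \<Union>A <+> \<Union>B" by (rule set_eqI)
    then show ?thesis by (simp add: A(3) B(3))
  qed
  moreover have "\<forall>c\<in>?C. emeasure (sum_measure M N) c \<noteq> \<infinity>"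
  proof
    fix c assume "c \<in> ?C"
    then consider a where "a \<in> A" "c = a <+> {}" | b where "b \<in> B" "c = {} <+> b" by blast
    then show "emeasure (sum_measure M N) c \<noteq> \<infinity>"
    proof cases
      case 1
      then have "a \<in> sets M" using A(2) by blast
      then show ?thesis using A(4) 1 by (simp add: emeasure_sum_measure)
    next
      case 2
      then have "b \<in> sets N" using B(2) by blast
      then show ?thesis using B(4) 2 by (simp add: emeasure_sum_measure)
    qed
  qed
  ultimately show ?thesis
    unfolding sigma_finite_measure_def by blast
qed

lemma space_extend_base: "space (extend_base M) = space M <+> UNIV"
  by (simp add: extend_base_def)

lemma Inl_measurable_extend [measurable]: "Inl \<in> measurable M (extend_base M)"
  and Inr_measurable_extend [measurable]: "Inr \<in> measurable borel (extend_base M)"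
proof -
  show "Inl \<in> measurable M (extend_base M)" by (simp add: extend_base_def)
  have "Inr \<in> measurable lborel (extend_base M)" by (simp add: extend_base_def)
  then show "Inr \<in> measurable borel (extend_base M)" by simp
qed

lemma measurable_case_sum_extend [measurable (raw)]:
  assumes "f \<in> measurable M K" "g \<in> measurable borel K"
  shows "case_sum f g \<in> measurable (extend_base M) K"
  unfolding extend_base_def using assms by (intro measurable_case_sum_measure) auto

lemma sets_extend_base_cong: "sets M = sets N \<Longrightarrow> sets (extend_base M) = sets (extend_base N)"
  by (simp add: extend_base_def sets_sum_measure)

lemma nn_integral_extend_base:
  "f \<in> borel_measurable (extend_base M) \<Longrightarrow>
    (\<integral>\<^sup>+z. f z \<partial>extend_base M) = (\<integral>\<^sup>+x. f (Inl x) \<partial>M) + (\<integral>\<^sup>+y. f (Inr y) \<partial>lborel)"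
  unfolding extend_base_def by (rule nn_integral_sum_measure)

lemma sigma_finite_extend_base:
  "sigma_finite_measure M \<Longrightarrow> sigma_finite_measure (extend_base M)"
  unfolding extend_base_def by (intro sigma_finite_sum_measure sigma_finite_lborel)

text \<open>The case distinction is rewritten as a product: the indicator \<open>i\<close> of the
  original space in each variable, times \<open>W\<close> composed with a retraction
  \<open>p\<close> that sends the added line to one chosen point. The retraction needs such a point,
  hence the separate case of an empty space.\<close>

lemma measurable_extend_kernel:
  assumes W: "(\<lambda>(x, y). W x y) \<in> borel_measurable (M \<Otimes>\<^sub>M M)"
  shows "(\<lambda>(x, y). extend_kernel W x y) \<in> borel_measurable (extend_base M \<Otimes>\<^sub>M extend_base M)"
proof (cases "space M = {}")
  case True
  have "(\<lambda>(x, y). extend_kernel W x y) \<in> borel_measurable (extend_base M \<Otimes>\<^sub>M extend_base M)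
    \<longleftrightarrow> (\<lambda>_. 0::real) \<in> borel_measurable (extend_base M \<Otimes>\<^sub>M extend_base M)"
    by (rule measurable_cong)
      (auto simp: space_pair_measure space_extend_base True extend_kernel_def)
  then show ?thesis by simp
next
  case False
  then obtain x0 where x0: "x0 \<in> space M" by blast
  define p where "p = case_sum (\<lambda>x. x) (\<lambda>_::real. x0)"
  define i where "i = case_sum (\<lambda>x::'a. 1::real) (\<lambda>_::real. 0)"
  have [measurable]: "p \<in> measurable (extend_base M) M" "i \<in> borel_measurable (extend_base M)"
    unfolding p_def i_def using x0 by measurable
  have [measurable]: "(\<lambda>z. W (fst z) (snd z)) \<in> borel_measurable (M \<Otimes>\<^sub>M M)"
    using W by (simp add: case_prod_beta')
  have "(\<lambda>z. i (fst z) * i (snd z) * W (p (fst z)) (p (snd z)))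
      = (\<lambda>(x, y). extend_kernel W x y)"
    by (auto simp: i_def p_def extend_kernel_def fun_eq_iff split: sum.splits)
  moreover have "(\<lambda>z. W (p (fst z)) (p (snd z))) \<in> borel_measurable (extend_base M \<Otimes>\<^sub>M extend_base M)"
    by (rule measurable_compose[of "\<lambda>z. (p (fst z), p (snd z))" _ "M \<Otimes>\<^sub>M M" "\<lambda>z. W (fst z) (snd z)", simplified])
       measurable
  then have "(\<lambda>z. i (fst z) * i (snd z) * W (p (fst z)) (p (snd z)))
      \<in> borel_measurable (extend_base M \<Otimes>\<^sub>M extend_base M)"
    by measurable
  ultimately show ?thesis by simp
qed

text \<open>A measure with a sigma-finite image is itself sigma-finite, and the first marginal is
  such an image.\<close>

lemma couplings_sigma_finite:
  assumes "\<mu> \<in> couplings M1 M2" "sigma_finite_measure M1"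
  shows "sigma_finite_measure \<mu>"
proof (rule sigma_finite_measure_distr)
  show "sigma_finite_measure (distr \<mu> M1 fst)" using assms by (simp add: couplings_def)
  have "sets \<mu> = sets (M1 \<Otimes>\<^sub>M M2)" using assms by (simp add: couplings_def)
  then show "fst \<in> measurable \<mu> M1" by (simp cong: measurable_cong_sets)
qed

subsection \<open>Couplings of infinite measures\<close>

text \<open>Partition the space into pieces \<open>A i\<close> of finite measure \<open>a i\<close>
  and lay them end to end along the half line as intervals \<open>I i\<close> of length
  \<open>a i\<close>. With the value \<open>1 / a i\<close> on \<open>A i \<times> I i\<close>, the
  density \<open>h\<close> describes a coupling of \<open>N\<close> with Lebesgue measure on the
  half line. Infinite total mass is what makes the intervals exhaust the half line.\<close>

lemma uniform_slicing:
  fixes N :: "'a measure"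
  assumes "sigma_finite_measure N" and inf: "emeasure N (space N) = \<infinity>"
  obtains h :: "'a \<times> real \<Rightarrow> ennreal" where
    "h \<in> borel_measurable (N \<Otimes>\<^sub>M lborel)"
    "AE x in N. (\<integral>\<^sup>+t. h (x, t) \<partial>lborel) = 1"
    "\<And>t. (\<integral>\<^sup>+x. h (x, t) \<partial>N) = indicator {0..} t"
    "\<And>x t. t < 0 \<Longrightarrow> h (x, t) = 0"
proof -
  interpret sigma_finite_measure N by fact
  obtain A :: "nat \<Rightarrow> 'a set" where A: "range A \<subseteq> sets N" "(\<Union>i. A i) = space N"
    "\<And>i. emeasure N (A i) \<noteq> \<infinity>" "disjoint_family A"
    by (rule sigma_finite_disjoint) (rule that)
  have [measurable]: "A i \<in> sets N" for i using A(1) by auto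
  define a where "a i = measure N (A i)" for i
  have eA: "emeasure N (A i) = ennreal (a i)" for i
    unfolding a_def using A(3)[of i] by (simp add: emeasure_eq_ennreal_measure)
  have a0: "0 \<le> a i" for i by (simp add: a_def)
  define s where "s i = (\<Sum>k<i. a k)" for i :: nat
  have sS: "s (Suc i) = s i + a i" for i by (simp add: s_def)
  have s0: "s 0 = 0" by (simp add: s_def)
  have smono: "i \<le> j \<Longrightarrow> s i \<le> s j" for i j
    unfolding s_def using a0 by (intro sum_mono2) auto
  have "(\<Sum>i. ennreal (a i)) = \<infinity>"
    using suminf_emeasure[of A N] A inf by (simp add: eA)
  then have unb: "\<exists>i. t < s i" for t
  proof -
    assume *: "(\<Sum>i. ennreal (a i)) = \<infinity>"
    have "(SUP n. \<Sum>k<n. ennreal (a k)) = \<infinity>"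
      using * by (simp add: suminf_eq_SUP)
    then have "ennreal (max t 0) < (SUP n. \<Sum>k<n. ennreal (a k))"
      by (metis ennreal_less_top infinity_ennreal_def)
    then obtain n where "ennreal (max t 0) < (\<Sum>k<n. ennreal (a k))"
      by (auto simp: less_SUP_iff)
    then have "ennreal (max t 0) < ennreal (s n)"
      using a0 by (simp add: s_def sum_nonneg)
    then show ?thesis by (auto simp: ennreal_less_iff)
  qed
  define I where "I i = {s i..<s (Suc i)}" for i
  have Idisj: "i = j" if "t \<in> I i" "t \<in> I j" for t i j
  proof (rule ccontr)
    assume "i \<noteq> j"
    then consider "Suc i \<le> j" | "Suc j \<le> i" by linarith
    then show False using that smono[of "Suc i" j] smono[of "Suc j" i]
      by cases (auto simp: I_def)
  qed
  have Icov: "\<exists>i. t \<in> I i" if "0 \<le> t" for t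
  proof -
    define n where "n = (LEAST i. t < s i)"
    have n: "t < s n" unfolding n_def using unb[of t] by (rule LeastI_ex)
    then have "n \<noteq> 0" using that s0 by (metis not_le)
    then obtain m where m: "n = Suc m" by (cases n) auto
    have "\<not> t < s m" using not_less_Least[of m "\<lambda>i. t < s i"] m n_def by auto
    then show ?thesis using n m by (auto simp: I_def intro!: exI[of _ m])
  qed
  have Ineg: "t \<notin> I i" if "t < 0" for t i
    using smono[of 0 i] s0 that by (auto simp: I_def)
  define h where "h z = (\<Sum>i. indicator (A i) (fst z) * indicator (I i) (snd z) * ennreal (1 / a i))"
    for z :: "'a \<times> real"
  have [measurable]: "I i \<in> sets borel" for i by (simp add: I_def)
  have hm: "h \<in> borel_measurable (N \<Otimes>\<^sub>M lborel)"
    unfolding h_def by measurable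
  have single: "(\<Sum>i. f i) = f k" if "\<And>i. i \<noteq> k \<Longrightarrow> f i = 0" for f :: "nat \<Rightarrow> ennreal" and k
    using suminf_finite[of "{k}" f] that by simp
  \<comment> \<open>Pieces of measure 0 get empty intervals, so \<open>h\<close> vanishes over them.
    Their union is null, which is why the first marginal identity holds only almost
    everywhere.\<close>
  have "AE x in N. a i = 0 \<longrightarrow> x \<notin> A i" for i
  proof (cases "a i = 0")
    case True
    then have "AE x in N. x \<notin> A i" by (intro AE_not_in) (simp add: null_sets_def eA)
    then show ?thesis by (rule AE_mp) simp
  qed simp
  then have "AE x in N. \<forall>i. a i = 0 \<longrightarrow> x \<notin> A i"
    by (subst AE_all_countable) (rule allI)
  then have 1: "AE x in N. (\<integral>\<^sup>+t. h (x, t) \<partial>lborel) = 1"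
  proof (rule AE_mp, intro AE_I2 impI)
    fix x assume x: "x \<in> space N" "\<forall>i. a i = 0 \<longrightarrow> x \<notin> A i"
    then have "x \<in> (\<Union>i. A i)" by (simp only: A(2))
    then obtain k where k: "x \<in> A k" by (rule UN_E)
    have "a k \<noteq> 0" using x(2) k by blast
    then have ak: "a k > 0" using a0[of k] by simp
    have nk: "x \<notin> A i" if "i \<noteq> k" for i
      using A(4) k that unfolding disjoint_family_on_def by blast
    have "h (x, t) = indicator (I k) t * ennreal (1 / a k)" for t
      unfolding h_def by (subst single[of k]) (use k nk in auto)
    then have "(\<integral>\<^sup>+t. h (x, t) \<partial>lborel) = emeasure lborel (I k) * ennreal (1 / a k)"
      by (simp add: nn_integral_multc)
    also have "\<dots> = 1"
      using ak a0[of k] by (simp add: I_def sS ennreal_mult[symmetric])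
    finally show "(\<integral>\<^sup>+t. h (x, t) \<partial>lborel) = 1" .
  qed
  have 2: "(\<integral>\<^sup>+x. h (x, t) \<partial>N) = indicator {0..} t" for t
  proof (cases "0 \<le> t")
    case True
    then obtain k where k: "t \<in> I k" using Icov by blast
    have "s k \<le> t" "t < s k + a k" using k unfolding I_def sS by simp_all
    then have ak: "a k > 0" by linarith
    have "h (x, t) = indicator (A k) x * ennreal (1 / a k)" for x
    proof -
      have "i = k" if "t \<in> I i" for i using Idisj[OF that k] .
      then have "i \<noteq> k \<Longrightarrow> t \<notin> I i" for i by blast
      then show ?thesis
        unfolding h_def by (subst single[of k]) (use k in auto)
    qed
    then have "(\<integral>\<^sup>+x. h (x, t) \<partial>N) = emeasure N (A k) * ennreal (1 / a k)"
      by (simp add: nn_integral_multc)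
    also have "\<dots> = 1"
      using ak by (simp add: eA ennreal_mult[symmetric])
    finally show ?thesis using True by simp
  next
    case False
    then have "h (x, t) = 0" for x
      unfolding h_def using Ineg[of t] by simp
    then show ?thesis using False by simp
  qed
  have 3: "h (x, t) = 0" if "t < 0" for x t
    unfolding h_def using Ineg[OF that] by simp
  from that[OF hm 1 2 3] show ?thesis .
qed

text \<open>
  Slicing couples each of the two measures with Lebesgue measure on the half line; the density \<open>k\<close>
  glues the two couplings along the half line.
\<close>
lemma infinite_measures_coupling:
  fixes N1 :: "'a measure" and N2 :: "'b measure"
  assumes "sigma_finite_measure N1" "emeasure N1 (space N1) = \<infinity>"
    and "sigma_finite_measure N2" "emeasure N2 (space N2) = \<infinity>"
  shows "couplings N1 N2 \<noteq> {}"
proof -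
  interpret N1: sigma_finite_measure N1 by fact
  interpret N2: sigma_finite_measure N2 by fact
  interpret P1: pair_sigma_finite N1 lborel by standard
  interpret P2: pair_sigma_finite N2 lborel by standard
  interpret P: pair_sigma_finite N1 N2 by standard
  obtain h :: "'a \<times> real \<Rightarrow> ennreal" where [measurable]: "h \<in> borel_measurable (N1 \<Otimes>\<^sub>M lborel)" and h:
    "AE x in N1. (\<integral>\<^sup>+t. h (x, t) \<partial>lborel) = 1"
    "\<And>t. (\<integral>\<^sup>+x. h (x, t) \<partial>N1) = indicator {0..} t" "\<And>x t. t < 0 \<Longrightarrow> h (x, t) = 0"
    by (rule uniform_slicing[OF assms(1,2)]) (rule that)
  obtain g :: "'b \<times> real \<Rightarrow> ennreal" where [measurable]: "g \<in> borel_measurable (N2 \<Otimes>\<^sub>M lborel)" and g: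
    "AE x in N2. (\<integral>\<^sup>+t. g (x, t) \<partial>lborel) = 1"
    "\<And>t. (\<integral>\<^sup>+x. g (x, t) \<partial>N2) = indicator {0..} t" "\<And>x t. t < 0 \<Longrightarrow> g (x, t) = 0"
    by (rule uniform_slicing[OF assms(3,4)]) (rule that)
  define k where "k z = (\<integral>\<^sup>+t. h (fst z, t) * g (snd z, t) \<partial>lborel)" for z
  have [measurable]: "k \<in> borel_measurable (N1 \<Otimes>\<^sub>M N2)"
    unfolding k_def by measurable
  let ?\<kappa> = "density (N1 \<Otimes>\<^sub>M N2) k"
  have k1: "(\<integral>\<^sup>+y. k (x, y) \<partial>N2) = (\<integral>\<^sup>+t. h (x, t) \<partial>lborel)" if [measurable]: "x \<in> space N1" for x
  proof -
    have "(\<integral>\<^sup>+y. k (x, y) \<partial>N2) = (\<integral>\<^sup>+t. \<integral>\<^sup>+y. h (x, t) * g (y, t) \<partial>N2 \<partial>lborel)"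
      unfolding k_def fst_conv snd_conv by (rule P2.Fubini'[symmetric]) measurable
    also have "\<dots> = (\<integral>\<^sup>+t. h (x, t) * indicator {0..} t \<partial>lborel)"
      by (intro nn_integral_cong) (simp add: nn_integral_cmult g)
    also have "\<dots> = (\<integral>\<^sup>+t. h (x, t) \<partial>lborel)"
      by (intro nn_integral_cong) (auto split: split_indicator simp: h)
    finally show ?thesis .
  qed
  have k2: "(\<integral>\<^sup>+x. k (x, y) \<partial>N1) = (\<integral>\<^sup>+t. g (y, t) \<partial>lborel)" if [measurable]: "y \<in> space N2" for y
  proof -
    have "(\<integral>\<^sup>+x. k (x, y) \<partial>N1) = (\<integral>\<^sup>+t. \<integral>\<^sup>+x. h (x, t) * g (y, t) \<partial>N1 \<partial>lborel)"
      unfolding k_def fst_conv snd_conv by (rule P1.Fubini'[symmetric]) measurable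
    also have "\<dots> = (\<integral>\<^sup>+t. indicator {0..} t * g (y, t) \<partial>lborel)"
      by (intro nn_integral_cong) (simp add: nn_integral_multc h)
    also have "\<dots> = (\<integral>\<^sup>+t. g (y, t) \<partial>lborel)"
      by (intro nn_integral_cong) (auto split: split_indicator simp: g)
    finally show ?thesis .
  qed
  have "distr ?\<kappa> N1 fst = N1"
  proof (rule measure_eqI)
    fix B assume "B \<in> sets (distr ?\<kappa> N1 fst)"
    then have [measurable]: "B \<in> sets N1" by simp
    have "emeasure (distr ?\<kappa> N1 fst) B = (\<integral>\<^sup>+z. indicator B z \<partial>distr ?\<kappa> N1 fst)" by simp
    also have "\<dots> = (\<integral>\<^sup>+z. k z * indicator B (fst z) \<partial>(N1 \<Otimes>\<^sub>M N2))"
      by (subst nn_integral_distr) (auto simp: nn_integral_density)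
    also have "\<dots> = (\<integral>\<^sup>+x. \<integral>\<^sup>+y. k (x, y) * indicator B x \<partial>N2 \<partial>N1)"
      by (subst N2.nn_integral_fst[symmetric]) auto
    also have "\<dots> = (\<integral>\<^sup>+x. (\<integral>\<^sup>+t. h (x, t) \<partial>lborel) * indicator B x \<partial>N1)"
      by (intro nn_integral_cong) (simp add: nn_integral_multc k1)
    also have "\<dots> = (\<integral>\<^sup>+x. indicator B x \<partial>N1)"
      using h(1) by (intro nn_integral_cong_AE) auto
    finally show "emeasure (distr ?\<kappa> N1 fst) B = emeasure N1 B" by simp
  qed simp
  moreover have "distr ?\<kappa> N2 snd = N2"
  proof (rule measure_eqI)
    fix B assume "B \<in> sets (distr ?\<kappa> N2 snd)"
    then have [measurable]: "B \<in> sets N2" by simp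
    have "emeasure (distr ?\<kappa> N2 snd) B = (\<integral>\<^sup>+z. indicator B z \<partial>distr ?\<kappa> N2 snd)" by simp
    also have "\<dots> = (\<integral>\<^sup>+z. k z * indicator B (snd z) \<partial>(N1 \<Otimes>\<^sub>M N2))"
      by (subst nn_integral_distr) (auto simp: nn_integral_density)
    also have "\<dots> = (\<integral>\<^sup>+y. \<integral>\<^sup>+x. k (x, y) * indicator B y \<partial>N1 \<partial>N2)"
      by (subst P.nn_integral_snd[symmetric]) auto
    also have "\<dots> = (\<integral>\<^sup>+y. (\<integral>\<^sup>+t. g (y, t) \<partial>lborel) * indicator B y \<partial>N2)"
      by (intro nn_integral_cong) (simp add: nn_integral_multc k2)
    also have "\<dots> = (\<integral>\<^sup>+x. indicator B x \<partial>N2)"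
      using g(1) by (intro nn_integral_cong_AE) auto
    finally show "emeasure (distr ?\<kappa> N2 snd) B = emeasure N2 B" by simp
  qed simp
  ultimately have "?\<kappa> \<in> couplings N1 N2"
    by (simp add: couplings_def)
  then show ?thesis by blast
qed

subsection \<open>Dominated measures\<close>

lemma sigma_finite_measure_mono:
  assumes "sigma_finite_measure M" and sets: "sets M' = sets M"
    and le: "\<And>B. B \<in> sets M \<Longrightarrow> emeasure M' B \<le> emeasure M B"
  shows "sigma_finite_measure M'"
proof -
  obtain A where A: "countable A" "A \<subseteq> sets M" "\<Union>A = space M" "\<forall>a\<in>A. emeasure M a \<noteq> \<infinity>"
    using assms(1) unfolding sigma_finite_measure_def by metis
  have "\<forall>a\<in>A. emeasure M' a \<noteq> \<infinity>"
  proof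
    fix a assume "a \<in> A"
    then have "emeasure M' a \<le> emeasure M a" "emeasure M a \<noteq> \<infinity>" using A(2,4) le by blast+
    then show "emeasure M' a \<noteq> \<infinity>" by (auto simp: top_unique)
  qed
  moreover have "space M' = space M" using sets by (rule sets_eq_imp_space_eq)
  ultimately show ?thesis
    unfolding sigma_finite_measure_def using A sets by metis
qed

text \<open>Radon-Nikodym gives a density with values in \<open>ennreal\<close>, and domination
  forces it below 1 almost everywhere. Truncating at 1 changes it on a null set only and yields a
  real function with bounds at every point, which spares the later arguments any exceptional
  sets.\<close>

lemma dominated_density:
  assumes "sigma_finite_measure M" and sets: "sets M' = sets M"
    and le: "\<And>B. B \<in> sets M \<Longrightarrow> emeasure M' B \<le> emeasure M B"
  obtains h :: "'a \<Rightarrow> real" where "h \<in> borel_measurable M" "\<And>x. 0 \<le> h x" "\<And>x. h x \<le> 1"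
    "M' = density M (\<lambda>x. ennreal (h x))"
proof -
  interpret sigma_finite_measure M by fact
  have "absolutely_continuous M M'"
    unfolding absolutely_continuous_def
  proof
    fix B assume B: "B \<in> null_sets M"
    then have "emeasure M' B \<le> 0" using le[of B] by (simp add: null_sets_def)
    then show "B \<in> null_sets M'" using B sets by (simp add: null_sets_def)
  qed
  then obtain f where f[measurable]: "f \<in> borel_measurable M" and M': "density M f = M'"
    using Radon_Nikodym sets by metis
  obtain A :: "nat \<Rightarrow> 'a set" where A: "range A \<subseteq> sets M" "(\<Union>i. A i) = space M"
    "\<And>i. emeasure M (A i) \<noteq> \<infinity>" "disjoint_family A"
    by (rule sigma_finite_disjoint) (rule that)
  have [measurable]: "A i \<in> sets M" for i using A(1) by auto
  \<comment> \<open>On the set where \<open>f\<close> exceeds 1 the excess integrates to 0 once the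
    measure of the set is cancelled. The cancellation needs finite measure, so it is done on one
    piece at a time.\<close>
  have "AE x in M. x \<in> A i \<longrightarrow> f x \<le> 1" for i
  proof -
    let ?E = "{x\<in>space M. 1 < f x} \<inter> A i"
    have [measurable]: "?E \<in> sets M" by measurable
    have fin: "emeasure M ?E \<noteq> \<infinity>"
      using emeasure_mono[of ?E "A i" M] A(3)[of i] by (auto simp: top_unique)
    have "(\<integral>\<^sup>+x. indicator ?E x + (f x - 1) * indicator ?E x \<partial>M) = (\<integral>\<^sup>+x. f x * indicator ?E x \<partial>M)"
      by (intro nn_integral_cong) (auto split: split_indicator simp: less_imp_le)
    also have "\<dots> = emeasure M' ?E" by (simp add: M'[symmetric] emeasure_density)
    also have "\<dots> \<le> emeasure M ?E" by (rule le) measurable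
    finally have "emeasure M ?E + (\<integral>\<^sup>+x. (f x - 1) * indicator ?E x \<partial>M) \<le> emeasure M ?E + 0"
      by (simp add: nn_integral_add)
    then have "(\<integral>\<^sup>+x. (f x - 1) * indicator ?E x \<partial>M) \<le> 0"
      using fin by (subst (asm) ennreal_add_left_cancel_le) auto
    then have "(\<integral>\<^sup>+x. (f x - 1) * indicator ?E x \<partial>M) = 0" by simp
    then have "AE x in M. (f x - 1) * indicator ?E x = 0"
      by (simp add: nn_integral_0_iff_AE)
    then show ?thesis
      by (rule AE_mp, intro AE_I2 impI) (auto split: split_indicator_asm simp: diff_eq_0_iff_ennreal not_less[symmetric])
  qed
  then have "AE x in M. \<forall>i. x \<in> A i \<longrightarrow> f x \<le> 1"
    by (subst AE_all_countable) (rule allI)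
  then have f1: "AE x in M. f x = ennreal (enn2real (min (f x) 1))"
  proof (rule AE_mp, intro AE_I2 impI)
    fix x assume "x \<in> space M" "\<forall>i. x \<in> A i \<longrightarrow> f x \<le> 1"
    then have "f x \<le> 1" using A(2) by blast
    then show "f x = ennreal (enn2real (min (f x) 1))"
      by (auto simp: min_absorb1 intro!: ennreal_enn2real[symmetric] intro: le_less_trans[OF _ ennreal_one_less_top])
  qed
  have "enn2real (min (f x) 1) \<le> 1" for x
    using enn2real_mono[of "min (f x) 1" 1] by simp
  moreover have "M' = density M (\<lambda>x. ennreal (enn2real (min (f x) 1)))"
    unfolding M'[symmetric] by (rule density_cong) (use f1 in auto)
  ultimately show ?thesis
    by (intro that[of "\<lambda>x. enn2real (min (f x) 1)"]) auto
qed

lemma density_le: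
  assumes [measurable]: "h \<in> borel_measurable M" "B \<in> sets M" and "\<And>x. h x \<le> (1::real)"
  shows "emeasure (density M (\<lambda>x. ennreal (h x))) B \<le> emeasure M B"
proof -
  have "emeasure (density M (\<lambda>x. ennreal (h x))) B \<le> (\<integral>\<^sup>+x. indicator B x \<partial>M)"
    using assms(3) by (simp add: emeasure_density ennreal_le_1 nn_integral_mono split: split_indicator del: nn_integral_indicator)
  then show ?thesis by simp
qed

text \<open>On a set of infinite measure, \<open>measure_within\<close> says only that the smaller
  measure is infinite too. The deficit is therefore bounded on sets of finite measure, where the
  subtraction carries information, and monotone convergence extends the bound to the whole
  space.\<close>

lemma density_deficiency:
  assumes "sigma_finite_measure M"
    and h[measurable]: "h \<in> borel_measurable M" and h0: "\<And>x. 0 \<le> h x" and h1: "\<And>x. h x \<le> (1::real)"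
    and w: "measure_within r M (density M (\<lambda>x. ennreal (h x)))"
  shows "(\<integral>\<^sup>+x. ennreal (1 - h x) \<partial>M) \<le> ennreal r"
proof -
  interpret sigma_finite_measure M by fact
  obtain A :: "nat \<Rightarrow> 'a set" where A: "range A \<subseteq> sets M" "(\<Union>i. A i) = space M"
    "\<And>i. emeasure M (A i) \<noteq> \<infinity>" "incseq A"
    by (rule sigma_finite_incseq) (rule that)
  have [measurable]: "A i \<in> sets M" for i using A(1) by auto
  have "(\<integral>\<^sup>+x. ennreal (1 - h x) * indicator (A i) x \<partial>M) \<le> ennreal r" for i
  proof -
    let ?a = "(\<integral>\<^sup>+x. ennreal (1 - h x) * indicator (A i) x \<partial>M)"
      and ?b = "(\<integral>\<^sup>+x. ennreal (h x) * indicator (A i) x \<partial>M)"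
    have "?a + ?b = (\<integral>\<^sup>+x. ennreal (1 - h x) * indicator (A i) x + ennreal (h x) * indicator (A i) x \<partial>M)"
      by (rule nn_integral_add[symmetric]) auto
    also have "\<dots> = (\<integral>\<^sup>+x. indicator (A i) x \<partial>M)"
      using h0 h1 by (intro nn_integral_cong)
        (auto split: split_indicator simp: ennreal_plus[symmetric] simp del: ennreal_plus)
    finally have eq: "?a + ?b = emeasure M (A i)" by simp
    have "emeasure M (A i) - ennreal r \<le> ?b"
      using w unfolding measure_within_def by (auto simp: emeasure_density)
    then have "?a + ?b \<le> ennreal r + ?b"
      unfolding eq by (simp add: ennreal_minus_le_iff add.commute)
    moreover have "?b \<noteq> \<infinity>" using eq A(3)[of i] by auto
    ultimately show ?thesis
      by (simp add: ennreal_add_left_cancel_le add.commute[of _ ?b])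
  qed
  moreover have "(\<integral>\<^sup>+x. ennreal (1 - h x) \<partial>M) = (SUP i. \<integral>\<^sup>+x. ennreal (1 - h x) * indicator (A i) x \<partial>M)"
  proof -
    have "(SUP i. \<integral>\<^sup>+x. ennreal (1 - h x) * indicator (A i) x \<partial>M)
        = (\<integral>\<^sup>+x. (SUP i. ennreal (1 - h x) * indicator (A i) x) \<partial>M)"
      using A(4) by (intro nn_integral_monotone_convergence_SUP[symmetric])
        (auto simp: incseq_def le_fun_def split: split_indicator)
    also have "\<dots> = (\<integral>\<^sup>+x. ennreal (1 - h x) \<partial>M)"
    proof (rule nn_integral_cong)
      fix x assume "x \<in> space M"
      then obtain i where "x \<in> A i" using A(2) by blast
      then show "(SUP i. ennreal (1 - h x) * indicator (A i) x) = ennreal (1 - h x)"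
        by (intro antisym SUP_least SUP_upper2[of i]) (auto split: split_indicator)
    qed
    finally show ?thesis by simp
  qed
  ultimately show ?thesis by (simp add: SUP_le_iff)
qed

definition add_measure :: "'a measure \<Rightarrow> 'a measure \<Rightarrow> 'a measure" where
  "add_measure M N = measure_of (space M) (sets M) (\<lambda>A. emeasure M A + emeasure N A)"

lemma space_add_measure [simp]: "space (add_measure M N) = space M"
  and sets_add_measure [simp, measurable_cong]: "sets (add_measure M N) = sets M"
  by (simp_all add: add_measure_def)

lemma emeasure_add_measure:
  assumes sets: "sets N = sets M" and A: "A \<in> sets M"
  shows "emeasure (add_measure M N) A = emeasure M A + emeasure N A"
proof -
  have "countably_additive (sets M) (\<lambda>A. emeasure M A + emeasure N A)"
  proof (rule countably_additiveI)
    fix F :: "nat \<Rightarrow> _" assume F: "range F \<subseteq> sets M" "disjoint_family F"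
    have "(\<Sum>i. emeasure M (F i) + emeasure N (F i)) = (\<Sum>i. emeasure M (F i)) + (\<Sum>i. emeasure N (F i))"
      by (rule suminf_add[symmetric]) (rule summableI)+
    then show "(\<Sum>i. emeasure M (F i) + emeasure N (F i)) = emeasure M (\<Union> (range F)) + emeasure N (\<Union> (range F))"
      using suminf_emeasure[of F M] suminf_emeasure[of F N] F sets by simp
  qed
  then show ?thesis
    unfolding add_measure_def
    by (intro emeasure_measure_of_sigma) (auto simp: positive_def A sets.sigma_algebra_axioms)
qed

subsection \<open>Completing partial couplings\<close>

text \<open>
  Squeezing the added copy of the line by the map \<open>r \<mapsto> 2 r\<close> halves its measure and thus frees
  infinite mass, with which whatever is missing from a coupling can be matched.
\<close>
definition squeeze :: "'a + real \<Rightarrow> 'a + real" where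
  "squeeze = map_sum id (\<lambda>r. 2 * r)"

lemma squeeze_simps [simp]: "squeeze (Inl x) = Inl x" "squeeze (Inr r) = Inr (2 * r)"
  by (simp_all add: squeeze_def)

lemma squeeze_measurable [measurable]: "squeeze \<in> measurable (extend_base N) (extend_base N)"
proof -
  have "squeeze = case_sum Inl (\<lambda>r::real. Inr (2 * r) :: 'a + real)"
    by (auto simp: squeeze_def fun_eq_iff split: sum.splits)
  moreover have "case_sum Inl (\<lambda>r::real. Inr (2 * r)) \<in> measurable (extend_base N) (extend_base N)"
    by measurable
  ultimately show ?thesis by simp
qed

lemma extend_kernel_squeeze [simp]:
  "extend_kernel W (squeeze z) (squeeze w) = extend_kernel W z w"
  by (cases z; cases w) (simp_all add: extend_kernel_def)

text \<open>If \<open>h\<close> is the density of \<open>\<nu>\<close>, its image under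
  \<open>squeeze\<close> has density \<open>h (Inr (r / 2)) / 2\<close> on the added line, which is
  at most 1/2. What \<open>X\<close> has beyond this image therefore has density at least 1/2 on the
  whole line and infinite mass, whatever \<open>\<nu>\<close> was.\<close>

lemma squeeze_complement:
  fixes N :: "'a measure"
  defines "X \<equiv> extend_base N"
  assumes N: "sigma_finite_measure N" and sets: "sets \<nu> = sets X"
    and le: "\<And>B. B \<in> sets X \<Longrightarrow> emeasure \<nu> B \<le> emeasure X B"
  obtains \<kappa> where "sets \<kappa> = sets X" "sigma_finite_measure \<kappa>" "emeasure \<kappa> (space \<kappa>) = \<infinity>"
    "\<And>B. B \<in> sets X \<Longrightarrow> emeasure \<nu> (squeeze -` B \<inter> space X) + emeasure \<kappa> B = emeasure X B"
proof -
  have X: "sigma_finite_measure X" unfolding X_def using N by (rule sigma_finite_extend_base)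
  have [measurable]: "squeeze \<in> measurable X X" "Inl \<in> measurable N X" "Inr \<in> measurable borel X"
    unfolding X_def by measurable
  obtain h :: "'a + real \<Rightarrow> real" where [measurable]: "h \<in> borel_measurable X"
    and h: "\<And>x. 0 \<le> h x" "\<And>x. h x \<le> 1" and \<nu>: "\<nu> = density X (\<lambda>x. ennreal (h x))"
    by (rule dominated_density[OF X sets le]) (auto intro: that)
  define g where "g = case_sum (\<lambda>x. h (Inl x)) (\<lambda>r. h (Inr (r / 2)) / 2)"
  have [measurable]: "g \<in> borel_measurable X"
    unfolding g_def X_def by (rule measurable_case_sum_extend) (simp_all add: X_def[symmetric])
  have g: "0 \<le> g z" "g z \<le> 1" for z
  proof -
    have "0 \<le> g z \<and> g z \<le> 1"
    proof (cases z)
      case (Inl x)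
      then show ?thesis using h[of "Inl x"] by (simp add: g_def)
    next
      case (Inr r)
      then show ?thesis using h[of "Inr (r / 2)"] by (simp add: g_def)
    qed
    then show "0 \<le> g z" "g z \<le> 1" by blast+
  qed
  have ge: "emeasure \<nu> (squeeze -` B \<inter> space X) = (\<integral>\<^sup>+z. ennreal (g z) * indicator B z \<partial>X)"
    if [measurable]: "B \<in> sets X" for B
  proof -
    have "emeasure \<nu> (squeeze -` B \<inter> space X)
        = (\<integral>\<^sup>+z. ennreal (h z) * indicator (squeeze -` B \<inter> space X) z \<partial>X)"
      unfolding \<nu> by (rule emeasure_density) auto
    also have "\<dots> = (\<integral>\<^sup>+z. ennreal (h z) * indicator B (squeeze z) \<partial>X)"
      by (intro nn_integral_cong) (auto split: split_indicator)
    also have "\<dots> = (\<integral>\<^sup>+x. ennreal (h (Inl x)) * indicator B (Inl x) \<partial>N)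
        + (\<integral>\<^sup>+r. ennreal (h (Inr r)) * indicator B (Inr (2 * r)) \<partial>lborel)"
      unfolding X_def by (subst nn_integral_extend_base) (simp_all add: X_def[symmetric])
    also have "(\<integral>\<^sup>+r. ennreal (h (Inr r)) * indicator B (Inr (2 * r)) \<partial>lborel)
       = (\<integral>\<^sup>+r. ennreal (g (Inr r)) * indicator B (Inr r) \<partial>lborel)"
    proof -
      have "(\<integral>\<^sup>+r. ennreal (g (Inr r)) * indicator B (Inr r) \<partial>lborel)
          = ennreal 2 * (\<integral>\<^sup>+r. ennreal (g (Inr (2 * r))) * indicator B (Inr (2 * r)) \<partial>lborel)"
        by (subst nn_integral_real_affine[where c = 2 and t = 0]) simp_all
      also have "\<dots> = (\<integral>\<^sup>+r. ennreal 2 * (ennreal (g (Inr (2 * r))) * indicator B (Inr (2 * r))) \<partial>lborel)"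
        by (rule nn_integral_cmult[symmetric]) simp
      also have "\<dots> = (\<integral>\<^sup>+r. ennreal (h (Inr r)) * indicator B (Inr (2 * r)) \<partial>lborel)"
      proof (rule nn_integral_cong)
        fix r
        have "ennreal 2 * ennreal (g (Inr (2 * r))) = ennreal (h (Inr r))"
          using h(1) by (subst ennreal_mult[symmetric]) (auto simp: g_def)
        then show "ennreal 2 * (ennreal (g (Inr (2 * r))) * indicator B (Inr (2 * r)))
            = ennreal (h (Inr r)) * indicator B (Inr (2 * r))"
          by (simp only: mult.assoc[symmetric])
      qed
      finally show ?thesis by simp
    qed
    also have "(\<integral>\<^sup>+x. ennreal (h (Inl x)) * indicator B (Inl x) \<partial>N) + \<dots>
        = (\<integral>\<^sup>+z. ennreal (g z) * indicator B z \<partial>X)"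
      unfolding X_def by (subst nn_integral_extend_base, simp add: X_def[symmetric]) (simp add: g_def)
    finally show ?thesis .
  qed
  let ?\<kappa> = "density X (\<lambda>z. ennreal (1 - g z))"
  have "sigma_finite_measure ?\<kappa>"
    by (rule sigma_finite_measure_mono[OF X]) (use g in \<open>auto intro!: density_le\<close>)
  moreover have "emeasure ?\<kappa> (space ?\<kappa>) = \<infinity>"
  proof -
    have "(\<infinity>::ennreal) = (\<integral>\<^sup>+r. ennreal (1/2) \<partial>(lborel::real measure))"
      by (simp add: ennreal_mult_top)
    also have "\<dots> \<le> (\<integral>\<^sup>+r. ennreal (1 - g (Inr r)) \<partial>lborel)"
    proof (intro nn_integral_mono ennreal_leI)
      fix r show "1/2 \<le> 1 - g (Inr r)" using h(2)[of "Inr (r/2)"] by (simp add: g_def)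
    qed
    also have "\<dots> \<le> (\<integral>\<^sup>+z. ennreal (1 - g z) \<partial>X)"
      unfolding X_def by (subst nn_integral_extend_base) (simp_all add: X_def[symmetric])
    also have "\<dots> = emeasure ?\<kappa> (space ?\<kappa>)"
      by (simp add: emeasure_density cong: nn_integral_cong_simp)
    finally show ?thesis by (simp add: top_unique)
  qed
  moreover have "emeasure \<nu> (squeeze -` B \<inter> space X) + emeasure ?\<kappa> B = emeasure X B"
    if [measurable]: "B \<in> sets X" for B
  proof -
    have "emeasure \<nu> (squeeze -` B \<inter> space X) + emeasure ?\<kappa> B
      = (\<integral>\<^sup>+z. ennreal (g z) * indicator B z + ennreal (1 - g z) * indicator B z \<partial>X)"
      by (simp add: ge emeasure_density nn_integral_add)
    also have "\<dots> = (\<integral>\<^sup>+z. indicator B z \<partial>X)"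
      using g by (intro nn_integral_cong)
        (auto split: split_indicator simp: ennreal_plus[symmetric] simp del: ennreal_plus)
    finally show ?thesis by simp
  qed
  ultimately show ?thesis by (intro that[of ?\<kappa>]) auto
qed

text \<open>The parts of \<open>X1\<close> and \<open>X2\<close> that a partial coupling misses may
  have different masses, say 0 and 1, and then they admit no coupling. After squeezing, both missing
  parts are infinite and sigma-finite, so a coupling of them exists; adding it to the squeezed
  partial coupling repairs both marginals.\<close>

lemma complete_coupling:
  fixes N1 :: "'a measure" and N2 :: "'b measure"
  defines "X1 \<equiv> extend_base N1" and "X2 \<equiv> extend_base N2"
  assumes N: "sigma_finite_measure N1" "sigma_finite_measure N2"
    and sets: "sets \<mu> = sets (X1 \<Otimes>\<^sub>M X2)"
    and le1: "\<And>B. B \<in> sets X1 \<Longrightarrow> emeasure (distr \<mu> X1 fst) B \<le> emeasure X1 B"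
    and le2: "\<And>B. B \<in> sets X2 \<Longrightarrow> emeasure (distr \<mu> X2 snd) B \<le> emeasure X2 B"
  shows "\<exists>\<mu>'\<in>couplings X1 X2. \<forall>E\<in>sets (X1 \<Otimes>\<^sub>M X2).
    emeasure (distr \<mu> (X1 \<Otimes>\<^sub>M X2) (map_prod squeeze squeeze)) E \<le> emeasure \<mu>' E"
proof -
  note [measurable_cong] = sets
  have space: "space \<mu> = space X1 \<times> space X2"
    using sets_eq_imp_space_eq[OF sets] by (simp add: space_pair_measure)
  have [measurable]: "squeeze \<in> measurable X1 X1" "squeeze \<in> measurable X2 X2"
    unfolding X1_def X2_def by measurable
  have \<psi>[measurable]: "map_prod squeeze squeeze \<in> measurable \<mu> (X1 \<Otimes>\<^sub>M X2)"
    unfolding map_prod_def case_prod_beta' by measurable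
  obtain \<kappa>1 where \<kappa>1: "sets \<kappa>1 = sets X1" "sigma_finite_measure \<kappa>1" "emeasure \<kappa>1 (space \<kappa>1) = \<infinity>"
    "\<And>B. B \<in> sets X1 \<Longrightarrow> emeasure (distr \<mu> X1 fst) (squeeze -` B \<inter> space X1) + emeasure \<kappa>1 B = emeasure X1 B"
    unfolding X1_def by (rule squeeze_complement[OF N(1), of "distr \<mu> X1 fst"])
      (use le1 in \<open>auto simp: X1_def intro: that\<close>)
  obtain \<kappa>2 where \<kappa>2: "sets \<kappa>2 = sets X2" "sigma_finite_measure \<kappa>2" "emeasure \<kappa>2 (space \<kappa>2) = \<infinity>"
    "\<And>B. B \<in> sets X2 \<Longrightarrow> emeasure (distr \<mu> X2 snd) (squeeze -` B \<inter> space X2) + emeasure \<kappa>2 B = emeasure X2 B"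
    unfolding X2_def by (rule squeeze_complement[OF N(2), of "distr \<mu> X2 snd"])
      (use le2 in \<open>auto simp: X2_def intro: that\<close>)
  obtain \<kappa> where \<kappa>: "\<kappa> \<in> couplings \<kappa>1 \<kappa>2"
    using infinite_measures_coupling[OF \<kappa>1(2,3) \<kappa>2(2,3)] by blast
  have sets\<kappa>[measurable_cong]: "sets \<kappa> = sets (X1 \<Otimes>\<^sub>M X2)"
    using \<kappa> sets_pair_measure_cong[OF \<kappa>1(1) \<kappa>2(1)] by (simp add: couplings_def)
  have \<kappa>m: "distr \<kappa> X1 fst = \<kappa>1" "distr \<kappa> X2 snd = \<kappa>2"
    using \<kappa> distr_cong[OF refl \<kappa>1(1), of \<kappa> fst fst] distr_cong[OF refl \<kappa>2(1), of \<kappa> snd snd]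
    by (simp_all add: couplings_def)
  let ?D = "distr \<mu> (X1 \<Otimes>\<^sub>M X2) (map_prod squeeze squeeze)"
  let ?\<mu>' = "add_measure ?D \<kappa>"
  have em: "emeasure ?\<mu>' E = emeasure ?D E + emeasure \<kappa> E" if "E \<in> sets (X1 \<Otimes>\<^sub>M X2)" for E
    using that by (subst emeasure_add_measure) (simp_all add: sets\<kappa>)
  \<comment> \<open>One computation serves both projections; beyond measurability and the identity
    for the missing mass, it uses only that they commute with \<open>squeeze\<close>.\<close>
  have marginal: "distr ?\<mu>' X p = X"
    if p[measurable]: "p \<in> measurable (X1 \<Otimes>\<^sub>M X2) X" and sq: "squeeze \<in> measurable X X"
      and comm: "\<And>a b. p (squeeze a, squeeze b) = squeeze (p (a, b))" and \<kappa>': "distr \<kappa> X p = \<kappa>'"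
      and compl: "\<And>B. B \<in> sets X \<Longrightarrow>
        emeasure (distr \<mu> X p) (squeeze -` B \<inter> space X) + emeasure \<kappa>' B = emeasure X B"
    for p :: "('a + real) \<times> ('b + real) \<Rightarrow> 'c + real" and X \<kappa>'
  proof (rule measure_eqI)
    fix B assume "B \<in> sets (distr ?\<mu>' X p)"
    then have B[measurable]: "B \<in> sets X" by simp
    let ?E = "p -` B \<inter> space (X1 \<Otimes>\<^sub>M X2)"
    have E: "?E \<in> sets (X1 \<Otimes>\<^sub>M X2)" by (rule measurable_sets[OF p B])
    have p\<mu>: "p \<in> measurable \<mu> X" by measurable
    have "emeasure (distr ?\<mu>' X p) B = emeasure ?\<mu>' ?E"
      by (subst emeasure_distr) simp_all
    also have "\<dots> = emeasure ?D ?E + emeasure \<kappa> ?E" by (rule em[OF E])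
    also have "emeasure ?D ?E = emeasure \<mu> (map_prod squeeze squeeze -` ?E \<inter> space \<mu>)"
      by (rule emeasure_distr[OF \<psi> E])
    also have "map_prod squeeze squeeze -` ?E \<inter> space \<mu> = p -` (squeeze -` B \<inter> space X) \<inter> space \<mu>"
      using measurable_space[OF \<psi>] measurable_space[OF p\<mu>] by (auto simp: comm)
    also have "emeasure \<mu> \<dots> = emeasure (distr \<mu> X p) (squeeze -` B \<inter> space X)"
      by (rule emeasure_distr[OF p\<mu> measurable_sets[OF sq B], symmetric])
    also have "emeasure \<kappa> ?E = emeasure \<kappa>' B"
      unfolding \<kappa>'[symmetric] by (subst emeasure_distr) (simp_all add: sets_eq_imp_space_eq[OF sets\<kappa>])
    finally show "emeasure (distr ?\<mu>' X p) B = emeasure X B" using compl[OF B] by simp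
  qed simp
  have "distr ?\<mu>' X1 fst = X1" "distr ?\<mu>' X2 snd = X2"
    by (rule marginal[OF _ _ _ \<kappa>m(1) \<kappa>1(4)] marginal[OF _ _ _ \<kappa>m(2) \<kappa>2(4)]; simp)+
  then have "?\<mu>' \<in> couplings X1 X2" by (simp add: couplings_def)
  moreover have "\<forall>E\<in>sets (X1 \<Otimes>\<^sub>M X2). emeasure ?D E \<le> emeasure ?\<mu>' E"
    by (simp add: em)
  ultimately show ?thesis by blast
qed

subsection \<open>Cut norms\<close>

text \<open>A bound on \<open>cut_norm\<close> in real terms, so that no supremum in
  \<open>ereal\<close> has to be handled.\<close>

definition cut_bounded :: "'a measure \<Rightarrow> ('a \<Rightarrow> 'a \<Rightarrow> real) \<Rightarrow> real \<Rightarrow> bool" where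
  "cut_bounded M U \<epsilon> \<longleftrightarrow>
    (\<forall>A\<in>sets M. \<forall>B\<in>sets M. \<bar>LINT z:A \<times> B|M \<Otimes>\<^sub>M M. U (fst z) (snd z)\<bar> \<le> \<epsilon>)"

lemma cut_norm_le_iff: "cut_norm M U \<le> ereal \<epsilon> \<longleftrightarrow> cut_bounded M U \<epsilon>"
  unfolding cut_norm_def cut_bounded_def by (auto simp: SUP_le_iff)

lemma cut_norm_nonneg: "0 \<le> cut_norm M U"
  unfolding cut_norm_def by (rule SUP_upper2[of "({}, {})"]) auto

lemma pair_measure_mono:
  assumes "sigma_finite_measure M" "sigma_finite_measure M'" and sets: "sets M' = sets M"
    and le: "\<And>E. E \<in> sets M \<Longrightarrow> emeasure M' E \<le> emeasure M E"
  shows "M' \<Otimes>\<^sub>M M' \<le> M \<Otimes>\<^sub>M M"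
proof -
  interpret M: sigma_finite_measure M by fact
  interpret M': sigma_finite_measure M' by fact
  have "M' \<le> M" using le sets by (simp add: le_measure)
  have s: "sets (M' \<Otimes>\<^sub>M M') = sets (M \<Otimes>\<^sub>M M)" by (intro sets_pair_measure_cong sets)
  have "emeasure (M' \<Otimes>\<^sub>M M') E \<le> emeasure (M \<Otimes>\<^sub>M M) E" if E: "E \<in> sets (M \<Otimes>\<^sub>M M)" for E
  proof -
    have "emeasure (M' \<Otimes>\<^sub>M M') E = (\<integral>\<^sup>+x. emeasure M' (Pair x -` E) \<partial>M')"
      using E s by (intro M'.emeasure_pair_measure_alt) simp
    also have "\<dots> \<le> (\<integral>\<^sup>+x. emeasure M (Pair x -` E) \<partial>M')"
      using sets_Pair1[OF E] by (intro nn_integral_mono le) auto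
    also have "\<dots> \<le> (\<integral>\<^sup>+x. emeasure M (Pair x -` E) \<partial>M)"
      using sets \<open>M' \<le> M\<close> by (rule nn_integral_mono_measure)
    also have "\<dots> = emeasure (M \<Otimes>\<^sub>M M) E"
      using E by (intro M.emeasure_pair_measure_alt[symmetric])
    finally show ?thesis .
  qed
  then show ?thesis using s by (simp add: le_measure)
qed

lemma integrable_mono_measure:
  fixes F :: "'a \<Rightarrow> real"
  assumes "sets M' = sets M" "M' \<le> M" "integrable M F"
  shows "integrable M' F"
proof -
  have "F \<in> borel_measurable M'"
    using assms(1) borel_measurable_integrable[OF assms(3)] by (simp cong: measurable_cong_sets)
  moreover have "(\<integral>\<^sup>+x. norm (F x) \<partial>M') < \<infinity>"
    using nn_integral_mono_measure[OF assms(1,2), of "\<lambda>x. norm (F x)"] assms(3)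
    by (auto simp: integrable_iff_bounded intro: le_less_trans)
  ultimately show ?thesis by (simp add: integrable_iff_bounded)
qed

lemma integral_mono_measure_nonneg:
  fixes F :: "'a \<Rightarrow> real"
  assumes "sets M' = sets M" "M' \<le> M" "integrable M F" "\<And>x. x \<in> space M \<Longrightarrow> 0 \<le> F x"
  shows "integral\<^sup>L M' F \<le> integral\<^sup>L M F"
proof -
  have "ennreal (integral\<^sup>L M' F) = (\<integral>\<^sup>+x. F x \<partial>M')"
    using assms sets_eq_imp_space_eq[OF assms(1)]
    by (intro nn_integral_eq_integral[symmetric] integrable_mono_measure[OF assms(1-3)]) auto
  also have "\<dots> \<le> (\<integral>\<^sup>+x. F x \<partial>M)" by (rule nn_integral_mono_measure[OF assms(1,2)])
  also have "\<dots> = ennreal (integral\<^sup>L M F)"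
    using assms by (intro nn_integral_eq_integral) auto
  finally show ?thesis
    using assms by (subst (asm) ennreal_le_iff) (auto intro: integral_nonneg_AE)
qed

text \<open>The integral lost on \<open>E\<close> and the integral lost on its complement are both
  nonnegative and add up to the total loss.\<close>

lemma set_integral_deviation:
  fixes F :: "'a \<Rightarrow> real"
  assumes le: "sets M' = sets M" "M' \<le> M" and F: "integrable M F" "\<And>x. x \<in> space M \<Longrightarrow> 0 \<le> F x"
    and E: "E \<in> sets M"
  shows "0 \<le> (LINT x:E|M. F x) - (LINT x:E|M'. F x)"
    and "(LINT x:E|M. F x) - (LINT x:E|M'. F x) \<le> integral\<^sup>L M F - integral\<^sup>L M' F"
proof -
  have i: "integrable M (\<lambda>x. indicator B x *\<^sub>R F x)" if "B \<in> sets M" for B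
    using F(1) that by (rule integrable_mult_indicator[rotated])
  have ge: "(LINT x:B|M'. F x) \<le> (LINT x:B|M. F x)" if "B \<in> sets M" for B
    unfolding set_lebesgue_integral_def
    by (rule integral_mono_measure_nonneg[OF le i[OF that]]) (use F(2) in auto)
  show "0 \<le> (LINT x:E|M. F x) - (LINT x:E|M'. F x)" using ge[OF E] by simp
  have split: "integral\<^sup>L N F = (LINT x:E|N. F x) + (LINT x:space M - E|N. F x)"
    if N: "integrable N F" "sets N = sets M" for N
  proof -
    have sp: "space N = space M" using N(2) by (rule sets_eq_imp_space_eq)
    have "integral\<^sup>L N F = (\<integral>x. indicator E x *\<^sub>R F x + indicator (space M - E) x *\<^sub>R F x \<partial>N)"
      by (rule Bochner_Integration.integral_cong) (auto split: split_indicator simp: sp)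
    also have "\<dots> = (LINT x:E|N. F x) + (LINT x:space M - E|N. F x)"
      unfolding set_lebesgue_integral_def using N E
      by (intro Bochner_Integration.integral_add integrable_mult_indicator) auto
    finally show ?thesis .
  qed
  have "space M - E \<in> sets M" using E by auto
  then show "(LINT x:E|M. F x) - (LINT x:E|M'. F x) \<le> integral\<^sup>L M F - integral\<^sup>L M' F"
    using split[OF F(1) refl] split[OF integrable_mono_measure[OF le F(1)] le(1)]
      ge[of "space M - E"] by simp
qed

lemma set_integral_diff_real:
  fixes F1 F2 :: "'a \<Rightarrow> real"
  assumes "integrable M F1" "integrable M F2" "E \<in> sets M"
  shows "(LINT x:E|M. F1 x - F2 x) = (LINT x:E|M. F1 x) - (LINT x:E|M. F2 x)"
  unfolding set_lebesgue_integral_def scaleR_diff_right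
  by (intro Bochner_Integration.integral_diff integrable_mult_indicator assms)

text \<open>Passing to the larger measure raises the integrals of \<open>F1\<close> and
  \<open>F2\<close> over any rectangle by amounts between 0 and the total gain. This carries a cut
  bound from a partial coupling to a full coupling that dominates it.\<close>

lemma cut_bounded_dominating:
  fixes M M' :: "'a measure"
  assumes sf: "sigma_finite_measure M" "sigma_finite_measure M'" and sets: "sets M' = sets M"
    and le: "\<And>E. E \<in> sets M \<Longrightarrow> emeasure M' E \<le> emeasure M E"
    and F1: "integrable (M \<Otimes>\<^sub>M M) (\<lambda>z. F1 (fst z) (snd z))"
      "\<And>x y. x \<in> space M \<Longrightarrow> y \<in> space M \<Longrightarrow> 0 \<le> F1 x y"
    and F2: "integrable (M \<Otimes>\<^sub>M M) (\<lambda>z. F2 (fst z) (snd z))"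
      "\<And>x y. x \<in> space M \<Longrightarrow> y \<in> space M \<Longrightarrow> 0 \<le> F2 x y"
    and cut: "cut_bounded M' (\<lambda>x y. F1 x y - F2 x y) \<epsilon>"
    and e1: "(\<integral>z. F1 (fst z) (snd z) \<partial>(M \<Otimes>\<^sub>M M)) - (\<integral>z. F1 (fst z) (snd z) \<partial>(M' \<Otimes>\<^sub>M M')) \<le> e1"
    and e2: "(\<integral>z. F2 (fst z) (snd z) \<partial>(M \<Otimes>\<^sub>M M)) - (\<integral>z. F2 (fst z) (snd z) \<partial>(M' \<Otimes>\<^sub>M M')) \<le> e2"
  shows "cut_bounded M (\<lambda>x y. F1 x y - F2 x y) (\<epsilon> + e1 + e2)"
  unfolding cut_bounded_def
proof (intro ballI)
  fix A B assume AB: "A \<in> sets M" "B \<in> sets M"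
  have s: "sets (M' \<Otimes>\<^sub>M M') = sets (M \<Otimes>\<^sub>M M)" by (intro sets_pair_measure_cong sets)
  have m: "M' \<Otimes>\<^sub>M M' \<le> M \<Otimes>\<^sub>M M" by (rule pair_measure_mono[OF sf sets le])
  have E: "A \<times> B \<in> sets (M \<Otimes>\<^sub>M M)" using AB by simp
  have nn: "0 \<le> F1 (fst z) (snd z)" "0 \<le> F2 (fst z) (snd z)" if "z \<in> space (M \<Otimes>\<^sub>M M)" for z
    using that F1(2) F2(2) by (auto simp: space_pair_measure)
  have cut': "\<bar>LINT z:A \<times> B|M' \<Otimes>\<^sub>M M'. F1 (fst z) (snd z) - F2 (fst z) (snd z)\<bar> \<le> \<epsilon>"
    using cut AB sets unfolding cut_bounded_def by simp
  show "\<bar>LINT z:A \<times> B|M \<Otimes>\<^sub>M M. F1 (fst z) (snd z) - F2 (fst z) (snd z)\<bar> \<le> \<epsilon> + e1 + e2"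
    using set_integral_deviation[OF s m F1(1) nn(1) E] set_integral_deviation[OF s m F2(1) nn(2) E]
      cut' e1 e2 E s
    by (simp add: set_integral_diff_real F1(1) F2(1) integrable_mono_measure[OF s m])
qed

text \<open>Rectangles pull back to rectangles, so the image measure tests no new sets.\<close>

lemma cut_bounded_distr:
  assumes sf: "sigma_finite_measure (distr M N f)" and f[measurable]: "f \<in> measurable M N"
    and U: "(\<lambda>z. U (fst z) (snd z)) \<in> borel_measurable (N \<Otimes>\<^sub>M N)"
    and cut: "cut_bounded M (\<lambda>x y. U (f x) (f y)) \<epsilon>"
  shows "cut_bounded (distr M N f) U \<epsilon>"
  unfolding cut_bounded_def
proof (intro ballI)
  fix A B assume "A \<in> sets (distr M N f)" "B \<in> sets (distr M N f)"
  then have [measurable]: "A \<in> sets N" "B \<in> sets N" by simp_all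
  have [measurable]: "(\<lambda>z. indicator (A \<times> B) z *\<^sub>R U (fst z) (snd z)) \<in> borel_measurable (N \<Otimes>\<^sub>M N)"
    using U by measurable
  have "(LINT z:A \<times> B|distr M N f \<Otimes>\<^sub>M distr M N f. U (fst z) (snd z))
      = (LINT z:(f -` A \<inter> space M) \<times> (f -` B \<inter> space M)|M \<Otimes>\<^sub>M M. U (f (fst z)) (f (snd z)))"
  proof -
    let ?G = "\<lambda>z. indicator (A \<times> B) z *\<^sub>R U (fst z) (snd z)"
    have "(\<integral>z. ?G z \<partial>distr (M \<Otimes>\<^sub>M M) (N \<Otimes>\<^sub>M N) (\<lambda>(x, y). (f x, f y)))
        = (\<integral>z. ?G (case z of (x, y) \<Rightarrow> (f x, f y)) \<partial>(M \<Otimes>\<^sub>M M))"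
      by (rule integral_distr) measurable
    also have "\<dots> = (LINT z:(f -` A \<inter> space M) \<times> (f -` B \<inter> space M)|M \<Otimes>\<^sub>M M. U (f (fst z)) (f (snd z)))"
      unfolding set_lebesgue_integral_def
      by (rule Bochner_Integration.integral_cong) (auto split: split_indicator simp: space_pair_measure)
    finally show ?thesis
      by (simp only: pair_measure_distr[OF f f sf] set_lebesgue_integral_def)
  qed
  then show "\<bar>LINT z:A \<times> B|distr M N f \<Otimes>\<^sub>M distr M N f. U (fst z) (snd z)\<bar> \<le> \<epsilon>"
    using cut unfolding cut_bounded_def by (simp add: measurable_sets)
qed

text \<open>Restricting the measure to \<open>Z\<close> amounts to intersecting both sides of the
  rectangle with \<open>Z\<close>, and the resulting rectangles are already among those tested by
  the cut norm.\<close>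

lemma cut_bounded_indicator:
  assumes sf: "sigma_finite_measure M" and Z[measurable]: "Z \<in> sets M"
    and U: "(\<lambda>z. U (fst z) (snd z)) \<in> borel_measurable (M \<Otimes>\<^sub>M M)"
    and cut: "cut_bounded M U \<epsilon>"
  shows "cut_bounded (density M (indicator Z)) U \<epsilon>"
  unfolding cut_bounded_def
proof (intro ballI)
  fix A B assume "A \<in> sets (density M (indicator Z))" "B \<in> sets (density M (indicator Z))"
  then have [measurable]: "A \<in> sets M" "B \<in> sets M" by simp_all
  interpret M: sigma_finite_measure M by fact
  have sfd: "sigma_finite_measure (density M (indicator Z))"
    by (rule sigma_finite_measure.sigma_finite_iff_density_finite[OF sf, THEN iffD2])
       (auto intro!: AE_I2 split: split_indicator)
  have p: "density M (indicator Z) \<Otimes>\<^sub>M density M (indicator Z)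
      = density (M \<Otimes>\<^sub>M M) (\<lambda>z. ennreal (indicator (Z \<times> Z) z))"
    by (subst pair_measure_density) (auto intro!: sfd sf density_cong split: split_indicator)
  have "(LINT z:A \<times> B|density M (indicator Z) \<Otimes>\<^sub>M density M (indicator Z). U (fst z) (snd z))
      = (LINT z:(A \<inter> Z) \<times> (B \<inter> Z)|M \<Otimes>\<^sub>M M. U (fst z) (snd z))"
    unfolding p set_lebesgue_integral_def using U
    by (subst integral_density) (auto intro!: Bochner_Integration.integral_cong split: split_indicator)
  then show "\<bar>LINT z:A \<times> B|density M (indicator Z) \<Otimes>\<^sub>M density M (indicator Z). U (fst z) (snd z)\<bar> \<le> \<epsilon>"
    using cut unfolding cut_bounded_def by simp
qed

text \<open>The test functions are the indicators of \<open>A\<close> and \<open>B\<close> divided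
  by the square roots of their measures, so both measures have to be finite and null sets are
  treated apart.\<close>

lemma kernel_norm_rect:
  assumes sf: "sigma_finite_measure M" and k: "kernel_norm M U \<le> ereal d" and d: "0 \<le> d"
    and [measurable]: "A \<in> sets M" "B \<in> sets M"
    and fin: "emeasure M A \<noteq> \<infinity>" "emeasure M B \<noteq> \<infinity>"
  shows "\<bar>LINT z:A \<times> B|M \<Otimes>\<^sub>M M. U (fst z) (snd z)\<bar> \<le> d * sqrt (measure M A * measure M B)"
proof (cases "measure M A = 0 \<or> measure M B = 0")
  case True
  interpret sigma_finite_measure M by fact
  have "emeasure (M \<Otimes>\<^sub>M M) (A \<times> B) = 0"
    using True fin by (auto simp: emeasure_pair_measure_Times emeasure_eq_ennreal_measure)
  then have "AE z in M \<Otimes>\<^sub>M M. z \<notin> A \<times> B"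
    by (intro AE_not_in) (simp add: null_sets_def)
  then have "(LINT z:A \<times> B|M \<Otimes>\<^sub>M M. U (fst z) (snd z)) = 0"
    unfolding set_lebesgue_integral_def by (intro integral_eq_zero_AE) auto
  then show ?thesis using d by simp
next
  case False
  define a b where "a = measure M A" and "b = measure M B"
  have ab: "a > 0" "b > 0" using False by (auto simp: a_def b_def less_le)
  have norm1: "L2_norm M (\<lambda>x. s * indicator C x / sqrt (measure M C)) = 1"
    if "C \<in> sets M" "emeasure M C \<noteq> \<infinity>" "measure M C > 0" "s\<^sup>2 = 1" for C and s :: real
  proof -
    have "(\<integral>x. (s * indicator C x / sqrt (measure M C))\<^sup>2 \<partial>M) = (\<integral>x. indicator C x / measure M C \<partial>M)"
      using that(3,4) by (intro Bochner_Integration.integral_cong)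
        (auto simp: power_divide power_mult_distrib split: split_indicator)
    also have "\<dots> = 1" using that by (simp add: measure_def)
    finally show ?thesis by (simp add: L2_norm_def)
  qed
  \<comment> \<open>A sign \<open>s\<close> in the first test function gives both halves of the
    absolute value.\<close>
  have main: "s * (LINT z:A \<times> B|M \<Otimes>\<^sub>M M. U (fst z) (snd z)) \<le> d * sqrt (a * b)" if s: "s\<^sup>2 = 1" for s
  proof -
    let ?f = "\<lambda>x. s * indicator A x / sqrt (measure M A)" and ?g = "\<lambda>x. 1 * indicator B x / sqrt (measure M B)"
    let ?I = "\<lambda>f g. \<integral>(x, y). f x * U x y * g y \<partial>(M \<Otimes>\<^sub>M M)"
    have "(?f, ?g) \<in> {(f, g). f \<in> borel_measurable M \<and> g \<in> borel_measurable M \<and> L2_norm M f = 1 \<and> L2_norm M g = 1}"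
      using norm1[of A s] norm1[of B 1] fin s ab by (simp add: a_def b_def)
    from SUP_upper[OF this, of "\<lambda>(f, g). ereal (?I f g)"]
    have "ereal (?I ?f ?g) \<le> kernel_norm M U"
      unfolding kernel_norm_def prod.case .
    then have "ereal (?I ?f ?g) \<le> ereal d" using k by (rule order_trans)
    then have "?I ?f ?g \<le> d" by (simp only: ereal_less_eq)
    also have "(\<integral>(x, y). ?f x * U x y * ?g y \<partial>(M \<Otimes>\<^sub>M M))
        = (\<integral>z. s / sqrt (a * b) * (indicator (A \<times> B) z *\<^sub>R U (fst z) (snd z)) \<partial>(M \<Otimes>\<^sub>M M))"
      by (rule Bochner_Integration.integral_cong)
         (auto simp: a_def b_def real_sqrt_mult indicator_times)
    also have "\<dots> = s / sqrt (a * b) * (LINT z:A \<times> B|M \<Otimes>\<^sub>M M. U (fst z) (snd z))"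
      unfolding set_lebesgue_integral_def by simp
    finally show ?thesis using ab by (simp add: field_simps)
  qed
  have "(-1::real)\<^sup>2 = 1" "(1::real)\<^sup>2 = 1" by simp_all
  from main[OF this(1)] main[OF this(2)] show ?thesis
    unfolding a_def b_def by simp
qed

subsection \<open>The cut norm controls the kernel norm\<close>

definition sq_integrable :: "'a measure \<Rightarrow> ('a \<Rightarrow> real) \<Rightarrow> bool" where
  "sq_integrable M f \<longleftrightarrow> f \<in> borel_measurable M \<and> integrable M (\<lambda>x. (f x)\<^sup>2)"

lemma sq_integrable_measurable [measurable_dest]: "sq_integrable M f \<Longrightarrow> f \<in> borel_measurable M"
  by (simp add: sq_integrable_def)

lemma integrable_mult_sq:
  assumes "sq_integrable M f" "sq_integrable M g"
  shows "integrable M (\<lambda>x. f x * g x)"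
proof (rule Bochner_Integration.integrable_bound)
  show "integrable M (\<lambda>x. (f x)\<^sup>2 + (g x)\<^sup>2)"
    using assms by (simp add: sq_integrable_def)
  show "(\<lambda>x. f x * g x) \<in> borel_measurable M"
    using assms[THEN sq_integrable_measurable] by (rule borel_measurable_times)
  have "\<bar>a * b\<bar> \<le> a\<^sup>2 + b\<^sup>2" for a b :: real
  proof -
    have "0 \<le> (\<bar>a\<bar> - \<bar>b\<bar>)\<^sup>2" by simp
    also have "\<dots> = a\<^sup>2 + b\<^sup>2 - 2 * \<bar>a * b\<bar>" by (simp add: power2_diff abs_mult)
    finally show ?thesis by (smt (verit) abs_ge_zero)
  qed
  then show "AE x in M. norm (f x * g x) \<le> norm ((f x)\<^sup>2 + (g x)\<^sup>2)"
    by (intro AE_I2) (auto intro: order_trans[OF _ abs_ge_self])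
qed

lemma Cauchy_Schwarz_sq:
  assumes f: "sq_integrable M f" and g: "sq_integrable M g"
  shows "(\<integral>x. f x * g x \<partial>M)\<^sup>2 \<le> (\<integral>x. (f x)\<^sup>2 \<partial>M) * (\<integral>x. (g x)\<^sup>2 \<partial>M)"
proof -
  define a b c where "a = (\<integral>x. (f x)\<^sup>2 \<partial>M)" and "b = (\<integral>x. (g x)\<^sup>2 \<partial>M)" and "c = (\<integral>x. f x * g x \<partial>M)"
  have i: "integrable M (\<lambda>x. (f x)\<^sup>2)" "integrable M (\<lambda>x. (g x)\<^sup>2)" "integrable M (\<lambda>x. f x * g x)"
    using f g integrable_mult_sq[OF f g] by (simp_all add: sq_integrable_def)
  have q: "0 \<le> s\<^sup>2 * a - 2 * s * c + b" for s
  proof -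
    have "0 \<le> (\<integral>x. (s * f x - g x)\<^sup>2 \<partial>M)" by (intro integral_nonneg_AE) auto
    also have "(\<integral>x. (s * f x - g x)\<^sup>2 \<partial>M) = (\<integral>x. s\<^sup>2 * (f x)\<^sup>2 - 2 * s * (f x * g x) + (g x)\<^sup>2 \<partial>M)"
      by (intro Bochner_Integration.integral_cong) (auto simp: power2_eq_square algebra_simps)
    also have "\<dots> = s\<^sup>2 * a - 2 * s * c + b"
      using i by (simp add: a_def b_def c_def)
    finally show ?thesis .
  qed
  have a0: "0 \<le> a" unfolding a_def by (intro integral_nonneg_AE) auto
  have "c\<^sup>2 \<le> a * b"
  proof (cases "a = 0")
    case True
    have "c = 0"
    proof (rule ccontr)
      assume c: "c \<noteq> 0"
      \<comment> \<open>For \<open>a = 0\<close> the quadratic in \<open>q\<close> is affine in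
        \<open>s\<close>, and this value of \<open>s\<close> would make it equal to -1.\<close>
      have "2 * ((b + 1) / (2 * c)) * c = b + 1" using c by (simp add: field_simps)
      then show False using q[of "(b + 1) / (2 * c)"] unfolding True by linarith
    qed
    then show ?thesis using True by simp
  next
    case False
    then have "a > 0" using a0 by simp
    have "0 \<le> (c / a)\<^sup>2 * a - 2 * (c / a) * c + b" by (rule q)
    also have "\<dots> = b - c\<^sup>2 / a" using \<open>a > 0\<close> by (simp add: power2_eq_square field_simps)
    finally show ?thesis using \<open>a > 0\<close> by (simp add: field_simps)
  qed
  then show ?thesis by (simp add: a_def b_def c_def)
qed

text \<open>The two bounds on \<open>U\<close> control its integral operator between different
  spaces: \<open>degree_U\<close> from L2 to L-infinity with constant \<open>sqrt \<Lambda>\<close>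
  (\<open>T_sup\<close>), and \<open>cut_U\<close> from L-infinity to L1 with constant
  \<open>4 * \<epsilon>\<close> (\<open>T_bounded_L1\<close>). They meet in
  \<open>T_form_le\<close>.\<close>

locale small_cut_kernel = sigma_finite_measure M for M :: "'a measure" +
  fixes U :: "'a \<Rightarrow> 'a \<Rightarrow> real" and \<epsilon> \<Lambda> :: real
  assumes integrable_U: "integrable (M \<Otimes>\<^sub>M M) (\<lambda>z. U (fst z) (snd z))"
    and symmetric_U: "\<And>x y. x \<in> space M \<Longrightarrow> y \<in> space M \<Longrightarrow> U x y = U y x"
    and bounded_U: "\<And>x y. x \<in> space M \<Longrightarrow> y \<in> space M \<Longrightarrow> \<bar>U x y\<bar> \<le> 1"
    and degree_U: "AE x in M. (\<integral>y. \<bar>U x y\<bar> \<partial>M) \<le> \<Lambda>"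
    and cut_U: "cut_bounded M U \<epsilon>"
    and \<Lambda>_pos: "0 < \<Lambda>"
begin

interpretation P: pair_sigma_finite M M by standard

lemma measurable_U [measurable]: "(\<lambda>z. U (fst z) (snd z)) \<in> borel_measurable (M \<Otimes>\<^sub>M M)"
  by (rule borel_measurable_integrable[OF integrable_U])

lemma measurable_U_pair [measurable]: "(\<lambda>(x, y). U x y) \<in> borel_measurable (M \<Otimes>\<^sub>M M)"
  using measurable_U by (simp add: case_prod_beta')

lemma \<epsilon>_nonneg: "0 \<le> \<epsilon>"
proof -
  have "\<bar>LINT z:{} \<times> {}|M \<Otimes>\<^sub>M M. U (fst z) (snd z)\<bar> \<le> \<epsilon>"
    using cut_U unfolding cut_bounded_def by blast
  then show ?thesis by simp
qed

definition T :: "('a \<Rightarrow> real) \<Rightarrow> 'a \<Rightarrow> real" where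
  "T g x = (\<integral>y. U x y * g y \<partial>M)"

lemma T_measurable [measurable]:
  assumes [measurable]: "g \<in> borel_measurable M"
  shows "T g \<in> borel_measurable M"
  unfolding T_def by measurable

lemma integrable_bounded_form:
  assumes [measurable]: "f \<in> borel_measurable M" "g \<in> borel_measurable M"
    and "\<And>x. \<bar>f x\<bar> \<le> a" "\<And>x. \<bar>g x\<bar> \<le> b"
  shows "integrable (M \<Otimes>\<^sub>M M) (\<lambda>z. f (fst z) * U (fst z) (snd z) * g (snd z))"
proof (rule Bochner_Integration.integrable_bound)
  show "integrable (M \<Otimes>\<^sub>M M) (\<lambda>z. a * b * \<bar>U (fst z) (snd z)\<bar>)"
    using integrable_U by simp
  have ab: "0 \<le> a" "0 \<le> b" using assms(3,4) abs_ge_zero order_trans by blast+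
  have "\<bar>f x * u * g y\<bar> \<le> a * b * \<bar>u\<bar>" for x y u
  proof -
    have "\<bar>f x\<bar> * \<bar>g y\<bar> \<le> a * b" using assms(3,4) ab by (intro mult_mono) auto
    then have "\<bar>f x\<bar> * \<bar>g y\<bar> * \<bar>u\<bar> \<le> a * b * \<bar>u\<bar>" by (rule mult_right_mono) simp
    then show ?thesis by (simp add: abs_mult ac_simps)
  qed
  then show "AE z in M \<Otimes>\<^sub>M M. norm (f (fst z) * U (fst z) (snd z) * g (snd z)) \<le> norm (a * b * \<bar>U (fst z) (snd z)\<bar>)"
    using ab by (intro AE_I2) (simp add: abs_mult)
qed measurable

lemma form_left:
  assumes i: "integrable (M \<Otimes>\<^sub>M M) (\<lambda>z. f (fst z) * U (fst z) (snd z) * g (snd z))"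
  shows "(\<integral>x. f x * T g x \<partial>M) = (\<integral>z. f (fst z) * U (fst z) (snd z) * g (snd z) \<partial>(M \<Otimes>\<^sub>M M))"
    and "integrable M (\<lambda>x. f x * T g x)"
  using P.integral_fst'[OF i] P.integrable_fst'[OF i] by (simp_all add: T_def mult.assoc)

text \<open>Integrating in the other order moves the operator onto the other function; here the
  symmetry of \<open>U\<close> enters.\<close>

lemma form_right:
  assumes i: "integrable (M \<Otimes>\<^sub>M M) (\<lambda>z. f (fst z) * U (fst z) (snd z) * g (snd z))"
  shows "(\<integral>y. T f y * g y \<partial>M) = (\<integral>z. f (fst z) * U (fst z) (snd z) * g (snd z) \<partial>(M \<Otimes>\<^sub>M M))"
    and "integrable M (\<lambda>y. T f y * g y)"
proof -
  let ?F = "\<lambda>x y. f x * U x y * g y"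
  have i': "integrable (M \<Otimes>\<^sub>M M) (case_prod ?F)"
    using i by (simp add: case_prod_beta')
  have *: "(\<integral>x. ?F x y \<partial>M) = T f y * g y" if y: "y \<in> space M" for y
  proof -
    have "(\<integral>x. ?F x y \<partial>M) = (\<integral>x. U y x * f x * g y \<partial>M)"
      using symmetric_U y by (intro Bochner_Integration.integral_cong) auto
    then show ?thesis by (simp add: T_def)
  qed
  show "(\<integral>y. T f y * g y \<partial>M) = (\<integral>z. f (fst z) * U (fst z) (snd z) * g (snd z) \<partial>(M \<Otimes>\<^sub>M M))"
  proof -
    have "(\<integral>y. (\<integral>x. ?F x y \<partial>M) \<partial>M) = (\<integral>y. T f y * g y \<partial>M)"
      by (intro Bochner_Integration.integral_cong refl *)
    then show ?thesis using P.integral_snd[OF i'] by (simp only: case_prod_beta')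
  qed
  show "integrable M (\<lambda>y. T f y * g y)"
  proof -
    have "integrable M (\<lambda>y. \<integral>x. ?F x y \<partial>M) \<longleftrightarrow> integrable M (\<lambda>y. T f y * g y)"
      by (intro Bochner_Integration.integrable_cong refl *)
    then show ?thesis using P.integrable_snd[OF i'] by (rule iffD1)
  qed
qed

text \<open>Split the space according to the sign of \<open>F\<close>: each part contributes at most
  \<open>c\<close>.\<close>

lemma abs_integral_le_cut:
  fixes F :: "'a \<Rightarrow> real"
  assumes F: "integrable M F"
    and b: "\<And>A. A \<in> sets M \<Longrightarrow> \<bar>\<integral>x. indicator A x * F x \<partial>M\<bar> \<le> c"
  shows "(\<integral>x. \<bar>F x\<bar> \<partial>M) \<le> 2 * c"
proof -
  have [measurable]: "F \<in> borel_measurable M" using F by (rule borel_measurable_integrable)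
  let ?A = "{x\<in>space M. 0 \<le> F x}" and ?B = "{x\<in>space M. \<not> 0 \<le> F x}"
  have AB[measurable]: "?A \<in> sets M" "?B \<in> sets M" by measurable
  have i: "integrable M (\<lambda>x. indicator A x * F x)" if "A \<in> sets M" for A
    using integrable_mult_indicator[OF that F] by simp
  have "(\<integral>x. \<bar>F x\<bar> \<partial>M) = (\<integral>x. indicator ?A x * F x - indicator ?B x * F x \<partial>M)"
    by (intro Bochner_Integration.integral_cong) (auto split: split_indicator)
  also have "\<dots> = (\<integral>x. indicator ?A x * F x \<partial>M) - (\<integral>x. indicator ?B x * F x \<partial>M)"
    by (intro Bochner_Integration.integral_diff i AB)
  also have "\<dots> \<le> 2 * c" using b[OF AB(1)] b[OF AB(2)] by linarith
  finally show ?thesis .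
qed

lemma T_indicator_L1:
  assumes [measurable]: "B \<in> sets M"
  shows "(\<integral>x. \<bar>T (indicator B) x\<bar> \<partial>M) \<le> 2 * \<epsilon>" "integrable M (T (indicator B))"
proof -
  have i: "integrable (M \<Otimes>\<^sub>M M) (\<lambda>z. indicator A (fst z) * U (fst z) (snd z) * indicator B (snd z))"
    if "A \<in> sets M" for A
    using that by (intro integrable_bounded_form[of _ _ 1 1]) (auto split: split_indicator)
  have "space M \<in> sets M" by simp
  from form_left(2)[OF i[OF this]] show int: "integrable M (T (indicator B))"
    by (rule Bochner_Integration.integrable_cong[THEN iffD1, rotated -1]) auto
  show "(\<integral>x. \<bar>T (indicator B) x\<bar> \<partial>M) \<le> 2 * \<epsilon>"
  proof (rule abs_integral_le_cut[OF int])
    fix A assume A: "A \<in> sets M"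
    have "(\<integral>x. indicator A x * T (indicator B) x \<partial>M) = (LINT z:A \<times> B|M \<Otimes>\<^sub>M M. U (fst z) (snd z))"
      unfolding form_left(1)[OF i[OF A]] set_lebesgue_integral_def
      by (intro Bochner_Integration.integral_cong) (auto split: split_indicator)
    then show "\<bar>\<integral>x. indicator A x * T (indicator B) x \<partial>M\<bar> \<le> \<epsilon>"
      using cut_U A unfolding cut_bounded_def by simp
  qed
qed

text \<open>The constant is 2 times 2: passing from indicators to functions with values in [-1, 1]
  costs a factor 2 in each variable. In between, the operator is moved onto the indicator of
  \<open>A\<close>, so that \<open>T_indicator_L1\<close> applies.\<close>

lemma T_bounded_L1:
  assumes g[measurable]: "g \<in> borel_measurable M" and g1: "\<And>x. \<bar>g x\<bar> \<le> 1"
  shows "(\<integral>x. \<bar>T g x\<bar> \<partial>M) \<le> 4 * \<epsilon>" "integrable M (T g)"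
proof -
  have i: "integrable (M \<Otimes>\<^sub>M M) (\<lambda>z. indicator A (fst z) * U (fst z) (snd z) * g (snd z))"
    if "A \<in> sets M" for A
    using that g1 by (intro integrable_bounded_form[of _ _ 1 1]) (auto split: split_indicator)
  have "space M \<in> sets M" by simp
  from form_left(2)[OF i[OF this]] show int: "integrable M (T g)"
    by (rule Bochner_Integration.integrable_cong[THEN iffD1, rotated -1]) auto
  have "(\<integral>x. \<bar>T g x\<bar> \<partial>M) \<le> 2 * (2 * \<epsilon>)"
  proof (rule abs_integral_le_cut[OF int])
    fix A assume A[measurable]: "A \<in> sets M"
    have "\<bar>\<integral>x. indicator A x * T g x \<partial>M\<bar> = \<bar>\<integral>y. T (indicator A) y * g y \<partial>M\<bar>"
      unfolding form_left(1)[OF i[OF A]] form_right(1)[OF i[OF A]] ..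
    also have "\<dots> \<le> (\<integral>y. \<bar>T (indicator A) y * g y\<bar> \<partial>M)" by (rule integral_abs_bound)
    also have "\<dots> \<le> (\<integral>y. \<bar>T (indicator A) y\<bar> \<partial>M)"
      using integrable_abs[OF form_right(2)[OF i[OF A]]] integrable_abs[OF T_indicator_L1(2)[OF A]]
    proof (rule integral_mono)
      show "\<bar>T (indicator A) y * g y\<bar> \<le> \<bar>T (indicator A) y\<bar>" for y
        using g1[of y] by (simp add: abs_mult mult_left_le)
    qed
    also have "\<dots> \<le> 2 * \<epsilon>" by (rule T_indicator_L1(1)[OF A])
    finally show "\<bar>\<integral>x. indicator A x * T g x \<partial>M\<bar> \<le> 2 * \<epsilon>" .
  qed
  then show "(\<integral>x. \<bar>T g x\<bar> \<partial>M) \<le> 4 * \<epsilon>" by simp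
qed

text \<open>The bounds on \<open>f\<close> and \<open>g\<close> hold only almost everywhere, as
  \<open>T_sup\<close> provides them. Rescaling and clamping to [-1, 1] gives functions bounded
  everywhere and changes the integral by the factor \<open>a * b\<close> alone.\<close>

lemma bounded_form_le:
  assumes [measurable]: "f \<in> borel_measurable M" "g \<in> borel_measurable M"
    and fa: "AE x in M. \<bar>f x\<bar> \<le> a" and ga: "AE x in M. \<bar>g x\<bar> \<le> b" and pos: "0 < a" "0 < b"
  shows "\<bar>\<integral>x. f x * T g x \<partial>M\<bar> \<le> 4 * \<epsilon> * a * b"
proof -
  define f' g' where "f' x = max (-1) (min 1 (f x / a))" and "g' x = max (-1) (min 1 (g x / b))" for x
  have [measurable]: "f' \<in> borel_measurable M" "g' \<in> borel_measurable M"
    unfolding f'_def g'_def by measurable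
  have b1: "\<bar>f' x\<bar> \<le> 1" "\<bar>g' x\<bar> \<le> 1" for x by (auto simp: f'_def g'_def)
  have clamp: "u = c * max (-1) (min 1 (u / c))" if "\<bar>u\<bar> \<le> c" "0 < c" for u c :: real
  proof -
    have "u / c \<le> 1" "-1 \<le> u / c" using that by (auto simp: field_simps abs_le_iff)
    then show ?thesis using that by simp
  qed
  have f': "AE x in M. f x = a * f' x"
    using fa by (rule AE_mp) (use clamp pos in \<open>auto simp: f'_def\<close>)
  have g': "AE x in M. g x = b * g' x"
    using ga by (rule AE_mp) (use clamp pos in \<open>auto simp: g'_def\<close>)
  have Tg: "T g x = b * T g' x" if "x \<in> space M" for x
  proof -
    have "T g x = (\<integral>y. b * (U x y * g' y) \<partial>M)"
      unfolding T_def using g' that by (intro integral_cong_AE) auto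
    then show ?thesis by (simp add: T_def)
  qed
  have "(\<integral>x. f x * T g x \<partial>M) = (\<integral>x. a * b * (f' x * T g' x) \<partial>M)"
  proof (rule integral_cong_AE)
    show "AE x in M. f x * T g x = a * b * (f' x * T g' x)"
      using f' AE_space by eventually_elim (simp add: Tg)
  qed measurable
  also have "\<dots> = a * b * (\<integral>x. f' x * T g' x \<partial>M)" by simp
  finally have "\<bar>\<integral>x. f x * T g x \<partial>M\<bar> = a * b * \<bar>\<integral>x. f' x * T g' x \<partial>M\<bar>"
    using pos by (simp add: abs_mult)
  also have "\<bar>\<integral>x. f' x * T g' x \<partial>M\<bar> \<le> 4 * \<epsilon>"
  proof -
    have "integrable M (\<lambda>x. f' x * T g' x)"
      by (rule form_left(2)[OF integrable_bounded_form[of _ _ 1 1]]) (use b1 in auto)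
    then have "(\<integral>x. \<bar>f' x * T g' x\<bar> \<partial>M) \<le> (\<integral>x. \<bar>T g' x\<bar> \<partial>M)"
      using T_bounded_L1(2)[of g'] b1
      by (intro integral_mono integrable_abs) (auto simp: abs_mult mult_left_le_one_le)
    also have "\<dots> \<le> 4 * \<epsilon>" using b1 by (intro T_bounded_L1(1)) auto
    finally show ?thesis by (rule order_trans[OF integral_abs_bound])
  qed
  finally show ?thesis using pos by (simp add: mult.commute mult.left_commute)
qed

lemma integrable_sq_form:
  assumes f: "sq_integrable M f" and g: "sq_integrable M g"
  shows "integrable (M \<Otimes>\<^sub>M M) (\<lambda>z. f (fst z) * U (fst z) (snd z) * g (snd z))"
proof (rule Bochner_Integration.integrable_bound)
  note [measurable] = sq_integrable_measurable[OF f] sq_integrable_measurable[OF g]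
  have "integrable (M \<Otimes>\<^sub>M M) (\<lambda>(x, y). (f x)\<^sup>2 * (g y)\<^sup>2)"
    using f g by (intro P.Fubini_integrable) (auto simp: sq_integrable_def)
  then have "integrable (M \<Otimes>\<^sub>M M) (\<lambda>z. (f (fst z))\<^sup>2 * (g (snd z))\<^sup>2)"
    by (simp add: case_prod_beta')
  then show "integrable (M \<Otimes>\<^sub>M M) (\<lambda>z. \<bar>U (fst z) (snd z)\<bar> + (f (fst z))\<^sup>2 * (g (snd z))\<^sup>2)"
    using integrable_U by simp
  \<comment> \<open>On a space of infinite measure the product of \<open>f\<close> and
    \<open>g\<close> need not be integrable, although its square is. In the bound
    \<open>1 + (a * b)\<^sup>2\<close> the summand 1 becomes integrable through the factor
    \<open>\<bar>u\<bar>\<close>.\<close>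
  have "\<bar>a * u * b\<bar> \<le> \<bar>u\<bar> + a\<^sup>2 * b\<^sup>2" if "\<bar>u\<bar> \<le> 1" for a b u :: real
  proof -
    have "\<bar>a * b\<bar> \<le> 1 + (a * b)\<^sup>2"
      using zero_le_power2[of "\<bar>a * b\<bar> - 1"] by (simp add: power2_diff)
    then have "\<bar>a * b\<bar> * \<bar>u\<bar> \<le> (1 + (a * b)\<^sup>2) * \<bar>u\<bar>" by (rule mult_right_mono) simp
    also have "\<dots> \<le> \<bar>u\<bar> + (a * b)\<^sup>2" using that by (simp add: distrib_right mult_left_le)
    finally show ?thesis by (simp add: abs_mult power_mult_distrib ac_simps)
  qed
  then show "AE z in M \<Otimes>\<^sub>M M. norm (f (fst z) * U (fst z) (snd z) * g (snd z))
      \<le> norm (\<bar>U (fst z) (snd z)\<bar> + (f (fst z))\<^sup>2 * (g (snd z))\<^sup>2)"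
    using bounded_U by (intro AE_I2) (auto simp: space_pair_measure)
qed (use f g in \<open>auto simp: sq_integrable_def\<close>)

text \<open>Cauchy-Schwarz in \<open>y\<close>. Because \<open>U\<close> is bounded by 1, its square
  is at most its absolute value, which turns the L2 norm of the section into a degree.\<close>

lemma T_pointwise:
  assumes f: "sq_integrable M f"
  shows "AE x in M. (T f x)\<^sup>2 \<le> (\<integral>y. \<bar>U x y\<bar> \<partial>M) * (\<integral>y. (f y)\<^sup>2 \<partial>M)"
proof -
  have "AE x in M. integrable M (\<lambda>y. U x y)"
    using P.AE_integrable_fst'[OF integrable_U] by simp
  then show ?thesis
  proof (rule AE_mp, intro AE_I2 impI)
    fix x assume x[measurable]: "x \<in> space M" and i: "integrable M (\<lambda>y. U x y)"
    have sq: "(U x y)\<^sup>2 \<le> \<bar>U x y\<bar>" if "y \<in> space M" for y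
    proof -
      have "(U x y)\<^sup>2 = \<bar>U x y\<bar> * \<bar>U x y\<bar>" by (simp add: power2_eq_square)
      also have "\<dots> \<le> \<bar>U x y\<bar>" using bounded_U[OF x that] by (intro mult_left_le) auto
      finally show ?thesis .
    qed
    have i2: "integrable M (\<lambda>y. (U x y)\<^sup>2)"
      using sq i by (intro Bochner_Integration.integrable_bound[OF i]) (auto intro!: AE_I2)
    then have "sq_integrable M (U x)"
      using borel_measurable_integrable[OF i] by (simp add: sq_integrable_def)
    from Cauchy_Schwarz_sq[OF this f]
    have "(T f x)\<^sup>2 \<le> (\<integral>y. (U x y)\<^sup>2 \<partial>M) * (\<integral>y. (f y)\<^sup>2 \<partial>M)" by (simp add: T_def)
    also have "\<dots> \<le> (\<integral>y. \<bar>U x y\<bar> \<partial>M) * (\<integral>y. (f y)\<^sup>2 \<partial>M)"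
      using sq i i2 by (intro mult_right_mono integral_mono integral_nonneg_AE) auto
    finally show "(T f x)\<^sup>2 \<le> (\<integral>y. \<bar>U x y\<bar> \<partial>M) * (\<integral>y. (f y)\<^sup>2 \<partial>M)" .
  qed
qed

lemma T_sq_integrable:
  assumes f: "sq_integrable M f"
  shows "sq_integrable M (T f)"
proof -
  note [measurable] = sq_integrable_measurable[OF f]
  have "integrable M (\<lambda>x. (\<integral>y. \<bar>U x y\<bar> \<partial>M) * (\<integral>y. (f y)\<^sup>2 \<partial>M))"
    using P.integrable_fst'[OF integrable_abs[OF integrable_U]] by simp
  then have "integrable M (\<lambda>x. (T f x)\<^sup>2)"
  proof (rule Bochner_Integration.integrable_bound)
    show "AE x in M. norm ((T f x)\<^sup>2) \<le> norm ((\<integral>y. \<bar>U x y\<bar> \<partial>M) * (\<integral>y. (f y)\<^sup>2 \<partial>M))"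
      using T_pointwise[OF f]
    proof eventually_elim
      fix x assume "(T f x)\<^sup>2 \<le> (\<integral>y. \<bar>U x y\<bar> \<partial>M) * (\<integral>y. (f y)\<^sup>2 \<partial>M)"
      then show "norm ((T f x)\<^sup>2) \<le> norm ((\<integral>y. \<bar>U x y\<bar> \<partial>M) * (\<integral>y. (f y)\<^sup>2 \<partial>M))"
        unfolding real_norm_def abs_power2 by (rule order_trans[OF _ abs_ge_self])
    qed
  qed measurable
  then show ?thesis by (simp add: sq_integrable_def)
qed

lemma T_sup:
  assumes f: "sq_integrable M f"
  shows "AE x in M. \<bar>T f x\<bar> \<le> sqrt (\<Lambda> * (\<integral>y. (f y)\<^sup>2 \<partial>M))"
  using T_pointwise[OF f] degree_U
proof eventually_elim
  fix x assume "(T f x)\<^sup>2 \<le> (\<integral>y. \<bar>U x y\<bar> \<partial>M) * (\<integral>y. (f y)\<^sup>2 \<partial>M)" "(\<integral>y. \<bar>U x y\<bar> \<partial>M) \<le> \<Lambda>"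
  then have "(T f x)\<^sup>2 \<le> \<Lambda> * (\<integral>y. (f y)\<^sup>2 \<partial>M)"
    by (elim order_trans) (intro mult_right_mono integral_nonneg_AE, auto)
  then show "\<bar>T f x\<bar> \<le> sqrt (\<Lambda> * (\<integral>y. (f y)\<^sup>2 \<partial>M))"
    using real_le_rsqrt by (simp add: real_le_rsqrt)
qed

lemma T_self_adjoint:
  assumes "sq_integrable M f" "sq_integrable M g"
  shows "(\<integral>x. f x * T g x \<partial>M) = (\<integral>x. T f x * g x \<partial>M)"
  using form_left(1)[OF integrable_sq_form[OF assms]] form_right(1)[OF integrable_sq_form[OF assms]]
  by simp

text \<open>
  The function \<open>T f\<close> is bounded by \<open>sqrt \<Lambda>\<close> times the norm of \<open>f\<close>. Hence the cut norm controls the quadratic form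
  of \<open>T^3\<close>, and for the self-adjoint operator \<open>T\<close> the norm of \<open>T^3\<close> is the cube of that of \<open>T\<close>.
\<close>
lemma T_form_le:
  assumes f: "sq_integrable M f" "(\<integral>x. (f x)\<^sup>2 \<partial>M) = 1"
    and g: "sq_integrable M g" "(\<integral>x. (g x)\<^sup>2 \<partial>M) = 1"
  shows "(\<integral>x. f x * T g x \<partial>M) \<le> root 3 (4 * \<epsilon> * \<Lambda>)"
proof -
  define t where "t = (\<integral>x. f x * T g x \<partial>M)"
  define n1 n2 n3 where "n1 = (\<integral>x. (T g x)\<^sup>2 \<partial>M)" and "n2 = (\<integral>x. (T (T g) x)\<^sup>2 \<partial>M)"
    and "n3 = (\<integral>x. (T (T (T g)) x)\<^sup>2 \<partial>M)"
  have nn: "0 \<le> n1" "0 \<le> n2" "0 \<le> n3" unfolding n1_def n2_def n3_def by (auto intro!: integral_nonneg_AE)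
  note s1 = T_sq_integrable[OF g(1)]
  note s2 = T_sq_integrable[OF s1]
  note s3 = T_sq_integrable[OF s2]
  \<comment> \<open>\<open>n1\<close>, \<open>n2\<close>, \<open>n3\<close> are the squared norms of
    the first three iterates of \<open>T\<close> on \<open>g\<close>. The inequalities
    \<open>t1\<close>, \<open>t2\<close>, \<open>t3\<close> give \<open>t\<^sup>2 \<le> n1\<close>
    and \<open>n1 ^ 4 \<le> n2\<^sup>2 \<le> n1 * n3\<close>, hence \<open>n1 ^ 3 \<le> n3\<close>:
    this is how the norm of the cube controls the cube of the norm.\<close>
  have t1: "t\<^sup>2 \<le> n1" using Cauchy_Schwarz_sq[OF f(1) s1] f(2) by (simp add: t_def n1_def)
  have "n1 = (\<integral>x. g x * T (T g) x \<partial>M)"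
    using T_self_adjoint[OF g(1) s1] by (simp add: n1_def power2_eq_square)
  then have t2: "n1\<^sup>2 \<le> n2" using Cauchy_Schwarz_sq[OF g(1) s2] g(2) by (simp add: n2_def)
  have "n2 = (\<integral>x. T g x * T (T (T g)) x \<partial>M)"
    using T_self_adjoint[OF s1 s2] by (simp add: n2_def power2_eq_square)
  then have t3: "n2\<^sup>2 \<le> n1 * n3" using Cauchy_Schwarz_sq[OF s1 s3] by (simp add: n1_def n3_def)
  \<comment> \<open>\<open>n3\<close> is rewritten as the form of \<open>T\<close> at
    \<open>T (T (T (T g)))\<close> and \<open>T g\<close>. Both arguments are images under
    \<open>T\<close>, so \<open>T_sup\<close> bounds them by \<open>sqrt (\<Lambda> * n3)\<close>
    and \<open>sqrt \<Lambda>\<close>, and \<open>n3\<close> ends up below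
    \<open>k * sqrt n3\<close>.\<close>
  have e: "n3 = (\<integral>x. T (T (T (T g))) x * T (T g) x \<partial>M)"
    using T_self_adjoint[OF s3 s2] by (simp add: n3_def power2_eq_square)
  define k where "k = 4 * \<epsilon> * \<Lambda>"
  have k0: "0 \<le> k" using \<epsilon>_nonneg \<Lambda>_pos by (simp add: k_def)
  have t4: "n3 \<le> k\<^sup>2"
  proof (cases "n3 = 0")
    case False
    then have n3: "0 < n3" using nn by simp
    have "n3 \<le> 4 * \<epsilon> * sqrt (\<Lambda> * n3) * sqrt \<Lambda>"
    proof -
      have "\<bar>n3\<bar> \<le> 4 * \<epsilon> * sqrt (\<Lambda> * n3) * sqrt \<Lambda>"
        unfolding e using T_sup[OF s3] T_sup[OF g(1)] n3 \<Lambda>_pos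
          sq_integrable_measurable[OF T_sq_integrable[OF s3]] sq_integrable_measurable[OF s1]
        by (intro bounded_form_le) (simp_all add: n3_def[symmetric] g(2) e[symmetric])
      then show ?thesis by simp
    qed
    also have "\<dots> = k * sqrt n3" using \<Lambda>_pos by (simp add: k_def real_sqrt_mult)
    finally have "sqrt n3 * sqrt n3 \<le> k * sqrt n3" using n3 by simp
    then have "sqrt n3 \<le> k" by (rule mult_right_le_imp_le) (use n3 in simp)
    then have "(sqrt n3)\<^sup>2 \<le> k\<^sup>2" using n3 by (intro power_mono) auto
    then show ?thesis using n3 by simp
  qed simp
  have "\<bar>t\<bar> ^ 3 \<le> k"
  proof (cases "n1 = 0")
    case True
    then show ?thesis using t1 k0 by simp
  next
    case False
    then have n1: "0 < n1" using nn by simp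
    have "n1 ^ 3 * n1 = (n1\<^sup>2)\<^sup>2" by (simp add: eval_nat_numeral)
    also have "\<dots> \<le> n2\<^sup>2" using t2 by (intro power_mono) auto
    also have "\<dots> \<le> k\<^sup>2 * n1" using t3 mult_left_mono[OF t4 nn(1)] by (simp add: mult.commute)
    finally have "n1 ^ 3 \<le> k\<^sup>2" using n1 by simp
    moreover have "(\<bar>t\<bar> ^ 3)\<^sup>2 \<le> n1 ^ 3"
    proof -
      have "(\<bar>t\<bar> ^ 3)\<^sup>2 = (t\<^sup>2) ^ 3" by (metis power2_abs power_mult mult.commute)
      also have "\<dots> \<le> n1 ^ 3" using t1 by (intro power_mono) auto
      finally show ?thesis .
    qed
    ultimately have "(\<bar>t\<bar> ^ 3)\<^sup>2 \<le> k\<^sup>2" by simp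
    then show ?thesis using k0 by (rule power2_le_imp_le)
  qed
  then have "root 3 (\<bar>t\<bar> ^ 3) \<le> root 3 k" by (intro real_root_le_mono) auto
  then show ?thesis by (simp add: real_root_power_cancel t_def[symmetric] k_def)
qed

lemma kernel_norm_le: "kernel_norm M U \<le> ereal (root 3 (4 * \<epsilon> * \<Lambda>))"
  unfolding kernel_norm_def
proof (rule SUP_least)
  fix p assume "p \<in> {(f, g). f \<in> borel_measurable M \<and> g \<in> borel_measurable M \<and> L2_norm M f = 1 \<and> L2_norm M g = 1}"
  then obtain f g where p: "p = (f, g)" and fg: "f \<in> borel_measurable M" "g \<in> borel_measurable M" "L2_norm M f = 1" "L2_norm M g = 1"
    by blast
  have "(\<integral>x. (h x)\<^sup>2 \<partial>M) = 1 \<and> sq_integrable M h" if "h \<in> borel_measurable M" "L2_norm M h = 1" for h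
  proof -
    have "(\<integral>x. (h x)\<^sup>2 \<partial>M) = 1" using that(2) by (simp add: L2_norm_def)
    then show ?thesis using that(1) not_integrable_integral_eq[of M "\<lambda>x. (h x)\<^sup>2"]
      by (auto simp: sq_integrable_def)
  qed
  then have f: "sq_integrable M f" "(\<integral>x. (f x)\<^sup>2 \<partial>M) = 1" and g: "sq_integrable M g" "(\<integral>x. (g x)\<^sup>2 \<partial>M) = 1"
    using fg by blast+
  have "(\<integral>(x, y). f x * U x y * g y \<partial>(M \<Otimes>\<^sub>M M)) = (\<integral>x. f x * T g x \<partial>M)"
    using form_left(1)[OF integrable_sq_form[OF f(1) g(1)]] by (simp add: case_prod_beta')
  then show "(case p of (f, g) \<Rightarrow> ereal (\<integral>(x, y). f x * U x y * g y \<partial>(M \<Otimes>\<^sub>M M))) \<le> ereal (root 3 (4 * \<epsilon> * \<Lambda>))"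
    using T_form_le[OF f g] by (simp add: p)
qed

text \<open>Meant for the marginal term of \<open>kernel_d\<close>. The degree is \<open>T\<close>
  applied to the constant 1, so its L1 norm is at most \<open>2 * \<epsilon>\<close>, while its
  absolute value is almost everywhere at most \<open>\<Lambda>\<close>; the integral of its square
  is at most the product of the two.\<close>

lemma degree_L2:
  "(\<integral>x. (\<integral>y. U x y \<partial>M)\<^sup>2 \<partial>M) \<le> 2 * \<epsilon> * \<Lambda>"
proof -
  have D: "T (indicator (space M)) x = (\<integral>y. U x y \<partial>M)" for x
    unfolding T_def by (intro Bochner_Integration.integral_cong) auto
  have i: "integrable M (\<lambda>x. \<integral>y. U x y \<partial>M)"
    using T_indicator_L1(2)[of "space M"] by (simp add: D[abs_def])
  have l: "AE x in M. \<bar>\<integral>y. U x y \<partial>M\<bar> \<le> \<Lambda>"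
    using degree_U
  proof eventually_elim
    fix x assume "(\<integral>y. \<bar>U x y\<bar> \<partial>M) \<le> \<Lambda>"
    then show "\<bar>\<integral>y. U x y \<partial>M\<bar> \<le> \<Lambda>" by (rule order_trans[OF integral_abs_bound])
  qed
  have "(\<integral>x. (\<integral>y. U x y \<partial>M)\<^sup>2 \<partial>M) \<le> (\<integral>x. \<Lambda> * \<bar>\<integral>y. U x y \<partial>M\<bar> \<partial>M)"
  proof (rule integral_mono_AE')
    show "integrable M (\<lambda>x. \<Lambda> * \<bar>\<integral>y. U x y \<partial>M\<bar>)" using i by simp
    show "AE x in M. (\<integral>y. U x y \<partial>M)\<^sup>2 \<le> \<Lambda> * \<bar>\<integral>y. U x y \<partial>M\<bar>"
      using l
    proof eventually_elim
      fix x assume "\<bar>\<integral>y. U x y \<partial>M\<bar> \<le> \<Lambda>"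
      then have "\<bar>\<integral>y. U x y \<partial>M\<bar> * \<bar>\<integral>y. U x y \<partial>M\<bar> \<le> \<Lambda> * \<bar>\<integral>y. U x y \<partial>M\<bar>"
        by (rule mult_right_mono) simp
      then show "(\<integral>y. U x y \<partial>M)\<^sup>2 \<le> \<Lambda> * \<bar>\<integral>y. U x y \<partial>M\<bar>"
        by (simp add: power2_eq_square)
    qed
    show "AE x in M. 0 \<le> \<Lambda> * \<bar>\<integral>y. U x y \<partial>M\<bar>" using \<Lambda>_pos by simp
  qed
  also have "\<dots> = \<Lambda> * (\<integral>x. \<bar>\<integral>y. U x y \<partial>M\<bar> \<partial>M)" by simp
  also have "\<dots> \<le> \<Lambda> * (2 * \<epsilon>)"
    using T_indicator_L1(1)[of "space M"] \<Lambda>_pos by (intro mult_left_mono) (simp_all add: D)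
  finally show ?thesis by (simp add: ac_simps)
qed

end

subsection \<open>Graphons and couplings\<close>

lemma emeasure_extend_base:
  "A \<in> sets M \<Longrightarrow> B \<in> sets lborel \<Longrightarrow> emeasure (extend_base M) (A <+> B) = emeasure M A + emeasure lborel B"
  unfolding extend_base_def by (rule emeasure_sum_measure)

lemma Inl_image_sets [measurable (raw)]: "A \<in> sets M \<Longrightarrow> Inl ` A \<in> sets (extend_base M)"
  using Plus_in_sets_sum_measure[of A M "{}" lborel] by (simp add: extend_base_def Plus_def)

lemma emeasure_extend_base_Inl:
  "A \<in> sets M \<Longrightarrow> emeasure (extend_base M) (Inl ` A) = emeasure M A"
  using emeasure_extend_base[of A M "{}"] by (simp add: Plus_def)

lemma distr_Inl_extend_base:
  "distr M (extend_base M) Inl = density (extend_base M) (indicator (Inl ` space M))"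
proof (rule measure_eqI)
  fix X assume "X \<in> sets (distr M (extend_base M) Inl)"
  then have X: "X \<in> sets (extend_base M)" by simp
  then obtain A B where AB: "X = A <+> B" "A \<in> sets M" "B \<in> sets lborel"
    unfolding extend_base_def sets_sum_measure by blast
  have "Inl ` space M \<inter> X = Inl ` A"
    using sets.sets_into_space[OF AB(2)] unfolding AB by auto
  then show "emeasure (distr M (extend_base M) Inl) X
      = emeasure (density (extend_base M) (indicator (Inl ` space M))) X"
    using X AB by (simp add: emeasure_restricted emeasure_distr emeasure_extend_base_Inl)
qed simp

text \<open>The product measure of the extension, restricted to \<open>L \<times> L\<close>, is the
  image of \<open>M \<Otimes>\<^sub>M M\<close> under the embedding; both claims are transported
  along this identity.\<close>

lemma extend_integral:
  fixes M :: "'a measure" and F :: "('a + real) \<times> ('a + real) \<Rightarrow> real"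
  defines "L \<equiv> Inl ` space M"
  assumes M: "sigma_finite_measure M"
    and F[measurable]: "F \<in> borel_measurable (extend_base M \<Otimes>\<^sub>M extend_base M)"
    and F0: "\<And>z. z \<in> space (extend_base M \<Otimes>\<^sub>M extend_base M) \<Longrightarrow> z \<notin> L \<times> L \<Longrightarrow> F z = 0"
  shows "integral\<^sup>L (extend_base M \<Otimes>\<^sub>M extend_base M) F = (\<integral>z. F (map_prod Inl Inl z) \<partial>(M \<Otimes>\<^sub>M M))"
    and "integrable (extend_base M \<Otimes>\<^sub>M extend_base M) F \<longleftrightarrow> integrable (M \<Otimes>\<^sub>M M) (\<lambda>z. F (map_prod Inl Inl z))"
proof -
  let ?X = "extend_base M"
  have X: "sigma_finite_measure ?X" using M by (rule sigma_finite_extend_base)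
  have L[measurable]: "L \<in> sets ?X" unfolding L_def by (rule Inl_image_sets) simp
  let ?D = "density ?X (indicator L)"
  have D: "distr M ?X Inl = ?D" unfolding L_def by (rule distr_Inl_extend_base)
  have sD: "sigma_finite_measure ?D"
    by (rule sigma_finite_measure_mono[OF X]) (auto simp: emeasure_restricted intro!: emeasure_mono)
  have "?D \<Otimes>\<^sub>M ?D = density (?X \<Otimes>\<^sub>M ?X) (\<lambda>z. ennreal (indicator (L \<times> L) z))"
    by (subst pair_measure_density) (auto intro!: sD X density_cong split: split_indicator)
  moreover have "?D \<Otimes>\<^sub>M ?D = distr (M \<Otimes>\<^sub>M M) (?X \<Otimes>\<^sub>M ?X) (\<lambda>(x, y). (Inl x, Inl y))"
    unfolding D[symmetric] by (rule pair_measure_distr) (simp_all add: D sD)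
  ultimately have eq: "density (?X \<Otimes>\<^sub>M ?X) (\<lambda>z. ennreal (indicator (L \<times> L) z))
      = distr (M \<Otimes>\<^sub>M M) (?X \<Otimes>\<^sub>M ?X) (map_prod Inl Inl)"
    by (simp add: map_prod_def)
  have [measurable]: "map_prod Inl Inl \<in> measurable (M \<Otimes>\<^sub>M M) (?X \<Otimes>\<^sub>M ?X)"
    unfolding map_prod_def by measurable
  have FL: "indicator (L \<times> L) z *\<^sub>R F z = F z" if "z \<in> space (?X \<Otimes>\<^sub>M ?X)" for z
    using F0[OF that] by (auto split: split_indicator)
  have "integral\<^sup>L (?X \<Otimes>\<^sub>M ?X) F = integral\<^sup>L (density (?X \<Otimes>\<^sub>M ?X) (\<lambda>z. ennreal (indicator (L \<times> L) z))) F"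
  proof -
    have "integral\<^sup>L (?X \<Otimes>\<^sub>M ?X) F = (\<integral>z. indicator (L \<times> L) z *\<^sub>R F z \<partial>(?X \<Otimes>\<^sub>M ?X))"
      by (intro Bochner_Integration.integral_cong refl FL[symmetric])
    then show ?thesis by (subst integral_density) auto
  qed
  also have "\<dots> = (\<integral>z. F (map_prod Inl Inl z) \<partial>(M \<Otimes>\<^sub>M M))"
    unfolding eq by (rule integral_distr) measurable
  finally show "integral\<^sup>L (?X \<Otimes>\<^sub>M ?X) F = (\<integral>z. F (map_prod Inl Inl z) \<partial>(M \<Otimes>\<^sub>M M))" .
  have "integrable (?X \<Otimes>\<^sub>M ?X) F \<longleftrightarrow> integrable (density (?X \<Otimes>\<^sub>M ?X) (\<lambda>z. ennreal (indicator (L \<times> L) z))) F"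
  proof -
    have "integrable (?X \<Otimes>\<^sub>M ?X) F \<longleftrightarrow> integrable (?X \<Otimes>\<^sub>M ?X) (\<lambda>z. indicator (L \<times> L) z *\<^sub>R F z)"
      by (intro Bochner_Integration.integrable_cong refl FL[symmetric])
    then show ?thesis by (subst integrable_density) auto
  qed
  also have "\<dots> \<longleftrightarrow> integrable (M \<Otimes>\<^sub>M M) (\<lambda>z. F (map_prod Inl Inl z))"
    unfolding eq by (rule integrable_distr_eq) measurable
  finally show "integrable (?X \<Otimes>\<^sub>M ?X) F \<longleftrightarrow> integrable (M \<Otimes>\<^sub>M M) (\<lambda>z. F (map_prod Inl Inl z))" .
qed

lemma pair_distr_integral:
  fixes F :: "_ \<Rightarrow> real"
  assumes "sigma_finite_measure (distr \<mu> N p)" and p[measurable]: "p \<in> measurable \<mu> N"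
    and [measurable]: "F \<in> borel_measurable (N \<Otimes>\<^sub>M N)"
  shows "integral\<^sup>L (distr \<mu> N p \<Otimes>\<^sub>M distr \<mu> N p) F = (\<integral>z. F (p (fst z), p (snd z)) \<partial>(\<mu> \<Otimes>\<^sub>M \<mu>))"
    and "integrable (distr \<mu> N p \<Otimes>\<^sub>M distr \<mu> N p) F \<longleftrightarrow> integrable (\<mu> \<Otimes>\<^sub>M \<mu>) (\<lambda>z. F (p (fst z), p (snd z)))"
  unfolding pair_measure_distr[OF p p assms(1)]
  by (subst integral_distr integrable_distr_eq, measurable, simp add: case_prod_beta')+

lemma integrable_graphonD:
  assumes "integrable_graphon M W"
  shows "sigma_finite_measure M"
    and "(\<lambda>(x, y). W x y) \<in> borel_measurable (M \<Otimes>\<^sub>M M)"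
    and "(\<lambda>z. W (fst z) (snd z)) \<in> borel_measurable (M \<Otimes>\<^sub>M M)"
    and "integrable (M \<Otimes>\<^sub>M M) (\<lambda>z. W (fst z) (snd z))"
    and "\<And>x y. x \<in> space M \<Longrightarrow> y \<in> space M \<Longrightarrow> W x y = W y x"
    and "\<And>x y. x \<in> space M \<Longrightarrow> y \<in> space M \<Longrightarrow> 0 \<le> W x y"
    and "\<And>x y. x \<in> space M \<Longrightarrow> y \<in> space M \<Longrightarrow> W x y \<le> 1"
  using assms unfolding integrable_graphon_def graphon_def by (auto simp: case_prod_beta')

text \<open>For the nonnegative kernels used here this is the L1 norm, and for a graphex without
  star and isolated part it is \<open>rho\<close>.\<close>

definition mass :: "'a measure \<Rightarrow> ('a \<Rightarrow> 'a \<Rightarrow> real) \<Rightarrow> real" where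
  "mass M W = (\<integral>z. W (fst z) (snd z) \<partial>(M \<Otimes>\<^sub>M M))"

lemma extend_kernel_range:
  assumes "\<And>x y. x \<in> space M \<Longrightarrow> y \<in> space M \<Longrightarrow> 0 \<le> W x y \<and> W x y \<le> 1"
    and "z \<in> space (extend_base M)" "w \<in> space (extend_base M)"
  shows "0 \<le> extend_kernel W z w \<and> extend_kernel W z w \<le> 1"
  using assms by (auto simp: extend_kernel_def space_extend_base split: sum.splits)

lemma extend_kernel_symmetric:
  assumes "\<And>x y. x \<in> space M \<Longrightarrow> y \<in> space M \<Longrightarrow> W x y = W y x"
    and "z \<in> space (extend_base M)" "w \<in> space (extend_base M)"
  shows "extend_kernel W z w = extend_kernel W w z"
  using assms by (auto simp: extend_kernel_def space_extend_base split: sum.splits)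

text \<open>Stated for an arbitrary map \<open>p\<close> whose image measure is the extended
  measure, because three maps need it: the two projections of a coupling, and the identity, which
  yields integrals over the extended space itself.\<close>

lemma marginal_set_integral:
  fixes W :: "'a \<Rightarrow> 'a \<Rightarrow> real" and M :: "'a measure" and p :: "'c \<Rightarrow> 'a + real"
  defines "X \<equiv> extend_base M"
  assumes W: "integrable_graphon M W"
    and p[measurable]: "p \<in> measurable \<mu> X" and d: "distr \<mu> X p = X"
  shows "integrable (\<mu> \<Otimes>\<^sub>M \<mu>) (\<lambda>z. extend_kernel W (p (fst z)) (p (snd z)))"
    and "A \<in> sets X \<Longrightarrow> B \<in> sets X \<Longrightarrow>
      (LINT z:(p -` A \<inter> space \<mu>) \<times> (p -` B \<inter> space \<mu>)|\<mu> \<Otimes>\<^sub>M \<mu>. extend_kernel W (p (fst z)) (p (snd z)))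
      = (LINT z:(Inl -` A) \<times> (Inl -` B)|M \<Otimes>\<^sub>M M. W (fst z) (snd z))"
    and "mass \<mu> (\<lambda>x y. extend_kernel W (p x) (p y)) = mass M W"
proof -
  note W' = integrable_graphonD[OF W]
  have sX: "sigma_finite_measure X" unfolding X_def by (rule sigma_finite_extend_base[OF W'(1)])
  have [measurable]: "(\<lambda>z. extend_kernel W (fst z) (snd z)) \<in> borel_measurable (X \<Otimes>\<^sub>M X)"
    using measurable_extend_kernel[OF W'(2)] by (simp add: X_def case_prod_beta')
  have 1: "integral\<^sup>L (X \<Otimes>\<^sub>M X) F = (\<integral>z. F (p (fst z), p (snd z)) \<partial>(\<mu> \<Otimes>\<^sub>M \<mu>))"
    "integrable (X \<Otimes>\<^sub>M X) F \<longleftrightarrow> integrable (\<mu> \<Otimes>\<^sub>M \<mu>) (\<lambda>z. F (p (fst z), p (snd z)))"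
    if "F \<in> borel_measurable (X \<Otimes>\<^sub>M X)" for F :: "_ \<Rightarrow> real"
    using pair_distr_integral[of \<mu> X p F] that p by (simp_all add: d sX)
  have K0: "extend_kernel W (fst z) (snd z) = 0"
    if "z \<in> space (X \<Otimes>\<^sub>M X)" "z \<notin> Inl ` space M \<times> Inl ` space M" for z
    using that by (auto simp: X_def space_pair_measure space_extend_base extend_kernel_def)
  note ei = extend_integral[OF W'(1), folded X_def]
  have "integrable (X \<Otimes>\<^sub>M X) (\<lambda>z. extend_kernel W (fst z) (snd z))"
    using W'(4) by (subst ei(2)) (auto simp: K0, simp add: extend_kernel_def)
  then show "integrable (\<mu> \<Otimes>\<^sub>M \<mu>) (\<lambda>z. extend_kernel W (p (fst z)) (p (snd z)))"
    by (subst (asm) 1(2)) simp_all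
  show "(LINT z:(p -` A \<inter> space \<mu>) \<times> (p -` B \<inter> space \<mu>)|\<mu> \<Otimes>\<^sub>M \<mu>. extend_kernel W (p (fst z)) (p (snd z)))
      = (LINT z:(Inl -` A) \<times> (Inl -` B)|M \<Otimes>\<^sub>M M. W (fst z) (snd z))" if [measurable]: "A \<in> sets X" "B \<in> sets X" for A B
  proof -
    let ?F = "\<lambda>z. indicator (A \<times> B) z * extend_kernel W (fst z) (snd z)"
    have F[measurable]: "?F \<in> borel_measurable (X \<Otimes>\<^sub>M X)" by measurable
    have "(LINT z:(p -` A \<inter> space \<mu>) \<times> (p -` B \<inter> space \<mu>)|\<mu> \<Otimes>\<^sub>M \<mu>. extend_kernel W (p (fst z)) (p (snd z)))
       = (\<integral>z. ?F (p (fst z), p (snd z)) \<partial>(\<mu> \<Otimes>\<^sub>M \<mu>))"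
      unfolding set_lebesgue_integral_def
      by (rule Bochner_Integration.integral_cong) (auto simp: space_pair_measure split: split_indicator)
    also have "\<dots> = integral\<^sup>L (X \<Otimes>\<^sub>M X) ?F" by (rule 1(1)[OF F, symmetric])
    also have "\<dots> = (\<integral>z. ?F (map_prod Inl Inl z) \<partial>(M \<Otimes>\<^sub>M M))"
      by (rule ei(1)[OF F]) (simp add: K0)
    also have "\<dots> = (LINT z:(Inl -` A) \<times> (Inl -` B)|M \<Otimes>\<^sub>M M. W (fst z) (snd z))"
      unfolding set_lebesgue_integral_def
      by (rule Bochner_Integration.integral_cong) (auto simp: extend_kernel_def split: split_indicator)
    finally show ?thesis .
  qed
  show "mass \<mu> (\<lambda>x y. extend_kernel W (p x) (p y)) = mass M W"
  proof -
    have "mass \<mu> (\<lambda>x y. extend_kernel W (p x) (p y)) = integral\<^sup>L (X \<Otimes>\<^sub>M X) (\<lambda>z. extend_kernel W (fst z) (snd z))"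
      unfolding mass_def by (subst 1(1)) simp_all
    also have "\<dots> = mass M W"
      unfolding mass_def by (subst ei(1)) (auto simp: K0, simp add: extend_kernel_def)
    finally show ?thesis .
  qed
qed

locale coupled_graphons =
  fixes M1 :: "'a measure" and W1 and M2 :: "'b measure" and W2 and \<mu>
  assumes W1: "integrable_graphon M1 W1" and W2: "integrable_graphon M2 W2"
    and coupling: "\<mu> \<in> couplings (extend_base M1) (extend_base M2)"
begin

abbreviation "X1 \<equiv> extend_base M1"
abbreviation "X2 \<equiv> extend_base M2"
abbreviation "K1 z w \<equiv> extend_kernel W1 (fst z) (fst w)"
abbreviation "K2 z w \<equiv> extend_kernel W2 (snd z) (snd w)"

lemma sets_\<mu> [measurable_cong]: "sets \<mu> = sets (X1 \<Otimes>\<^sub>M X2)"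
  and distr_fst: "distr \<mu> X1 fst = X1" and distr_snd: "distr \<mu> X2 snd = X2"
  using coupling by (simp_all add: couplings_def)

lemma space_\<mu>: "space \<mu> = space X1 \<times> space X2"
  using sets_eq_imp_space_eq[OF sets_\<mu>] by (simp add: space_pair_measure)

lemma sigma_finite_X: "sigma_finite_measure X1" "sigma_finite_measure X2"
  using integrable_graphonD(1)[OF W1] integrable_graphonD(1)[OF W2]
  by (simp_all add: sigma_finite_extend_base)

lemma sigma_finite_\<mu>: "sigma_finite_measure \<mu>"
  using coupling sigma_finite_X(1) by (rule couplings_sigma_finite)

lemma fst_measurable_\<mu>: "fst \<in> measurable \<mu> X1" and snd_measurable_\<mu>: "snd \<in> measurable \<mu> X2"
  by measurable

lemmas K1_integral = marginal_set_integral[OF W1 fst_measurable_\<mu> distr_fst]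
lemmas K2_integral = marginal_set_integral[OF W2 snd_measurable_\<mu> distr_snd]

lemma K1_range: "z \<in> space \<mu> \<Longrightarrow> w \<in> space \<mu> \<Longrightarrow> 0 \<le> K1 z w \<and> K1 z w \<le> 1"
  using integrable_graphonD(6,7)[OF W1] by (intro extend_kernel_range) (auto simp: space_\<mu>)

lemma K2_range: "z \<in> space \<mu> \<Longrightarrow> w \<in> space \<mu> \<Longrightarrow> 0 \<le> K2 z w \<and> K2 z w \<le> 1"
  using integrable_graphonD(6,7)[OF W2] by (intro extend_kernel_range) (auto simp: space_\<mu>)

lemma K1_symmetric: "z \<in> space \<mu> \<Longrightarrow> w \<in> space \<mu> \<Longrightarrow> K1 z w = K1 w z"
  using integrable_graphonD(5)[OF W1] by (intro extend_kernel_symmetric) (auto simp: space_\<mu>)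

lemma K2_symmetric: "z \<in> space \<mu> \<Longrightarrow> w \<in> space \<mu> \<Longrightarrow> K2 z w = K2 w z"
  using integrable_graphonD(5)[OF W2] by (intro extend_kernel_symmetric) (auto simp: space_\<mu>)

lemma diff_set_integral:
  assumes "A \<in> sets \<mu>" "B \<in> sets \<mu>"
  shows "(LINT z:A \<times> B|\<mu> \<Otimes>\<^sub>M \<mu>. K1 (fst z) (snd z) - K2 (fst z) (snd z))
    = (LINT z:A \<times> B|\<mu> \<Otimes>\<^sub>M \<mu>. K1 (fst z) (snd z)) - (LINT z:A \<times> B|\<mu> \<Otimes>\<^sub>M \<mu>. K2 (fst z) (snd z))"
  using assms by (intro set_integral_diff_real K1_integral(1) K2_integral(1)) simp

text \<open>The cut norm is tested with the whole space in both variables.\<close>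

lemma mass_diff_le_cut:
  assumes "cut_bounded \<mu> (\<lambda>z w. K1 z w - K2 z w) \<epsilon>"
  shows "\<bar>mass M1 W1 - mass M2 W2\<bar> \<le> \<epsilon>"
proof -
  have "\<bar>LINT z:space \<mu> \<times> space \<mu>|\<mu> \<Otimes>\<^sub>M \<mu>. K1 (fst z) (snd z) - K2 (fst z) (snd z)\<bar> \<le> \<epsilon>"
    using assms unfolding cut_bounded_def by blast
  have total: "(LINT z:space \<mu> \<times> space \<mu>|\<mu> \<Otimes>\<^sub>M \<mu>. F (fst z) (snd z)) = mass \<mu> F" for F :: "_ \<Rightarrow> _ \<Rightarrow> real"
    unfolding mass_def set_lebesgue_integral_def
    by (intro Bochner_Integration.integral_cong) (auto simp: space_pair_measure)
  with \<open>\<bar>LINT z:space \<mu> \<times> space \<mu>|\<mu> \<Otimes>\<^sub>M \<mu>. K1 (fst z) (snd z) - K2 (fst z) (snd z)\<bar> \<le> \<epsilon>\<close>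
  show ?thesis
    using K1_integral(3) K2_integral(3) total[of K1] total[of K2] by (simp add: diff_set_integral)
qed

end

lemma cut_dist_less:
  assumes "cut_dist M1 W1 M2 W2 < ereal \<epsilon>"
  obtains \<mu> where "\<mu> \<in> couplings (extend_base M1) (extend_base M2)"
    "cut_bounded \<mu> (\<lambda>z w. extend_kernel W1 (fst z) (fst w) - extend_kernel W2 (snd z) (snd w)) \<epsilon>"
proof -
  obtain \<mu> where "\<mu> \<in> couplings (extend_base M1) (extend_base M2)"
    "cut_norm \<mu> (\<lambda>z w. extend_kernel W1 (fst z) (fst w) - extend_kernel W2 (snd z) (snd w)) < ereal \<epsilon>"
    using assms unfolding cut_dist_def by (auto simp: INF_less_iff)
  then show ?thesis using that by (auto simp: cut_norm_le_iff[symmetric] intro: less_imp_le)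
qed

lemma cut_dist_le:
  assumes "\<mu> \<in> couplings (extend_base M1) (extend_base M2)"
    "cut_bounded \<mu> (\<lambda>z w. extend_kernel W1 (fst z) (fst w) - extend_kernel W2 (snd z) (snd w)) \<epsilon>"
  shows "cut_dist M1 W1 M2 W2 \<le> ereal \<epsilon>"
  unfolding cut_dist_def using assms by (intro INF_lower2[of \<mu>]) (simp_all add: cut_norm_le_iff)

lemma cut_dist_nonneg: "0 \<le> cut_dist M1 W1 M2 W2"
  unfolding cut_dist_def by (intro INF_greatest cut_norm_nonneg)

subsection \<open>Tail regularity along a convergent sequence\<close>

context coupled_graphons
begin

text \<open>
  The restriction of the coupling to the fibres over \<open>A0\<close> projects to a measure with a density
  \<open>h \<le> 1\<close>; the superlevel set \<open>h > 1/2\<close> carries almost all of \<open>W1\<close>.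
\<close>
lemma tail_transfer:
  assumes cut: "cut_bounded \<mu> (\<lambda>z w. K1 z w - K2 z w) \<epsilon>"
    and A0[measurable]: "A0 \<in> sets M2" and m: "emeasure M2 A0 \<le> ennreal m" "0 \<le> m"
    and tail: "mass M2 W2 - (LINT z:A0 \<times> A0|M2 \<Otimes>\<^sub>M M2. W2 (fst z) (snd z)) \<le> \<epsilon>"
  shows "\<exists>A\<in>sets M1. emeasure M1 A \<le> ennreal (2 * m) \<and>
    mass M1 W1 - (LINT z:A \<times> A|M1 \<Otimes>\<^sub>M M1. W1 (fst z) (snd z)) \<le> 6 * \<epsilon>"
proof -
  interpret X1: sigma_finite_measure X1 by (rule sigma_finite_X)
  let ?K = "extend_kernel W1"
  have K[measurable]: "(\<lambda>z. ?K (fst z) (snd z)) \<in> borel_measurable (X1 \<Otimes>\<^sub>M X1)"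
    using measurable_extend_kernel[OF integrable_graphonD(2)[OF W1]] by (simp add: case_prod_beta')
  define Z where "Z = snd -` (Inl ` A0) \<inter> space \<mu>"
  have Z[measurable]: "Z \<in> sets \<mu>"
    unfolding Z_def by (rule measurable_sets[OF snd_measurable_\<mu>]) measurable
  define \<nu> where "\<nu> = density \<mu> (indicator Z)"
  have s\<nu>: "sets \<nu> = sets \<mu>" "space \<nu> = space \<mu>" by (simp_all add: \<nu>_def)
  have fst\<nu>[measurable]: "fst \<in> measurable \<nu> X1"
    using fst_measurable_\<mu> by (simp add: \<nu>_def)
  have le: "emeasure (distr \<nu> X1 fst) B \<le> emeasure X1 B" if [measurable]: "B \<in> sets X1" for B
  proof -
    have "emeasure (distr \<nu> X1 fst) B = emeasure \<mu> (Z \<inter> (fst -` B \<inter> space \<mu>))"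
      using measurable_sets[OF fst_measurable_\<mu> that]
      by (subst emeasure_distr) (simp_all add: \<nu>_def emeasure_restricted)
    also have "\<dots> \<le> emeasure \<mu> (fst -` B \<inter> space \<mu>)"
      using measurable_sets[OF fst_measurable_\<mu> that] by (intro emeasure_mono) auto
    also have "\<dots> = emeasure (distr \<mu> X1 fst) B"
      by (rule emeasure_distr[OF fst_measurable_\<mu> that, symmetric])
    finally show ?thesis by (simp only: distr_fst)
  qed
  obtain h :: "'a + real \<Rightarrow> real" where [measurable]: "h \<in> borel_measurable X1"
    and h: "\<And>x. 0 \<le> h x" "\<And>x. h x \<le> 1" and \<nu>h: "distr \<nu> X1 fst = density X1 (\<lambda>x. ennreal (h x))"
    by (rule dominated_density[OF sigma_finite_X(1) _ le]) (auto intro: that)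
  have hm: "(\<integral>\<^sup>+x. ennreal (h x) \<partial>X1) \<le> ennreal m"
  proof -
    have "(\<integral>\<^sup>+x. ennreal (h x) \<partial>X1) = emeasure (density X1 (\<lambda>x. ennreal (h x))) (space X1)"
      by (subst emeasure_density) (auto intro!: nn_integral_cong)
    also have "\<dots> = emeasure \<mu> Z"
      unfolding \<nu>h[symmetric] using sets.sets_into_space[OF Z]
      by (subst emeasure_distr) (auto simp: \<nu>_def emeasure_restricted space_\<mu> intro!: arg_cong[where f="emeasure \<mu>"])
    also have "\<dots> = emeasure (distr \<mu> X2 snd) (Inl ` A0)"
      unfolding Z_def by (rule emeasure_distr[OF snd_measurable_\<mu>, symmetric]) measurable
    also have "\<dots> = emeasure M2 A0"
      unfolding distr_snd by (rule emeasure_extend_base_Inl) measurable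
    finally show ?thesis using m(1) by simp
  qed
  \<comment> \<open>The integral of \<open>K1\<close> over \<open>Z \<times> Z\<close>, seen from
    the first space. \<open>Z\<close> is not a preimage under \<open>fst\<close>, so after
    projection only the weights \<open>h\<close> remain of it.\<close>
  define I where "I = (\<integral>z. (h (fst z) * h (snd z)) * ?K (fst z) (snd z) \<partial>(X1 \<Otimes>\<^sub>M X1))"
  have sf\<nu>: "sigma_finite_measure \<nu>"
    by (rule sigma_finite_measure_mono[OF sigma_finite_\<mu>])
       (auto simp: \<nu>_def emeasure_restricted intro!: emeasure_mono)
  have sfd: "sigma_finite_measure (density X1 (\<lambda>x. ennreal (h x)))"
    by (rule sigma_finite_measure_mono[OF sigma_finite_X(1)]) (use h in \<open>auto intro!: density_le\<close>)
  have I: "(LINT z:Z \<times> Z|\<mu> \<Otimes>\<^sub>M \<mu>. K1 (fst z) (snd z)) = I"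
  proof -
    interpret \<mu>: sigma_finite_measure \<mu> by (rule sigma_finite_\<mu>)
    have p: "\<nu> \<Otimes>\<^sub>M \<nu> = density (\<mu> \<Otimes>\<^sub>M \<mu>) (\<lambda>z. ennreal (indicator (Z \<times> Z) z))"
      unfolding \<nu>_def by (subst pair_measure_density)
        (auto intro!: sf\<nu>[unfolded \<nu>_def] sigma_finite_\<mu> density_cong split: split_indicator)
    have "(LINT z:Z \<times> Z|\<mu> \<Otimes>\<^sub>M \<mu>. K1 (fst z) (snd z)) = (\<integral>z. K1 (fst z) (snd z) \<partial>(\<nu> \<Otimes>\<^sub>M \<nu>))"
      unfolding p set_lebesgue_integral_def
      using borel_measurable_integrable[OF K1_integral(1)] by (subst integral_density) auto
    also have "\<dots> = (\<integral>z. ?K (fst z) (snd z) \<partial>(distr \<nu> X1 fst \<Otimes>\<^sub>M distr \<nu> X1 fst))"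
      by (subst pair_distr_integral(1)) (simp_all add: \<nu>h sfd)
    also have "distr \<nu> X1 fst \<Otimes>\<^sub>M distr \<nu> X1 fst
        = density (X1 \<Otimes>\<^sub>M X1) (\<lambda>z. ennreal (h (fst z) * h (snd z)))"
      unfolding \<nu>h using h by (subst pair_measure_density)
        (auto intro!: sfd sigma_finite_X density_cong simp: ennreal_mult)
    also have "(\<integral>z. ?K (fst z) (snd z) \<partial>density (X1 \<Otimes>\<^sub>M X1) (\<lambda>z. ennreal (h (fst z) * h (snd z)))) = I"
      unfolding I_def using h by (subst integral_density) auto
    finally show ?thesis .
  qed
  have "(LINT z:Z \<times> Z|\<mu> \<Otimes>\<^sub>M \<mu>. K2 (fst z) (snd z)) = (LINT z:A0 \<times> A0|M2 \<Otimes>\<^sub>M M2. W2 (fst z) (snd z))"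
  proof -
    have "(Inl :: 'b \<Rightarrow> 'b + real) -` Inl ` A0 = A0" by auto
    moreover have "Inl ` A0 \<in> sets X2" by measurable
    ultimately show ?thesis using K2_integral(2)[of "Inl ` A0" "Inl ` A0"] unfolding Z_def by simp
  qed
  moreover have "\<bar>LINT z:Z \<times> Z|\<mu> \<Otimes>\<^sub>M \<mu>. K1 (fst z) (snd z) - K2 (fst z) (snd z)\<bar> \<le> \<epsilon>"
    using cut Z unfolding cut_bounded_def by blast
  \<comment> \<open>One \<open>\<epsilon>\<close> each for the difference of the masses, the tail of
    \<open>W2\<close> off \<open>A0 \<times> A0\<close>, and the cut bound on
    \<open>Z \<times> Z\<close>.\<close>
  ultimately have "mass M1 W1 - I \<le> 3 * \<epsilon>"
    using mass_diff_le_cut[OF cut] tail diff_set_integral[OF Z Z] I by linarith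
  \<comment> \<open>Off \<open>A' \<times> A'\<close> the product of the two weights is at most 1/2,
    so there the kernel is at most twice what the weights remove; this doubles
    \<open>3 * \<epsilon>\<close>. By Markov the measure of \<open>A'\<close> is at most
    \<open>2 * m\<close>.\<close>
  define A' where "A' = {x\<in>space X1. 1/2 < h x}"
  have A'[measurable]: "A' \<in> sets X1" unfolding A'_def by measurable
  have idm: "(\<lambda>x. x) \<in> measurable X1 X1" by simp
  note mi = marginal_set_integral[OF W1 idm distr_id]
  have iK: "integrable (X1 \<Otimes>\<^sub>M X1) (\<lambda>z. ?K (fst z) (snd z))" by (rule mi(1))
  have "mass M1 W1 - 2 * (mass M1 W1 - I) \<le> (LINT z:A' \<times> A'|X1 \<Otimes>\<^sub>M X1. ?K (fst z) (snd z))"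
  proof -
    have ih: "integrable (X1 \<Otimes>\<^sub>M X1) (\<lambda>z. (h (fst z) * h (snd z)) * ?K (fst z) (snd z))"
      by (rule Bochner_Integration.integrable_bound[OF iK])
        (use h in \<open>auto simp: abs_mult intro!: AE_I2 mult_left_le_one_le mult_le_one\<close>)
    have K0: "0 \<le> ?K (fst z) (snd z)" if "z \<in> space (X1 \<Otimes>\<^sub>M X1)" for z
      using extend_kernel_range[of M1 W1 "fst z" "snd z"] integrable_graphonD(6,7)[OF W1] that
      by (auto simp: space_pair_measure)
    have "mass M1 W1 - 2 * (mass M1 W1 - I)
        = (\<integral>z. ?K (fst z) (snd z) - 2 * (?K (fst z) (snd z) - (h (fst z) * h (snd z)) * ?K (fst z) (snd z)) \<partial>(X1 \<Otimes>\<^sub>M X1))"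
      using iK ih mi(3) by (simp add: I_def mass_def)
    also have "\<dots> \<le> (LINT z:A' \<times> A'|X1 \<Otimes>\<^sub>M X1. ?K (fst z) (snd z))"
      unfolding set_lebesgue_integral_def
    proof (rule integral_mono)
      show "integrable (X1 \<Otimes>\<^sub>M X1) (\<lambda>z. ?K (fst z) (snd z) - 2 * (?K (fst z) (snd z) - (h (fst z) * h (snd z)) * ?K (fst z) (snd z)))"
        using iK ih by simp
      show "integrable (X1 \<Otimes>\<^sub>M X1) (\<lambda>z. indicator (A' \<times> A') z *\<^sub>R ?K (fst z) (snd z))"
        by (rule integrable_mult_indicator[OF _ iK]) measurable
      fix z assume z: "z \<in> space (X1 \<Otimes>\<^sub>M X1)"
      have hh: "h (fst z) * h (snd z) \<le> 1" using h by (intro mult_le_one) auto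
      show "?K (fst z) (snd z) - 2 * (?K (fst z) (snd z) - (h (fst z) * h (snd z)) * ?K (fst z) (snd z))
          \<le> indicator (A' \<times> A') z *\<^sub>R ?K (fst z) (snd z)"
      proof (cases "z \<in> A' \<times> A'")
        case True
        have "(h (fst z) * h (snd z)) * ?K (fst z) (snd z) \<le> 1 * ?K (fst z) (snd z)"
          using hh K0[OF z] by (rule mult_right_mono)
        then show ?thesis using True by simp
      next
        case False
        then have "h (fst z) \<le> 1/2 \<or> h (snd z) \<le> 1/2"
          using z by (cases z) (auto simp: A'_def space_pair_measure not_less)
        moreover have "h (fst z) * h (snd z) \<le> h (fst z)" "h (fst z) * h (snd z) \<le> h (snd z)"
          using h by (auto intro: mult_left_le mult_left_le_one_le)
        ultimately have "h (fst z) * h (snd z) \<le> 1/2" by linarith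
        then have "(h (fst z) * h (snd z)) * ?K (fst z) (snd z) \<le> 1/2 * ?K (fst z) (snd z)"
          using K0[OF z] by (rule mult_right_mono)
        then show ?thesis using False by simp
      qed
    qed
    finally show ?thesis .
  qed
  also have "\<dots> = (LINT z:(Inl -` A') \<times> (Inl -` A')|M1 \<Otimes>\<^sub>M M1. W1 (fst z) (snd z))"
  proof -
    have "(\<lambda>x. x) -` A' \<inter> space X1 = A'" using sets.sets_into_space[OF A'] by auto
    then show ?thesis using mi(2)[OF A' A'] by simp
  qed
  finally have fin: "mass M1 W1 - 2 * (mass M1 W1 - I)
      \<le> (LINT z:(Inl -` A') \<times> (Inl -` A')|M1 \<Otimes>\<^sub>M M1. W1 (fst z) (snd z))" .
  have "a - c \<le> 6 * e" if "a - 2 * (a - b) \<le> c" "a - b \<le> 3 * e" for a b c e :: real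
  proof -
    have "a - c \<le> 2 * (a - b)" using that(1) by (simp add: algebra_simps)
    also have "\<dots> \<le> 2 * (3 * e)" using that(2) by (rule mult_left_mono) simp
    finally show ?thesis by simp
  qed
  from this[OF fin \<open>mass M1 W1 - I \<le> 3 * \<epsilon>\<close>]
  have "mass M1 W1 - (LINT z:(Inl -` A') \<times> (Inl -` A')|M1 \<Otimes>\<^sub>M M1. W1 (fst z) (snd z)) \<le> 6 * \<epsilon>" .
  moreover have A: "Inl -` A' \<in> sets M1"
  proof -
    have "Inl -` A' = Inl -` A' \<inter> space M1"
      using sets.sets_into_space[OF A'] by (auto simp: space_extend_base)
    also have "\<dots> \<in> sets M1" by (rule measurable_sets[OF Inl_measurable_extend A'])
    finally show ?thesis .
  qed
  moreover have "emeasure M1 (Inl -` A') \<le> ennreal (2 * m)"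
  proof -
    have "emeasure M1 (Inl -` A') = emeasure X1 (Inl ` (Inl -` A'))"
      using A by (rule emeasure_extend_base_Inl[symmetric])
    also have "\<dots> \<le> emeasure X1 A'" by (rule emeasure_mono) auto
    also have "\<dots> = (\<integral>\<^sup>+x. indicator A' x \<partial>X1)" by simp
    also have "\<dots> \<le> (\<integral>\<^sup>+x. 2 * ennreal (h x) \<partial>X1)"
    proof (rule nn_integral_mono)
      fix x
      have "2 * ennreal (h x) = ennreal (2 * h x)" using h by (simp add: ennreal_mult)
      then show "indicator A' x \<le> 2 * ennreal (h x)"
        using h[of x] by (auto simp: A'_def split: split_indicator)
    qed
    also have "\<dots> = 2 * (\<integral>\<^sup>+x. ennreal (h x) \<partial>X1)" by (rule nn_integral_cmult) measurable
    also have "\<dots> \<le> 2 * ennreal m" using hm by (rule mult_left_mono) simp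
    also have "\<dots> = ennreal (2 * m)" using m(2) by (simp add: ennreal_mult)
    finally show ?thesis .
  qed
  ultimately show ?thesis by blast
qed

end

text \<open>Exhaust the space by sets of finite measure and apply dominated convergence to the
  integrable kernel.\<close>

lemma graphon_tail:
  assumes W: "integrable_graphon M W" and "0 < \<epsilon>"
  obtains A C where "A \<in> sets M" "emeasure M A \<le> ennreal C" "0 \<le> C"
    "mass M W - (LINT z:A \<times> A|M \<Otimes>\<^sub>M M. W (fst z) (snd z)) \<le> \<epsilon>"
proof -
  interpret sigma_finite_measure M using integrable_graphonD(1)[OF W] .
  obtain A :: "nat \<Rightarrow> 'a set" where A: "range A \<subseteq> sets M" "(\<Union>i. A i) = space M"
    "\<And>i. emeasure M (A i) \<noteq> \<infinity>" "incseq A"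
    by (rule sigma_finite_incseq) (rule that)
  have [measurable]: "A i \<in> sets M" for i using A(1) by auto
  note i = integrable_graphonD(4)[OF W]
  have "(\<lambda>i. LINT z:A i \<times> A i|M \<Otimes>\<^sub>M M. W (fst z) (snd z)) \<longlonglongrightarrow> mass M W"
    unfolding set_lebesgue_integral_def mass_def
  proof (rule integral_dominated_convergence[where w="\<lambda>z. \<bar>W (fst z) (snd z)\<bar>"])
    show "AE z in M \<Otimes>\<^sub>M M. (\<lambda>i. indicator (A i \<times> A i) z *\<^sub>R W (fst z) (snd z)) \<longlonglongrightarrow> W (fst z) (snd z)"
    proof (rule AE_I2)
      fix z assume "z \<in> space (M \<Otimes>\<^sub>M M)"
      then have "fst z \<in> (\<Union>i. A i)" "snd z \<in> (\<Union>i. A i)"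
        unfolding A(2) by (auto simp: space_pair_measure)
      then obtain j k where jk: "fst z \<in> A j" "snd z \<in> A k" by blast
      have "indicator (A i \<times> A i) z *\<^sub>R W (fst z) (snd z) = W (fst z) (snd z)" if "i \<ge> max j k" for i
      proof -
        have "A j \<subseteq> A i" "A k \<subseteq> A i" using A(4) that by (auto simp: incseq_def)
        then have "z \<in> A i \<times> A i" using jk by (cases z) auto
        then show ?thesis by simp
      qed
      then show "(\<lambda>i. indicator (A i \<times> A i) z *\<^sub>R W (fst z) (snd z)) \<longlonglongrightarrow> W (fst z) (snd z)"
        by (intro tendsto_eventually eventually_sequentiallyI)
    qed
    show "integrable (M \<Otimes>\<^sub>M M) (\<lambda>z. \<bar>W (fst z) (snd z)\<bar>)" using i by simp
    show "(\<lambda>z. W (fst z) (snd z)) \<in> borel_measurable (M \<Otimes>\<^sub>M M)" using i by simp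
    then show "(\<lambda>z. indicator (A n \<times> A n) z *\<^sub>R W (fst z) (snd z)) \<in> borel_measurable (M \<Otimes>\<^sub>M M)" for n
      by measurable
    show "AE z in M \<Otimes>\<^sub>M M. norm (indicator (A n \<times> A n) z *\<^sub>R W (fst z) (snd z)) \<le> \<bar>W (fst z) (snd z)\<bar>" for n
      by (auto split: split_indicator)
  qed
  then have "eventually (\<lambda>i. mass M W - \<epsilon> < (LINT z:A i \<times> A i|M \<Otimes>\<^sub>M M. W (fst z) (snd z))) sequentially"
    using \<open>0 < \<epsilon>\<close> by (intro order_tendstoD) auto
  then obtain n where "mass M W - \<epsilon> < (LINT z:A n \<times> A n|M \<Otimes>\<^sub>M M. W (fst z) (snd z))"
    by (auto simp: eventually_sequentially)
  then show ?thesis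
    using that[of "A n" "measure M (A n)"] A(3)[of n] by (simp add: emeasure_eq_ennreal_measure)
qed

definition tail_bounded :: "'a measure \<Rightarrow> ('a \<Rightarrow> 'a \<Rightarrow> real) \<Rightarrow> real \<Rightarrow> real \<Rightarrow> bool" where
  "tail_bounded M W \<epsilon> C \<longleftrightarrow> (\<exists>A\<in>sets M. emeasure M A \<le> ennreal C \<and>
     mass M W - (LINT z:A \<times> A|M \<Otimes>\<^sub>M M. W (fst z) (snd z)) \<le> \<epsilon>)"

lemma uniformly_tail_regular_range:
  "uniformly_tail_regular (range (\<lambda>n. (\<Omega> n, W n))) \<longleftrightarrow>
    (\<forall>\<epsilon>>0. \<exists>C. \<forall>n. tail_bounded (\<Omega> n) (W n) \<epsilon> C)"
  unfolding uniformly_tail_regular_def tail_bounded_def mass_def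
  by (simp add: case_prod_beta')

lemma cut_convergent_tail_regular:
  assumes W: "\<And>n. integrable_graphon (\<Omega> n) (W n)" and U: "integrable_graphon M U"
    and lim: "(\<lambda>n. cut_dist (\<Omega> n) (W n) M U) \<longlonglongrightarrow> 0"
  shows "uniformly_tail_regular (range (\<lambda>n. (\<Omega> n, W n)))"
  unfolding uniformly_tail_regular_range
proof (intro allI impI)
  fix \<epsilon> :: real assume "0 < \<epsilon>"
  \<comment> \<open>The 6 is the factor lost in \<open>tail_transfer\<close>.\<close>
  then have e: "0 < \<epsilon> / 6" by simp
  obtain A0 m where A0: "A0 \<in> sets M" "emeasure M A0 \<le> ennreal m" "0 \<le> m"
    "mass M U - (LINT z:A0 \<times> A0|M \<Otimes>\<^sub>M M. U (fst z) (snd z)) \<le> \<epsilon> / 6"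
    by (rule graphon_tail[OF U e])
  have "eventually (\<lambda>n. cut_dist (\<Omega> n) (W n) M U < ereal (\<epsilon> / 6)) sequentially"
    using lim e by (intro order_tendstoD(2)[of _ 0]) auto
  then obtain N where N: "cut_dist (\<Omega> n) (W n) M U < ereal (\<epsilon> / 6)" if "N \<le> n" for n
    by (auto simp: eventually_sequentially)
  have big: "tail_bounded (\<Omega> n) (W n) \<epsilon> (2 * m)" if n: "N \<le> n" for n
  proof -
    obtain \<mu> where \<mu>: "\<mu> \<in> couplings (extend_base (\<Omega> n)) (extend_base M)"
      "cut_bounded \<mu> (\<lambda>z w. extend_kernel (W n) (fst z) (fst w) - extend_kernel U (snd z) (snd w)) (\<epsilon> / 6)"
      by (rule cut_dist_less[OF N[OF n]])
    interpret coupled_graphons "\<Omega> n" "W n" M U \<mu>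
      using W[of n] U \<mu>(1) by unfold_locales
    show ?thesis
      using tail_transfer[OF \<mu>(2) A0] by (simp add: tail_bounded_def)
  qed
  have "\<exists>C. tail_bounded (\<Omega> n) (W n) \<epsilon> C" for n
    unfolding tail_bounded_def by (rule graphon_tail[OF W \<open>0 < \<epsilon>\<close>, of n]) blast
  then obtain C where C: "\<And>n. tail_bounded (\<Omega> n) (W n) \<epsilon> (C n)" by metis
  \<comment> \<open>\<open>2 * m\<close> serves every \<open>n \<ge> N\<close>; the finitely many
    remaining graphons each bring their own bound.\<close>
  define D where "D = Max (insert (2 * m) (C ` {..<N}))"
  have mono: "tail_bounded (\<Omega> n) (W n) \<epsilon> D" if "tail_bounded (\<Omega> n) (W n) \<epsilon> c" "c \<le> D" for n c
    using that unfolding tail_bounded_def by (meson ennreal_leI order_trans)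
  have "tail_bounded (\<Omega> n) (W n) \<epsilon> D" for n
  proof (cases "N \<le> n")
    case True
    then show ?thesis by (intro mono[OF big]) (auto simp: D_def)
  next
    case False
    then show ?thesis by (intro mono[OF C]) (auto simp: D_def intro!: Max_ge)
  qed
  then show "\<exists>C. \<forall>n. tail_bounded (\<Omega> n) (W n) \<epsilon> C" by blast
qed

subsection \<open>Passing between partial and full couplings\<close>

text \<open>The kernels do not see \<open>squeeze\<close>, so the squeezed partial coupling has the
  same cut bound and the same kernel masses. Completing it then costs at most the kernel masses
  \<open>e1\<close> and \<open>e2\<close> that the partial coupling missed.\<close>

lemma extend_partial_coupling:
  fixes M1 :: "'a measure" and M2 :: "'b measure"
  defines "X1 \<equiv> extend_base M1" and "X2 \<equiv> extend_base M2"
  assumes W1: "integrable_graphon M1 W1" and W2: "integrable_graphon M2 W2"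
    and sets: "sets \<mu> = sets (X1 \<Otimes>\<^sub>M X2)"
    and le1: "\<And>B. B \<in> sets X1 \<Longrightarrow> emeasure (distr \<mu> X1 fst) B \<le> emeasure X1 B"
    and le2: "\<And>B. B \<in> sets X2 \<Longrightarrow> emeasure (distr \<mu> X2 snd) B \<le> emeasure X2 B"
    and cut: "cut_bounded \<mu> (\<lambda>z w. extend_kernel W1 (fst z) (fst w) - extend_kernel W2 (snd z) (snd w)) \<epsilon>"
    and m1: "mass M1 W1 - mass \<mu> (\<lambda>z w. extend_kernel W1 (fst z) (fst w)) \<le> e1"
    and m2: "mass M2 W2 - mass \<mu> (\<lambda>z w. extend_kernel W2 (snd z) (snd w)) \<le> e2"
  shows "\<exists>\<mu>'\<in>couplings X1 X2.
    cut_bounded \<mu>' (\<lambda>z w. extend_kernel W1 (fst z) (fst w) - extend_kernel W2 (snd z) (snd w)) (\<epsilon> + e1 + e2)"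
proof -
  note s1 = integrable_graphonD(1)[OF W1] and s2 = integrable_graphonD(1)[OF W2]
  let ?\<nu> = "distr \<mu> (X1 \<Otimes>\<^sub>M X2) (map_prod squeeze squeeze)"
  obtain \<mu>' where \<mu>': "\<mu>' \<in> couplings X1 X2"
    and le: "\<And>E. E \<in> sets (X1 \<Otimes>\<^sub>M X2) \<Longrightarrow> emeasure ?\<nu> E \<le> emeasure \<mu>' E"
    using complete_coupling[OF s1 s2, folded X1_def X2_def, OF sets le1 le2] by blast
  interpret C: coupled_graphons M1 W1 M2 W2 \<mu>'
    using W1 W2 \<mu>' by unfold_locales (simp_all add: X1_def X2_def)
  note [measurable_cong] = sets
  have s\<mu>': "sets \<mu>' = sets (X1 \<Otimes>\<^sub>M X2)" using C.sets_\<mu> by (simp add: X1_def X2_def)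
  have s\<nu>: "sets ?\<nu> = sets \<mu>'" by (simp add: s\<mu>')
  have le': "emeasure ?\<nu> E \<le> emeasure \<mu>' E" if "E \<in> sets \<mu>'" for E
    using le that by (simp add: s\<mu>')
  have sf\<nu>: "sigma_finite_measure ?\<nu>"
    by (rule sigma_finite_measure_mono[OF C.sigma_finite_\<mu> s\<nu> le'])
  have [measurable]: "squeeze \<in> measurable X1 X1" "squeeze \<in> measurable X2 X2"
    unfolding X1_def X2_def by measurable
  have \<psi>[measurable]: "map_prod squeeze squeeze \<in> measurable \<mu> (X1 \<Otimes>\<^sub>M X2)"
    unfolding map_prod_def case_prod_beta' by measurable
  have p: "sets (\<mu>' \<Otimes>\<^sub>M \<mu>') = sets ((X1 \<Otimes>\<^sub>M X2) \<Otimes>\<^sub>M (X1 \<Otimes>\<^sub>M X2))"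
    by (intro sets_pair_measure_cong s\<mu>')
  have K[measurable]: "(\<lambda>z. extend_kernel W1 (fst (fst z)) (fst (snd z))) \<in> borel_measurable ((X1 \<Otimes>\<^sub>M X2) \<Otimes>\<^sub>M (X1 \<Otimes>\<^sub>M X2))"
    "(\<lambda>z. extend_kernel W2 (snd (fst z)) (snd (snd z))) \<in> borel_measurable ((X1 \<Otimes>\<^sub>M X2) \<Otimes>\<^sub>M (X1 \<Otimes>\<^sub>M X2))"
    using borel_measurable_integrable[OF C.K1_integral(1)] borel_measurable_integrable[OF C.K2_integral(1)] p
    by (simp_all cong: measurable_cong_sets)
  have mass\<nu>: "mass ?\<nu> (\<lambda>z w. extend_kernel W1 (fst z) (fst w)) = mass \<mu> (\<lambda>z w. extend_kernel W1 (fst z) (fst w))"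
    "mass ?\<nu> (\<lambda>z w. extend_kernel W2 (snd z) (snd w)) = mass \<mu> (\<lambda>z w. extend_kernel W2 (snd z) (snd w))"
    unfolding mass_def using pair_distr_integral(1)[OF sf\<nu> \<psi> K(1)] pair_distr_integral(1)[OF sf\<nu> \<psi> K(2)]
    by (simp_all add: fst_map_prod snd_map_prod)
  have cut\<nu>: "cut_bounded ?\<nu> (\<lambda>z w. extend_kernel W1 (fst z) (fst w) - extend_kernel W2 (snd z) (snd w)) \<epsilon>"
    by (rule cut_bounded_distr[OF sf\<nu> \<psi>]) (use cut K in \<open>simp_all add: fst_map_prod snd_map_prod\<close>)
  have "cut_bounded \<mu>' (\<lambda>z w. extend_kernel W1 (fst z) (fst w) - extend_kernel W2 (snd z) (snd w)) (\<epsilon> + e1 + e2)"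
  proof (rule cut_bounded_dominating[OF C.sigma_finite_\<mu> sf\<nu> s\<nu> le' C.K1_integral(1) _ C.K2_integral(1) _ cut\<nu>])
    show "0 \<le> extend_kernel W1 (fst z) (fst w)" "0 \<le> extend_kernel W2 (snd z) (snd w)"
      if "z \<in> space \<mu>'" "w \<in> space \<mu>'" for z w
      using C.K1_range[OF that] C.K2_range[OF that] by simp_all
    show "(\<integral>z. extend_kernel W1 (fst (fst z)) (fst (snd z)) \<partial>(\<mu>' \<Otimes>\<^sub>M \<mu>'))
        - (\<integral>z. extend_kernel W1 (fst (fst z)) (fst (snd z)) \<partial>(?\<nu> \<Otimes>\<^sub>M ?\<nu>)) \<le> e1"
      using m1 C.K1_integral(3) mass\<nu>(1) by (simp add: mass_def)
    show "(\<integral>z. extend_kernel W2 (snd (fst z)) (snd (snd z)) \<partial>(\<mu>' \<Otimes>\<^sub>M \<mu>'))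
        - (\<integral>z. extend_kernel W2 (snd (fst z)) (snd (snd z)) \<partial>(?\<nu> \<Otimes>\<^sub>M ?\<nu>)) \<le> e2"
      using m2 C.K2_integral(3) mass\<nu>(2) by (simp add: mass_def)
  qed
  with \<mu>' show ?thesis by blast
qed

section \<open>Small reductions of a measure and the kernel mass they cost\<close>

lemma measure_within_le: "measure_within r M N \<Longrightarrow> B \<in> sets M \<Longrightarrow> emeasure N B \<le> emeasure M B"
  by (simp add: measure_within_def)

lemma measure_within_mono:
  assumes "measure_within r M N" "r \<le> s"
  shows "measure_within s M N"
  using assms ennreal_leI[OF assms(2)] unfolding measure_within_def
  by (meson ennreal_minus_mono order_refl order_trans)

lemma measure_within_density:
  assumes "sigma_finite_measure M" "measure_within r M N"
  obtains h :: "'a \<Rightarrow> real" where "h \<in> borel_measurable M" "\<And>x. 0 \<le> h x" "\<And>x. h x \<le> 1"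
    "N = density M (\<lambda>x. ennreal (h x))" "(\<integral>\<^sup>+x. ennreal (1 - h x) \<partial>M) \<le> ennreal r"
proof -
  obtain h :: "'a \<Rightarrow> real" where h: "h \<in> borel_measurable M" "\<And>x. 0 \<le> h x" "\<And>x. h x \<le> 1"
    "N = density M (\<lambda>x. ennreal (h x))"
    by (rule dominated_density[OF assms(1) _ measure_within_le[OF assms(2)]])
      (use assms(2) in \<open>auto simp: measure_within_def intro: that\<close>)
  moreover have "(\<integral>\<^sup>+x. ennreal (1 - h x) \<partial>M) \<le> ennreal r"
    by (rule density_deficiency[OF assms(1) h(1-3)]) (use assms(2) h(4) in simp)
  ultimately show ?thesis by (rule that)
qed

text \<open>Each summand depends on one variable only, so by Fubini it contributes the deficit over
  \<open>A\<close> times the measure of \<open>A\<close>.\<close>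

lemma nn_integral_deficiency_rect:
  assumes "sigma_finite_measure M" and h[measurable]: "h \<in> borel_measurable M"
    and r: "(\<integral>\<^sup>+x. ennreal (1 - h x) \<partial>M) \<le> ennreal r" and A[measurable]: "A \<in> sets M"
    and C: "emeasure M A \<le> ennreal C" and pos: "0 \<le> r" "0 \<le> C"
    and h1: "\<And>x. h x \<le> 1"
  shows "(\<integral>\<^sup>+z. ennreal (indicator (A \<times> A) z * ((1 - h (fst z)) + (1 - h (snd z)))) \<partial>(M \<Otimes>\<^sub>M M))
    \<le> ennreal (2 * C * r)"
proof -
  interpret sigma_finite_measure M by fact
  interpret P: pair_sigma_finite M M by standard
  have "(\<integral>\<^sup>+z. ennreal (indicator (A \<times> A) z * ((1 - h (fst z)) + (1 - h (snd z)))) \<partial>(M \<Otimes>\<^sub>M M))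
    = (\<integral>\<^sup>+z. ennreal (1 - h (fst z)) * indicator A (fst z) * indicator A (snd z)
        + ennreal (1 - h (snd z)) * indicator A (snd z) * indicator A (fst z) \<partial>(M \<Otimes>\<^sub>M M))"
  proof (rule nn_integral_cong)
    fix z
    have "ennreal ((1 - h (fst z)) + (1 - h (snd z))) = ennreal (1 - h (fst z)) + ennreal (1 - h (snd z))"
      using h1 by (intro ennreal_plus) simp_all
    then show "ennreal (indicator (A \<times> A) z * ((1 - h (fst z)) + (1 - h (snd z))))
        = ennreal (1 - h (fst z)) * indicator A (fst z) * indicator A (snd z)
        + ennreal (1 - h (snd z)) * indicator A (snd z) * indicator A (fst z)"
      by (simp add: indicator_times split: split_indicator)
  qed
  also have "\<dots> = (\<integral>\<^sup>+z. ennreal (1 - h (fst z)) * indicator A (fst z) * indicator A (snd z) \<partial>(M \<Otimes>\<^sub>M M))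
      + (\<integral>\<^sup>+z. ennreal (1 - h (snd z)) * indicator A (snd z) * indicator A (fst z) \<partial>(M \<Otimes>\<^sub>M M))"
    by (rule nn_integral_add) measurable
  also have "(\<integral>\<^sup>+z. ennreal (1 - h (fst z)) * indicator A (fst z) * indicator A (snd z) \<partial>(M \<Otimes>\<^sub>M M))
      = (\<integral>\<^sup>+x. ennreal (1 - h x) * indicator A x \<partial>M) * emeasure M A"
    by (subst nn_integral_fst[symmetric]) (simp_all add: nn_integral_cmult nn_integral_multc)
  also have "(\<integral>\<^sup>+z. ennreal (1 - h (snd z)) * indicator A (snd z) * indicator A (fst z) \<partial>(M \<Otimes>\<^sub>M M))
      = (\<integral>\<^sup>+x. ennreal (1 - h x) * indicator A x \<partial>M) * emeasure M A"
    by (subst P.nn_integral_snd[symmetric]) (simp_all add: nn_integral_cmult nn_integral_multc)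
  also have "(\<integral>\<^sup>+x. ennreal (1 - h x) * indicator A x \<partial>M) \<le> (\<integral>\<^sup>+x. ennreal (1 - h x) \<partial>M)"
    by (intro nn_integral_mono) (auto split: split_indicator)
  also note r
  also note C
  also have "ennreal r * ennreal C + ennreal r * ennreal C = ennreal (2 * C * r)"
    using pos by (simp add: ennreal_mult[symmetric] ennreal_plus[symmetric] del: ennreal_plus)
  finally show ?thesis by (simp add: add_mono mult_mono)
qed

lemma mass_density:
  assumes "sigma_finite_measure M" and W: "(\<lambda>z. W (fst z) (snd z)) \<in> borel_measurable (M \<Otimes>\<^sub>M M)"
    and h: "h \<in> borel_measurable M" "\<And>x. 0 \<le> h x" "\<And>x. h x \<le> (1::real)"
  shows "density M (\<lambda>x. ennreal (h x)) \<Otimes>\<^sub>M density M (\<lambda>x. ennreal (h x))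
      = density (M \<Otimes>\<^sub>M M) (\<lambda>z. ennreal (h (fst z) * h (snd z)))" (is ?t1)
    and "mass (density M (\<lambda>x. ennreal (h x))) W = (\<integral>z. h (fst z) * h (snd z) * W (fst z) (snd z) \<partial>(M \<Otimes>\<^sub>M M))"
proof -
  note [measurable] = h(1) W
  have sfd: "sigma_finite_measure (density M (\<lambda>x. ennreal (h x)))"
    by (rule sigma_finite_measure_mono[OF assms(1)]) (use h in \<open>auto intro!: density_le\<close>)
  show ?t1
    using h by (subst pair_measure_density)
      (auto intro!: sfd assms(1) density_cong simp: ennreal_mult)
  show "mass (density M (\<lambda>x. ennreal (h x))) W = (\<integral>z. h (fst z) * h (snd z) * W (fst z) (snd z) \<partial>(M \<Otimes>\<^sub>M M))"
    unfolding mass_def \<open>?t1\<close> using h by (subst integral_density) (auto simp: mult.assoc)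
qed

text \<open>A union bound: \<open>1 - u * v\<close> is at most the sum of the two deficits, and
  \<open>w\<close> is at most 1.\<close>

lemma deficiency_pointwise:
  fixes u v w :: real
  assumes "0 \<le> u" "u \<le> 1" "0 \<le> v" "v \<le> 1" "0 \<le> w" "w \<le> 1"
  shows "w \<le> u * v * w + ((1 - u) + (1 - v))"
proof -
  have "0 \<le> (1 - u) * (1 - v)" using assms by simp
  then have "1 - u * v \<le> (1 - u) + (1 - v)" by (simp add: algebra_simps)
  moreover have "w * (1 - u * v) \<le> 1 - u * v"
    using assms by (intro mult_left_le_one_le) (auto intro: mult_le_one)
  ultimately show ?thesis by (simp add: algebra_simps)
qed

text \<open>Outside \<open>A \<times> A\<close>, with \<open>A\<close> from the tail bound, all of
  the kernel may be lost, at a cost of \<open>\<epsilon>\<close>. Inside, the kernel is at most 1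
  and the loss is bounded by the deficits of the weights.\<close>

lemma mass_loss:
  assumes W: "integrable_graphon M W" and N: "measure_within r M N" and t: "tail_bounded M W \<epsilon> C"
    and pos: "0 \<le> r" "0 \<le> C"
  shows "mass M W - mass N W \<le> \<epsilon> + 2 * C * r"
proof -
  note W' = integrable_graphonD[OF W]
  interpret sigma_finite_measure M by (rule W'(1))
  obtain h :: "'a \<Rightarrow> real" where h[measurable]: "h \<in> borel_measurable M" and h01: "\<And>x. 0 \<le> h x" "\<And>x. h x \<le> 1"
    and N: "N = density M (\<lambda>x. ennreal (h x))" and hr: "(\<integral>\<^sup>+x. ennreal (1 - h x) \<partial>M) \<le> ennreal r"
    by (rule measure_within_density[OF W'(1) N]) (auto intro: that)
  obtain A where A[measurable]: "A \<in> sets M" and C: "emeasure M A \<le> ennreal C"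
    and e: "mass M W - (LINT z:A \<times> A|M \<Otimes>\<^sub>M M. W (fst z) (snd z)) \<le> \<epsilon>"
    using t unfolding tail_bounded_def by blast
  define G where "G z = indicator (A \<times> A) z * ((1 - h (fst z)) + (1 - h (snd z)))" for z
  have Gm[measurable]: "G \<in> borel_measurable (M \<Otimes>\<^sub>M M)" unfolding G_def by measurable
  have Gn: "(\<integral>\<^sup>+z. ennreal (G z) \<partial>(M \<Otimes>\<^sub>M M)) \<le> ennreal (2 * C * r)"
    unfolding G_def by (rule nn_integral_deficiency_rect[OF W'(1) h hr A C pos h01(2)])
  have G0: "0 \<le> G z" for z
    unfolding G_def using h01(2)[of "fst z"] h01(2)[of "snd z"] by (intro mult_nonneg_nonneg) auto
  have Gi: "integrable (M \<Otimes>\<^sub>M M) G"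
    using Gn G0 by (intro integrableI_bounded) (auto intro: le_less_trans)
  have GI: "integral\<^sup>L (M \<Otimes>\<^sub>M M) G \<le> 2 * C * r"
    using Gn pos by (intro integral_real_bounded) auto
  have hW: "integrable (M \<Otimes>\<^sub>M M) (\<lambda>z. h (fst z) * h (snd z) * W (fst z) (snd z))"
    by (rule Bochner_Integration.integrable_bound[OF W'(4)])
      (use h01 W'(3) in \<open>auto simp: abs_mult intro!: AE_I2 mult_left_le_one_le mult_le_one\<close>)
  have iA: "integrable (M \<Otimes>\<^sub>M M) (\<lambda>z. indicator (A \<times> A) z *\<^sub>R W (fst z) (snd z))"
    by (rule integrable_mult_indicator[OF _ W'(4)]) measurable
  have "mass M W - mass N W
      = (\<integral>z. W (fst z) (snd z) - h (fst z) * h (snd z) * W (fst z) (snd z) \<partial>(M \<Otimes>\<^sub>M M))"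
    unfolding N mass_density(2)[OF W'(1,3) h h01] using hW W'(4) by (simp add: mass_def[of M])
  also have "\<dots> \<le> (\<integral>z. (W (fst z) (snd z) - indicator (A \<times> A) z *\<^sub>R W (fst z) (snd z)) + G z \<partial>(M \<Otimes>\<^sub>M M))"
  proof (rule integral_mono)
    fix z assume z: "z \<in> space (M \<Otimes>\<^sub>M M)"
    define u v w where "u = h (fst z)" and "v = h (snd z)" and "w = W (fst z) (snd z)"
    have uv: "0 \<le> u" "u \<le> 1" "0 \<le> v" "v \<le> 1" using h01 by (auto simp: u_def v_def)
    have w: "0 \<le> w" "w \<le> 1" using z W'(6,7) by (auto simp: w_def space_pair_measure)
    have "w - u * v * w \<le> (1 - u) + (1 - v)" using deficiency_pointwise[OF uv w] by linarith
    moreover have "0 \<le> u * v * w" using uv w by simp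
    ultimately have "w - u * v * w \<le> (w - indicator (A \<times> A) z *\<^sub>R w) + indicator (A \<times> A) z * ((1 - u) + (1 - v))"
      by (auto split: split_indicator)
    then show "W (fst z) (snd z) - h (fst z) * h (snd z) * W (fst z) (snd z)
        \<le> (W (fst z) (snd z) - indicator (A \<times> A) z *\<^sub>R W (fst z) (snd z)) + G z"
      by (simp add: u_def v_def w_def G_def)
  qed (use hW W'(4) iA Gi in simp_all)
  also have "\<dots> = (mass M W - (LINT z:A \<times> A|M \<Otimes>\<^sub>M M. W (fst z) (snd z))) + integral\<^sup>L (M \<Otimes>\<^sub>M M) G"
    using W'(4) iA Gi by (simp add: mass_def set_lebesgue_integral_def)
  also have "\<dots> \<le> \<epsilon> + 2 * C * r" using e GI by simp
  finally show ?thesis .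
qed

text \<open>Made for the limit graphex, whose kernel is not known beforehand to be integrable. Over
  a fixed set of finite measure the reduced measures lose arbitrarily little, so the integral of
  \<open>W\<close> there is at most \<open>K\<close>; monotone convergence extends this to the whole
  space.\<close>

lemma integrable_graphon_approx:
  assumes W: "graphon M W"
    and approx: "\<And>r. 0 < r \<Longrightarrow> \<exists>N. measure_within r M N \<and> integrable_graphon N W \<and> mass N W \<le> K"
  shows "integrable_graphon M W"
proof -
  have W': "(\<lambda>z. W (fst z) (snd z)) \<in> borel_measurable (M \<Otimes>\<^sub>M M)"
    "\<And>x y. x \<in> space M \<Longrightarrow> y \<in> space M \<Longrightarrow> 0 \<le> W x y \<and> W x y \<le> 1"
    using W by (auto simp: graphon_def case_prod_beta')
  note W'(1)[measurable]
  have sf: "sigma_finite_measure M" using W by (simp add: graphon_def)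
  interpret sigma_finite_measure M by (rule sf)
  obtain A :: "nat \<Rightarrow> 'a set" where A: "range A \<subseteq> sets M" "(\<Union>i. A i) = space M"
    "\<And>i. emeasure M (A i) \<noteq> \<infinity>" "incseq A"
    by (rule sigma_finite_incseq) (rule that)
  have Am[measurable]: "A i \<in> sets M" for i using A(1) by auto
  let ?w = "\<lambda>z. ennreal (W (fst z) (snd z))"
  have "(\<integral>\<^sup>+z. ?w z * indicator (A i \<times> A i) z \<partial>(M \<Otimes>\<^sub>M M)) \<le> ennreal K" for i
  proof (rule ennreal_le_epsilon)
    define C where "C = measure M (A i)"
    have C: "emeasure M (A i) \<le> ennreal C" "0 \<le> C"
      using A(3)[of i] by (simp_all add: C_def emeasure_eq_ennreal_measure)
    fix e :: real assume "0 < e"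
    \<comment> \<open>Makes \<open>2 * C * r\<close> at most \<open>e\<close>; the added 1 covers
      \<open>C = 0\<close>.\<close>
    define r where "r = e / (2 * C + 1)"
    have r: "0 < r" "2 * C * r \<le> e" using \<open>0 < e\<close> C(2) by (simp_all add: r_def field_simps)
    obtain N where wi: "measure_within r M N" and NW: "integrable_graphon N W" and NK: "mass N W \<le> K"
      using approx[OF r(1)] by blast
    obtain h :: "'a \<Rightarrow> real" where h[measurable]: "h \<in> borel_measurable M" and h01: "\<And>x. 0 \<le> h x" "\<And>x. h x \<le> 1"
      and N: "N = density M (\<lambda>x. ennreal (h x))" and hr: "(\<integral>\<^sup>+x. ennreal (1 - h x) \<partial>M) \<le> ennreal r"
      by (rule measure_within_density[OF sf wi]) (auto intro: that)
    let ?G = "\<lambda>z. indicator (A i \<times> A i) z * ((1 - h (fst z)) + (1 - h (snd z)))"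
    have "(\<integral>\<^sup>+z. ?w z * indicator (A i \<times> A i) z \<partial>(M \<Otimes>\<^sub>M M))
        \<le> (\<integral>\<^sup>+z. ennreal (h (fst z) * h (snd z)) * ?w z + ennreal (?G z) \<partial>(M \<Otimes>\<^sub>M M))"
    proof (rule nn_integral_mono)
      fix z assume z: "z \<in> space (M \<Otimes>\<^sub>M M)"
      define u v w where "u = h (fst z)" and "v = h (snd z)" and "w = W (fst z) (snd z)"
      have uv: "0 \<le> u" "u \<le> 1" "0 \<le> v" "v \<le> 1" using h01 by (auto simp: u_def v_def)
      have w: "0 \<le> w" "w \<le> 1" using z W'(2) by (auto simp: w_def space_pair_measure)
      have "w \<le> u * v * w + ((1 - u) + (1 - v))" using uv w by (rule deficiency_pointwise)
      then have "ennreal w \<le> ennreal (u * v * w + ((1 - u) + (1 - v)))" by (rule ennreal_leI)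
      also have "\<dots> = ennreal (u * v * w) + ennreal ((1 - u) + (1 - v))"
        using uv w by (intro ennreal_plus) auto
      also have "ennreal (u * v * w) = ennreal (u * v) * ennreal w"
        using uv w by (intro ennreal_mult) auto
      finally have "ennreal w \<le> ennreal (u * v) * ennreal w + ennreal ((1 - u) + (1 - v))" .
      then show "?w z * indicator (A i \<times> A i) z \<le> ennreal (h (fst z) * h (snd z)) * ?w z + ennreal (?G z)"
        unfolding u_def v_def w_def by (auto split: split_indicator)
    qed
    also have "\<dots> = (\<integral>\<^sup>+z. ennreal (h (fst z) * h (snd z)) * ?w z \<partial>(M \<Otimes>\<^sub>M M)) + (\<integral>\<^sup>+z. ennreal (?G z) \<partial>(M \<Otimes>\<^sub>M M))"
      by (rule nn_integral_add) measurable
    also have "(\<integral>\<^sup>+z. ennreal (h (fst z) * h (snd z)) * ?w z \<partial>(M \<Otimes>\<^sub>M M)) = (\<integral>\<^sup>+z. ?w z \<partial>(N \<Otimes>\<^sub>M N))"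
      unfolding N mass_density(1)[OF sf W'(1) h h01] by (rule nn_integral_density[symmetric]) measurable
    also have "(\<integral>\<^sup>+z. ?w z \<partial>(N \<Otimes>\<^sub>M N)) = ennreal (mass N W)"
      unfolding mass_def using integrable_graphonD(4,6)[OF NW]
      by (intro nn_integral_eq_integral AE_I2) (auto simp: space_pair_measure)
    also have "\<dots> \<le> ennreal K" using NK by (rule ennreal_leI)
    also have "(\<integral>\<^sup>+z. ennreal (?G z) \<partial>(M \<Otimes>\<^sub>M M)) \<le> ennreal (2 * C * r)"
      using r by (intro nn_integral_deficiency_rect[OF sf h hr Am C(1) _ C(2) h01(2)]) simp
    also have "\<dots> \<le> ennreal e" using r(2) by (rule ennreal_leI)
    finally show "(\<integral>\<^sup>+z. ?w z * indicator (A i \<times> A i) z \<partial>(M \<Otimes>\<^sub>M M)) \<le> ennreal K + ennreal e"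
      by (simp add: add_mono)
  qed
  then have "(SUP i. \<integral>\<^sup>+z. ?w z * indicator (A i \<times> A i) z \<partial>(M \<Otimes>\<^sub>M M)) \<le> ennreal K"
    by (rule SUP_least)
  also have "(SUP i. \<integral>\<^sup>+z. ?w z * indicator (A i \<times> A i) z \<partial>(M \<Otimes>\<^sub>M M))
      = (\<integral>\<^sup>+z. (SUP i. ?w z * indicator (A i \<times> A i) z) \<partial>(M \<Otimes>\<^sub>M M))"
  proof (rule nn_integral_monotone_convergence_SUP[symmetric])
    show "incseq (\<lambda>i z. ?w z * indicator (A i \<times> A i) z)"
    proof (intro incseq_SucI le_funI)
      fix i z
      have "A i \<times> A i \<subseteq> A (Suc i) \<times> A (Suc i)" using incseq_SucD[OF A(4)] by blast
      then show "?w z * indicator (A i \<times> A i) z \<le> ?w z * indicator (A (Suc i) \<times> A (Suc i)) z"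
        by (intro mult_left_mono) (auto simp: indicator_def)
    qed
  qed measurable
  also have "\<dots> = (\<integral>\<^sup>+z. ?w z \<partial>(M \<Otimes>\<^sub>M M))"
  proof (rule nn_integral_cong)
    fix z assume "z \<in> space (M \<Otimes>\<^sub>M M)"
    then have "fst z \<in> (\<Union>i. A i)" "snd z \<in> (\<Union>i. A i)"
      unfolding A(2) by (auto simp: space_pair_measure)
    then obtain j k where jk: "fst z \<in> A j" "snd z \<in> A k" by blast
    have "A j \<subseteq> A (max j k)" "A k \<subseteq> A (max j k)" using A(4) by (auto simp: incseq_def)
    then have "z \<in> A (max j k) \<times> A (max j k)" using jk by (cases z) auto
    then show "(SUP i. ?w z * indicator (A i \<times> A i) z) = ?w z"
      by (intro antisym SUP_least SUP_upper2[of "max j k"]) (auto split: split_indicator)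
  qed
  finally have "integrable (M \<Otimes>\<^sub>M M) (\<lambda>z. W (fst z) (snd z))"
    using W'(2) by (intro integrableI_nonneg) (auto simp: space_pair_measure intro: le_less_trans)
  then show ?thesis using W by (simp add: integrable_graphon_def case_prod_beta')
qed

text \<open>The difference is the integral over \<open>E - D\<close>, hence at most the integral
  outside \<open>D\<close>.\<close>

lemma set_integral_inter_deviation:
  fixes F :: "'a \<Rightarrow> real"
  assumes F: "integrable M F" "\<And>x. x \<in> space M \<Longrightarrow> 0 \<le> F x" and E: "E \<in> sets M" and D: "D \<in> sets M"
  shows "0 \<le> (LINT x:E|M. F x) - (LINT x:E \<inter> D|M. F x)"
    and "(LINT x:E|M. F x) - (LINT x:E \<inter> D|M. F x) \<le> integral\<^sup>L M F - (LINT x:D|M. F x)"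
proof -
  have i: "integrable M (\<lambda>x. indicator B x *\<^sub>R F x)" if "B \<in> sets M" for B
    using F(1) that by (rule integrable_mult_indicator[rotated])
  have eq: "(LINT x:E|M. F x) - (LINT x:E \<inter> D|M. F x) = (\<integral>x. indicator E x *\<^sub>R F x - indicator (E \<inter> D) x *\<^sub>R F x \<partial>M)"
    unfolding set_lebesgue_integral_def using E D by (intro Bochner_Integration.integral_diff[symmetric] i) auto
  show "0 \<le> (LINT x:E|M. F x) - (LINT x:E \<inter> D|M. F x)"
    unfolding eq using F(2) by (intro integral_nonneg_AE AE_I2) (auto split: split_indicator)
  have "(\<integral>x. indicator E x *\<^sub>R F x - indicator (E \<inter> D) x *\<^sub>R F x \<partial>M) \<le> (\<integral>x. F x - indicator D x *\<^sub>R F x \<partial>M)"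
    using F(2) E D by (intro integral_mono Bochner_Integration.integrable_diff i F(1)) (auto split: split_indicator)
  also have "\<dots> = integral\<^sup>L M F - (LINT x:D|M. F x)"
    unfolding set_lebesgue_integral_def by (intro Bochner_Integration.integral_diff F(1) i D)
  finally show "(LINT x:E|M. F x) - (LINT x:E \<inter> D|M. F x) \<le> integral\<^sup>L M F - (LINT x:D|M. F x)"
    unfolding eq .
qed

text \<open>No more can be lost on \<open>A \<times> A\<close> than is lost in total. The same
  rearranged: the mass outside \<open>A \<times> A\<close> only shrinks, so the set \<open>A\<close>
  for \<open>M\<close> also serves \<open>N\<close>.\<close>

lemma tail_bounded_within:
  assumes W: "integrable_graphon M W" and N: "measure_within r M N" and t: "tail_bounded M W \<epsilon> C"
  shows "tail_bounded N W \<epsilon> C"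
proof -
  note W' = integrable_graphonD[OF W]
  have s: "sets N = sets M" using N by (simp add: measure_within_def)
  have le: "emeasure N B \<le> emeasure M B" if "B \<in> sets M" for B using measure_within_le[OF N that] .
  obtain A where A: "A \<in> sets M" "emeasure M A \<le> ennreal C"
    "mass M W - (LINT z:A \<times> A|M \<Otimes>\<^sub>M M. W (fst z) (snd z)) \<le> \<epsilon>"
    using t unfolding tail_bounded_def by blast
  have sN: "sigma_finite_measure N" by (rule sigma_finite_measure_mono[OF W'(1) s le])
  have nn: "0 \<le> W (fst z) (snd z)" if "z \<in> space (M \<Otimes>\<^sub>M M)" for z
    using that W'(6) by (auto simp: space_pair_measure)
  have "A \<times> A \<in> sets (M \<Otimes>\<^sub>M M)" using A(1) by simp
  from set_integral_deviation(2)[OF sets_pair_measure_cong[OF s s] pair_measure_mono[OF W'(1) sN s le] W'(4) nn this]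
  have "mass N W - (LINT z:A \<times> A|N \<Otimes>\<^sub>M N. W (fst z) (snd z)) \<le> \<epsilon>"
    using A(3) by (simp add: mass_def)
  moreover have "emeasure N A \<le> ennreal C" using le[OF A(1)] A(2) by (rule order_trans)
  ultimately show ?thesis using A(1) s unfolding tail_bounded_def by blast
qed

context coupled_graphons
begin

text \<open>\<open>Z\<close> consists of the fibres over the tail set \<open>A\<close> and has
  measure at most \<open>C\<close>, so inside \<open>Z \<times> Z\<close> the kernel norm bounds
  every rectangle by \<open>\<eta> * C\<close>. Off \<open>Z \<times> Z\<close> the kernel
  \<open>K1\<close> has mass at most \<open>\<epsilon>\<close>. There \<open>K2\<close> has mass at
  most \<open>\<epsilon> + \<delta> + \<eta> * C\<close>: its total exceeds that of
  \<open>K1\<close> by at most \<open>\<delta>\<close>, and on \<open>Z \<times> Z\<close> the two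
  differ by at most \<open>\<eta> * C\<close>. So the tail of \<open>W2\<close> is controlled
  through that of \<open>W1\<close>.\<close>

lemma kernel_norm_cut:
  assumes k: "kernel_norm \<mu> (\<lambda>z w. K1 z w - K2 z w) \<le> ereal \<eta>" and \<eta>: "0 \<le> \<eta>"
    and t: "tail_bounded M1 W1 \<epsilon> C" and C0: "0 \<le> C" and m: "mass M2 W2 \<le> mass M1 W1 + \<delta>"
  shows "cut_bounded \<mu> (\<lambda>z w. K1 z w - K2 z w) (2 * \<eta> * C + 2 * \<epsilon> + \<delta>)"
proof -
  obtain A where A[measurable]: "A \<in> sets M1" and C: "emeasure M1 A \<le> ennreal C"
    and e: "mass M1 W1 - (LINT z:A \<times> A|M1 \<Otimes>\<^sub>M M1. W1 (fst z) (snd z)) \<le> \<epsilon>"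
    using t unfolding tail_bounded_def by blast
  define Z where "Z = fst -` (Inl ` A) \<inter> space \<mu>"
  have AI: "Inl ` A \<in> sets X1" by measurable
  have Z[measurable]: "Z \<in> sets \<mu>"
    unfolding Z_def by (rule measurable_sets[OF fst_measurable_\<mu> AI])
  have ZC: "emeasure \<mu> Z \<le> ennreal C"
  proof -
    have "emeasure \<mu> Z = emeasure (distr \<mu> X1 fst) (Inl ` A)"
      unfolding Z_def by (rule emeasure_distr[OF fst_measurable_\<mu> AI, symmetric])
    also have "\<dots> = emeasure M1 A" unfolding distr_fst by (rule emeasure_extend_base_Inl) measurable
    finally show ?thesis using C by simp
  qed
  have meas: "emeasure \<mu> (B \<inter> Z) \<noteq> \<infinity>" "measure \<mu> (B \<inter> Z) \<le> C" if "B \<in> sets \<mu>" for B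
  proof -
    have le: "emeasure \<mu> (B \<inter> Z) \<le> ennreal C"
      using emeasure_mono[of "B \<inter> Z" Z \<mu>] ZC by (auto intro: order_trans)
    then show "emeasure \<mu> (B \<inter> Z) \<noteq> \<infinity>" by (auto simp: top_unique)
    show "measure \<mu> (B \<inter> Z) \<le> C"
      unfolding measure_def using enn2real_mono[OF le] C0 by simp
  qed
  have rect: "\<bar>(LINT z:(B \<inter> Z) \<times> (D \<inter> Z)|\<mu> \<Otimes>\<^sub>M \<mu>. K1 (fst z) (snd z)) - (LINT z:(B \<inter> Z) \<times> (D \<inter> Z)|\<mu> \<Otimes>\<^sub>M \<mu>. K2 (fst z) (snd z))\<bar>
      \<le> \<eta> * C" if BD: "B \<in> sets \<mu>" "D \<in> sets \<mu>" for B D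
  proof -
    have "\<bar>LINT z:(B \<inter> Z) \<times> (D \<inter> Z)|\<mu> \<Otimes>\<^sub>M \<mu>. K1 (fst z) (snd z) - K2 (fst z) (snd z)\<bar>
        \<le> \<eta> * sqrt (measure \<mu> (B \<inter> Z) * measure \<mu> (D \<inter> Z))"
      using BD meas by (intro kernel_norm_rect[OF sigma_finite_\<mu> k \<eta>]) auto
    also have "\<dots> \<le> \<eta> * sqrt (C * C)"
      using meas BD \<eta> C0 by (intro mult_left_mono real_sqrt_le_mono mult_mono) auto
    also have "\<dots> = \<eta> * C" using C0 by simp
    finally show ?thesis using BD by (subst (asm) diff_set_integral) auto
  qed
  have Zi: "(LINT z:Z \<times> Z|\<mu> \<Otimes>\<^sub>M \<mu>. K1 (fst z) (snd z)) = (LINT z:A \<times> A|M1 \<Otimes>\<^sub>M M1. W1 (fst z) (snd z))"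
  proof -
    have "(Inl :: 'a \<Rightarrow> 'a + real) -` Inl ` A = A" by auto
    then show ?thesis using K1_integral(2)[OF AI AI] unfolding Z_def by simp
  qed
  have ZZ: "Z \<times> Z \<in> sets (\<mu> \<Otimes>\<^sub>M \<mu>)" by simp
  have n1: "0 \<le> K1 (fst z) (snd z)" and n2: "0 \<le> K2 (fst z) (snd z)" if "z \<in> space (\<mu> \<Otimes>\<^sub>M \<mu>)" for z
    using that K1_range[of "fst z" "snd z"] K2_range[of "fst z" "snd z"] by (auto simp: space_pair_measure)
  have "Z \<inter> Z = Z" by simp
  with rect[OF Z Z] have r0: "\<bar>(LINT z:Z \<times> Z|\<mu> \<Otimes>\<^sub>M \<mu>. K1 (fst z) (snd z)) - (LINT z:Z \<times> Z|\<mu> \<Otimes>\<^sub>M \<mu>. K2 (fst z) (snd z))\<bar> \<le> \<eta> * C"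
    by simp
  show ?thesis
    unfolding cut_bounded_def
  proof (intro ballI)
    fix B D assume BD: "B \<in> sets \<mu>" "D \<in> sets \<mu>"
    then have E: "B \<times> D \<in> sets (\<mu> \<Otimes>\<^sub>M \<mu>)" by simp
    have int: "(B \<times> D) \<inter> (Z \<times> Z) = (B \<inter> Z) \<times> (D \<inter> Z)" by blast
    note d1 = set_integral_inter_deviation[OF K1_integral(1) n1 E ZZ, unfolded int]
    note d2 = set_integral_inter_deviation[OF K2_integral(1) n2 E ZZ, unfolded int]
    have t1: "(\<integral>z. K1 (fst z) (snd z) \<partial>(\<mu> \<Otimes>\<^sub>M \<mu>)) = mass M1 W1" using K1_integral(3) by (simp add: mass_def)
    have t2: "(\<integral>z. K2 (fst z) (snd z) \<partial>(\<mu> \<Otimes>\<^sub>M \<mu>)) = mass M2 W2" using K2_integral(3) by (simp add: mass_def)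
    have "\<bar>a - b\<bar> \<le> 2 * \<eta> * C + 2 * \<epsilon> + \<delta>"
      if "0 \<le> a - a'" "a - a' \<le> s - p" "0 \<le> b - b'" "b - b' \<le> t - q" "\<bar>p - q\<bar> \<le> \<eta> * C" "\<bar>a' - b'\<bar> \<le> \<eta> * C"
        "s - p \<le> \<epsilon>" "t \<le> s + \<delta>" for a b a' b' s t p q :: real
      using that by (simp only: abs_le_iff) (simp add: algebra_simps)
    from this[OF d1[unfolded t1] d2[unfolded t2] r0 rect[OF BD] e[folded Zi] m]
    show "\<bar>LINT z:B \<times> D|\<mu> \<Otimes>\<^sub>M \<mu>. K1 (fst z) (snd z) - K2 (fst z) (snd z)\<bar> \<le> 2 * \<eta> * C + 2 * \<epsilon> + \<delta>"
      unfolding diff_set_integral[OF BD] .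
  qed
qed

end

subsection \<open>Kernel convergence implies cut convergence\<close>

lemma mass_within_le:
  assumes W: "integrable_graphon M W" and N: "measure_within r M N"
  shows "mass N W \<le> mass M W"
proof -
  note W' = integrable_graphonD[OF W]
  have s: "sets N = sets M" using N by (simp add: measure_within_def)
  have le: "emeasure N B \<le> emeasure M B" if "B \<in> sets M" for B using measure_within_le[OF N that] .
  have sN: "sigma_finite_measure N" by (rule sigma_finite_measure_mono[OF W'(1) s le])
  show ?thesis
    unfolding mass_def
    by (rule integral_mono_measure_nonneg[OF sets_pair_measure_cong[OF s s] pair_measure_mono[OF W'(1) sN s le] W'(4)])
      (use W'(6) in \<open>auto simp: space_pair_measure\<close>)
qed

text \<open>Over the tail set the kernel is at most 1. Along a uniformly tail regular sequence this
  bounds all masses at once.\<close>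

lemma tail_bounded_mass:
  assumes W: "integrable_graphon M W" and t: "tail_bounded M W \<epsilon> C" and C0: "0 \<le> C"
  shows "mass M W \<le> \<epsilon> + C\<^sup>2"
proof -
  note W' = integrable_graphonD[OF W]
  interpret sigma_finite_measure M by (rule W'(1))
  obtain A where A[measurable]: "A \<in> sets M" and C: "emeasure M A \<le> ennreal C"
    and e: "mass M W - (LINT z:A \<times> A|M \<Otimes>\<^sub>M M. W (fst z) (snd z)) \<le> \<epsilon>"
    using t unfolding tail_bounded_def by blast
  have AA: "emeasure (M \<Otimes>\<^sub>M M) (A \<times> A) \<le> ennreal (C\<^sup>2)"
  proof -
    have "emeasure (M \<Otimes>\<^sub>M M) (A \<times> A) = emeasure M A * emeasure M A"
      by (rule emeasure_pair_measure_Times) measurable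
    also have "\<dots> \<le> ennreal C * ennreal C" using C by (intro mult_mono) auto
    also have "\<dots> = ennreal (C\<^sup>2)" using C0 by (simp add: ennreal_mult power2_eq_square)
    finally show ?thesis .
  qed
  have "(LINT z:A \<times> A|M \<Otimes>\<^sub>M M. W (fst z) (snd z)) \<le> (\<integral>z. indicator (A \<times> A) z \<partial>(M \<Otimes>\<^sub>M M))"
    unfolding set_lebesgue_integral_def
  proof (rule integral_mono)
    show "integrable (M \<Otimes>\<^sub>M M) (\<lambda>z. indicator (A \<times> A) z *\<^sub>R W (fst z) (snd z))"
      by (rule integrable_mult_indicator[OF _ W'(4)]) measurable
    show "integrable (M \<Otimes>\<^sub>M M) (\<lambda>z. indicator (A \<times> A) z :: real)"
      using AA by (intro integrable_real_indicator) (auto intro: le_less_trans)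
  qed (use W'(7) in \<open>auto simp: space_pair_measure split: split_indicator\<close>)
  also have "\<dots> = measure (M \<Otimes>\<^sub>M M) (A \<times> A)" by simp
  also have "\<dots> \<le> C\<^sup>2" unfolding measure_def using enn2real_mono[OF AA] by simp
  finally show ?thesis using e by linarith
qed

lemma extend_graphex_simps:
  "kernel (extend_graphex G) = extend_kernel (kernel G)"
  "star (extend_graphex G) = (\<lambda>z. case z of Inl x \<Rightarrow> star G x | Inr _ \<Rightarrow> 0)"
  "isolated (extend_graphex G) = isolated G"
  "base (extend_graphex G) = extend_base (base G)"
  by (simp_all add: extend_graphex_def)

lemma pullback_simps:
  "kernel (pullback p \<mu> G) = (\<lambda>x y. kernel G (p x) (p y))"
  "star (pullback p \<mu> G) = (\<lambda>x. star G (p x))"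
  "isolated (pullback p \<mu> G) = isolated G"
  "base (pullback p \<mu> G) = \<mu>"
  by (simp_all add: pullback_def)

lemma graphex_of_graphon_simps:
  "kernel (graphex_of_graphon M W) = W" "star (graphex_of_graphon M W) = (\<lambda>_. 0)"
  "isolated (graphex_of_graphon M W) = 0" "base (graphex_of_graphon M W) = M"
  by (simp_all add: graphex_of_graphon_def)

lemma graphex_of_graphon_base: "graphex_of_graphon M W\<lparr>base := N\<rparr> = graphex_of_graphon N W"
  by (simp add: graphex_of_graphon_def)

lemma kernel_dist_nonneg: "0 \<le> kernel_dist G1 G2"
proof -
  have "0 \<le> kernel_d H1 H2" for H1 H2 :: "'c graphex"
    unfolding kernel_d_def by (intro le_max_iff_disj[THEN iffD2] disjI2) simp
  then show ?thesis unfolding kernel_dist_def kernel_dist_coupled_def by (intro INF_greatest)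
qed

lemma L1_L2_graphexD:
  assumes "L1_L2_graphex G"
  shows "integrable_graphon (base G) (kernel G)"
  using assms by (auto simp: L1_L2_graphex_def is_graphex_def in_L1_L2_def integrable_graphon_def)

text \<open>Both infima are unpacked. Of the comparison of \<open>rho\<close> an inequality between
  kernel masses is kept: the star and isolated parts of \<open>G\<close> are nonnegative, so they
  only increase \<open>rho\<close> on its side.\<close>

lemma weak_kernel_dist_lessD:
  assumes G: "is_graphex G" and less: "weak_kernel_dist (graphex_of_graphon M W) G < ereal \<eta>"
  obtains N1 N2 \<mu> where "integrable_graphon N1 W" "integrable_graphon N2 (kernel G)"
    "measure_within (\<eta>\<^sup>2) M N1" "measure_within (\<eta>\<^sup>2) (base G) N2"
    "\<mu> \<in> couplings (extend_base N1) (extend_base N2)"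
    "kernel_norm \<mu> (\<lambda>z w. extend_kernel W (fst z) (fst w) - extend_kernel (kernel G) (snd z) (snd w)) \<le> ereal \<eta>"
    "mass N2 (kernel G) \<le> mass N1 W + \<eta> ^ 3"
proof -
  obtain c N1 N2 where c: "c < \<eta>" and L1: "L1_L2_graphex (graphex_of_graphon N1 W)"
    and L2: "L1_L2_graphex (G\<lparr>base := N2\<rparr>)"
    and w: "measure_within (c\<^sup>2) M N1" "measure_within (c\<^sup>2) (base G) N2"
    and d: "kernel_dist (graphex_of_graphon N1 W) (G\<lparr>base := N2\<rparr>) \<le> ereal c"
    using less unfolding weak_kernel_dist_def INF_less_iff
    by (auto simp: graphex_of_graphon_base graphex_of_graphon_simps)
  let ?G1 = "graphex_of_graphon N1 W" and ?G2 = "G\<lparr>base := N2\<rparr>"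
  \<comment> \<open>The infimum runs over all real \<open>c\<close>. That \<open>c\<close> is
    nonnegative comes from \<open>kernel_dist\<close> and is needed to compare
    \<open>c\<^sup>2\<close> with \<open>\<eta>\<^sup>2\<close>.\<close>
  have c0: "0 \<le> c" using order_trans[OF kernel_dist_nonneg d] by simp
  have "kernel_dist ?G1 ?G2 < ereal \<eta>" using d c by (auto intro: le_less_trans)
  then obtain \<mu> where \<mu>: "\<mu> \<in> couplings (extend_base N1) (extend_base N2)"
    and kd: "kernel_d (pullback fst \<mu> (extend_graphex ?G1)) (pullback snd \<mu> (extend_graphex ?G2)) < ereal \<eta>"
    unfolding kernel_dist_def kernel_dist_coupled_def INF_less_iff
    by (auto simp: extend_graphex_simps graphex_of_graphon_simps)
  have W1: "integrable_graphon N1 W" and W2: "integrable_graphon N2 (kernel G)"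
    using L1_L2_graphexD[OF L1] L1_L2_graphexD[OF L2] by (simp_all add: graphex_of_graphon_simps)
  interpret coupled_graphons N1 W N2 "kernel G" \<mu>
    using W1 W2 \<mu> by unfold_locales
  have sq: "c\<^sup>2 \<le> \<eta>\<^sup>2" using c c0 by (intro power_mono) auto
  have kn: "kernel_norm \<mu> (\<lambda>z w. K1 z w - K2 z w) \<le> ereal \<eta>"
    using kd by (auto simp: kernel_d_def pullback_simps extend_graphex_simps graphex_of_graphon_simps)
  have r: "root 3 \<bar>rho (pullback fst \<mu> (extend_graphex ?G1)) - rho (pullback snd \<mu> (extend_graphex ?G2))\<bar> < \<eta>"
    using kd by (auto simp: kernel_d_def)
  have rho1: "rho (pullback fst \<mu> (extend_graphex ?G1)) = mass N1 W"
  proof -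
    have "(\<lambda>x. case fst x of Inl x \<Rightarrow> star ?G1 x | Inr _ \<Rightarrow> 0) = (\<lambda>x::('b + real) \<times> ('a + real). 0)"
      by (auto simp: fun_eq_iff graphex_of_graphon_simps split: sum.splits)
    then show ?thesis
      using K1_integral(3)
      by (simp add: rho_def mass_def pullback_simps extend_graphex_simps graphex_of_graphon_simps case_prod_beta')
  qed
  have rho2: "mass N2 (kernel G) \<le> rho (pullback snd \<mu> (extend_graphex ?G2))"
  proof -
    have sp: "space N2 = space (base G)"
      using w(2) by (intro sets_eq_imp_space_eq) (simp add: measure_within_def)
    have "0 \<le> (\<integral>x. (case snd x of Inl x \<Rightarrow> star ?G2 x | Inr _ \<Rightarrow> 0) \<partial>\<mu>)"
      using G by (intro integral_nonneg_AE AE_I2)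
        (auto simp: space_\<mu> space_extend_base sp is_graphex_def split: sum.splits)
    moreover have "0 \<le> isolated G" using G by (simp add: is_graphex_def)
    ultimately show ?thesis
      using K2_integral(3)
      by (simp add: rho_def mass_def pullback_simps extend_graphex_simps case_prod_beta')
  qed
  have "mass N2 (kernel G) \<le> mass N1 W + \<eta> ^ 3"
  proof -
    let ?x = "\<bar>rho (pullback fst \<mu> (extend_graphex ?G1)) - rho (pullback snd \<mu> (extend_graphex ?G2))\<bar>"
    have "?x = root 3 ?x ^ 3" by (simp add: real_root_pow_pos2)
    also have "\<dots> \<le> \<eta> ^ 3" using r by (intro power_mono) auto
    finally show ?thesis using rho1 rho2 by linarith
  qed
  then show ?thesis
    using that[OF W1 W2 measure_within_mono[OF w(1) sq] measure_within_mono[OF w(2) sq] \<mu> kn] by blast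
qed

text \<open>In this way a coupling of the reduced measures counts as a partial coupling of the
  original ones.\<close>

lemma distr_within_le:
  assumes "measure_within r M N" and X: "distr \<mu> (extend_base N) p = extend_base N"
    and E: "E \<in> sets (extend_base M)"
  shows "emeasure (distr \<mu> (extend_base M) p) E \<le> emeasure (extend_base M) E"
proof -
  have s: "sets N = sets M" using assms(1) by (simp add: measure_within_def)
  have "distr \<mu> (extend_base M) p = distr \<mu> (extend_base N) p"
    by (intro distr_cong refl sets_extend_base_cong s[symmetric])
  then have "emeasure (distr \<mu> (extend_base M) p) E = emeasure (extend_base N) E" by (simp add: X)
  moreover obtain A B where AB: "E = A <+> B" "A \<in> sets M" "B \<in> sets lborel"
    using E unfolding extend_base_def sets_sum_measure by blast
  moreover have "emeasure N A \<le> emeasure M A" by (rule measure_within_le[OF assms(1) AB(2)])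
  ultimately show ?thesis using s by (simp add: emeasure_extend_base add_mono)
qed

text \<open>The three summands of the bound are the cut bound on the coupling of the reduced
  measures, from \<open>kernel_norm_cut\<close> with \<open>\<delta> = \<eta> ^ 3\<close>, and the
  kernel masses lost on either side when measure \<open>\<eta>\<^sup>2\<close> is removed.\<close>

lemma weak_kernel_dist_imp_cut_dist:
  assumes W: "integrable_graphon M W" and G: "is_graphex G" and U: "integrable_graphon (base G) (kernel G)"
    and less: "weak_kernel_dist (graphex_of_graphon M W) G < ereal \<eta>" and \<eta>: "0 < \<eta>"
    and t1: "tail_bounded M W \<epsilon> C1" "0 \<le> C1" and t2: "tail_bounded (base G) (kernel G) \<epsilon> C2" "0 \<le> C2"
  shows "cut_dist M W (base G) (kernel G)
    \<le> ereal ((2 * \<eta> * C1 + 2 * \<epsilon> + \<eta> ^ 3) + (\<epsilon> + 2 * C1 * \<eta>\<^sup>2) + (\<epsilon> + 2 * C2 * \<eta>\<^sup>2))"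
proof -
  obtain N1 N2 \<mu> where N: "integrable_graphon N1 W" "integrable_graphon N2 (kernel G)"
    and w: "measure_within (\<eta>\<^sup>2) M N1" "measure_within (\<eta>\<^sup>2) (base G) N2"
    and \<mu>: "\<mu> \<in> couplings (extend_base N1) (extend_base N2)"
    and k: "kernel_norm \<mu> (\<lambda>z w. extend_kernel W (fst z) (fst w) - extend_kernel (kernel G) (snd z) (snd w)) \<le> ereal \<eta>"
    and m: "mass N2 (kernel G) \<le> mass N1 W + \<eta> ^ 3"
    by (rule weak_kernel_dist_lessD[OF G less])
  interpret coupled_graphons N1 W N2 "kernel G" \<mu>
    using N \<mu> by unfold_locales
  have s: "sets N1 = sets M" "sets N2 = sets (base G)" using w by (simp_all add: measure_within_def)
  have cut: "cut_bounded \<mu> (\<lambda>z w. K1 z w - K2 z w) (2 * \<eta> * C1 + 2 * \<epsilon> + \<eta> ^ 3)"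
    using \<eta> by (intro kernel_norm_cut[OF k _ tail_bounded_within[OF W w(1) t1(1)] t1(2) m]) simp
  have sets: "sets \<mu> = sets (extend_base M \<Otimes>\<^sub>M extend_base (base G))"
    using sets_\<mu> sets_pair_measure_cong[OF sets_extend_base_cong[OF s(1)] sets_extend_base_cong[OF s(2)]] by simp
  have m1: "mass M W - mass \<mu> K1 \<le> \<epsilon> + 2 * C1 * \<eta>\<^sup>2"
    using mass_loss[OF W w(1) t1(1) _ t1(2)] K1_integral(3) by simp
  have m2: "mass (base G) (kernel G) - mass \<mu> K2 \<le> \<epsilon> + 2 * C2 * \<eta>\<^sup>2"
    using mass_loss[OF U w(2) t2(1) _ t2(2)] K2_integral(3) by simp
  from extend_partial_coupling[OF W U sets distr_within_le[OF w(1) distr_fst] distr_within_le[OF w(2) distr_snd] cut m1 m2]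
  show ?thesis by (auto intro: cut_dist_le)
qed

lemma kernel_convergent_imp_cut_convergent:
  assumes W: "\<And>n. integrable_graphon (\<Omega> n) (W n)" and G: "is_graphex G"
    and utr: "uniformly_tail_regular (range (\<lambda>n. (\<Omega> n, W n)))"
    and lim: "(\<lambda>n. weak_kernel_dist (graphex_of_graphon (\<Omega> n) (W n)) G) \<longlonglongrightarrow> 0"
  shows "integrable_graphon (base G) (kernel G)"
    and "(\<lambda>n. cut_dist (\<Omega> n) (W n) (base G) (kernel G)) \<longlonglongrightarrow> 0"
proof -
  have ev: "eventually (\<lambda>n. weak_kernel_dist (graphex_of_graphon (\<Omega> n) (W n)) G < ereal \<eta>) sequentially"
    if "0 < \<eta>" for \<eta>
    using lim that by (intro order_tendstoD(2)[of _ 0]) auto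
  have tb: "\<exists>C\<ge>0. \<forall>n. tail_bounded (\<Omega> n) (W n) \<epsilon> C" if "0 < \<epsilon>" for \<epsilon>
  proof -
    have "\<exists>C. \<forall>n. tail_bounded (\<Omega> n) (W n) \<epsilon> C"
      using utr that unfolding uniformly_tail_regular_range by blast
    then obtain C where C: "\<And>n. tail_bounded (\<Omega> n) (W n) \<epsilon> C" by metis
    have "ennreal C \<le> ennreal (max C 0)" by (intro ennreal_leI) simp
    then have "tail_bounded (\<Omega> n) (W n) \<epsilon> (max C 0)" for n
      using C[of n] unfolding tail_bounded_def by (meson order_trans)
    then show ?thesis by (intro exI[of _ "max C 0"]) simp
  qed
  obtain C0 where C0: "0 \<le> C0" "\<And>n. tail_bounded (\<Omega> n) (W n) 1 C0" using tb[of 1] by auto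
  show U: "integrable_graphon (base G) (kernel G)"
  proof (rule integrable_graphon_approx)
    show "graphon (base G) (kernel G)" using G by (simp add: is_graphex_def)
    fix r :: real assume "0 < r"
    \<comment> \<open>\<open>sqrt r\<close> keeps the removed measure below \<open>r\<close>, and
      the minimum with 1 keeps \<open>\<eta> ^ 3\<close> below 1. With the mass bound
      \<open>1 + C0\<^sup>2\<close> for the sequence this makes
      \<open>2 + C0\<^sup>2\<close>.\<close>
    define \<eta> where "\<eta> = min 1 (sqrt r)"
    have \<eta>: "0 < \<eta>" "\<eta> \<le> 1" using \<open>0 < r\<close> by (simp_all add: \<eta>_def)
    have "\<eta>\<^sup>2 \<le> (sqrt r)\<^sup>2" using \<eta> by (intro power_mono) (auto simp: \<eta>_def)
    then have \<eta>r: "\<eta>\<^sup>2 \<le> r" using \<open>0 < r\<close> by simp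
    have \<eta>3: "\<eta> ^ 3 \<le> 1" using \<eta> by (intro power_le_one) auto
    obtain n where n: "weak_kernel_dist (graphex_of_graphon (\<Omega> n) (W n)) G < ereal \<eta>"
      using ev[OF \<eta>(1)] by (auto simp: eventually_sequentially)
    obtain N1 N2 \<mu> where N: "integrable_graphon N1 (W n)" "integrable_graphon N2 (kernel G)"
      "measure_within (\<eta>\<^sup>2) (\<Omega> n) N1" "measure_within (\<eta>\<^sup>2) (base G) N2"
      "mass N2 (kernel G) \<le> mass N1 (W n) + \<eta> ^ 3"
      by (rule weak_kernel_dist_lessD[OF G n])
    have "mass N2 (kernel G) \<le> 2 + C0\<^sup>2"
      using N(5) mass_within_le[OF W N(3)] tail_bounded_mass[OF W C0(2) C0(1), of n] \<eta>3 by linarith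
    then show "\<exists>N. measure_within r (base G) N \<and> integrable_graphon N (kernel G) \<and> mass N (kernel G) \<le> 2 + C0\<^sup>2"
      using N(2) measure_within_mono[OF N(4) \<eta>r] by blast
  qed
  show "(\<lambda>n. cut_dist (\<Omega> n) (W n) (base G) (kernel G)) \<longlonglongrightarrow> 0"
  proof (rule order_tendstoI)
    fix a :: ereal assume "a < 0"
    then show "eventually (\<lambda>n. a < cut_dist (\<Omega> n) (W n) (base G) (kernel G)) sequentially"
      using cut_dist_nonneg by (intro always_eventually allI) (rule less_le_trans)
  next
    fix a :: ereal assume "0 < a"
    then obtain \<tau> :: real where \<tau>: "0 < ereal \<tau>" "ereal \<tau> < a" using ereal_dense2 by blast
    then have e: "0 < \<tau> / 8" by simp
    obtain C1 where C1: "0 \<le> C1" "\<And>n. tail_bounded (\<Omega> n) (W n) (\<tau> / 8) C1" using tb[OF e] by auto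
    obtain C2 where C2: "0 \<le> C2" "tail_bounded (base G) (kernel G) (\<tau> / 8) C2"
      unfolding tail_bounded_def by (rule graphon_tail[OF U e]) blast
    \<comment> \<open>Four terms \<open>\<tau> / 8\<close> of the bound take half of
      \<open>\<tau>\<close>. As \<open>\<eta> \<le> 1\<close>, the powers in the other terms are at
      most \<open>\<eta>\<close>; the coefficients, \<open>2 * C1\<close> twice,
      \<open>2 * C2\<close> and 1, add up to \<open>D\<close>.\<close>
    define D where "D = 4 * C1 + 2 * C2 + 1"
    have D: "0 < D" using C1(1) C2(1) by (simp add: D_def)
    define \<eta> where "\<eta> = min 1 (\<tau> / (2 * D))"
    have \<eta>: "0 < \<eta>" "\<eta> \<le> 1" "\<eta> * D \<le> \<tau> / 2"
    proof -
      show "0 < \<eta>" "\<eta> \<le> 1" using D \<tau>(1) by (simp_all add: \<eta>_def)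
      have "\<eta> * D \<le> \<tau> / (2 * D) * D" using D by (intro mult_right_mono) (auto simp: \<eta>_def)
      then show "\<eta> * D \<le> \<tau> / 2" using D by simp
    qed
    have p: "\<eta>\<^sup>2 \<le> \<eta>" "\<eta> ^ 3 \<le> \<eta>"
      using \<eta>(1,2) power_decreasing[of 1 2 \<eta>] power_decreasing[of 1 3 \<eta>] by simp_all
    have bound: "(2 * \<eta> * C1 + 2 * (\<tau> / 8) + \<eta> ^ 3) + (\<tau> / 8 + 2 * C1 * \<eta>\<^sup>2) + (\<tau> / 8 + 2 * C2 * \<eta>\<^sup>2) \<le> \<tau>"
    proof -
      have "2 * C1 * \<eta>\<^sup>2 \<le> 2 * C1 * \<eta>" "2 * C2 * \<eta>\<^sup>2 \<le> 2 * C2 * \<eta>"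
        using C1(1) C2(1) p(1) by (intro mult_left_mono, simp_all)+
      moreover have "\<eta> * D = 4 * C1 * \<eta> + 2 * C2 * \<eta> + \<eta>" by (simp add: D_def algebra_simps)
      ultimately show ?thesis using \<eta>(3) p(2) by (simp add: algebra_simps)
    qed
    from ev[OF \<eta>(1)]
    show "eventually (\<lambda>n. cut_dist (\<Omega> n) (W n) (base G) (kernel G) < a) sequentially"
    proof eventually_elim
      fix n assume n: "weak_kernel_dist (graphex_of_graphon (\<Omega> n) (W n)) G < ereal \<eta>"
      have "cut_dist (\<Omega> n) (W n) (base G) (kernel G) \<le> ereal \<tau>"
        using weak_kernel_dist_imp_cut_dist[OF W G U n \<eta>(1) C1(2) C1(1) C2(2) C2(1)] bound
        by (meson ereal_less_eq(3) order_trans)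
      then show "cut_dist (\<Omega> n) (W n) (base G) (kernel G) < a" using \<tau>(2) by (rule le_less_trans)
    qed
  qed
qed

subsection \<open>Cut convergence implies kernel convergence\<close>

text \<open>Fubini gives integrable sections in the second variable, and symmetry turns them into
  the sections in the first variable that \<open>is_graphex\<close> asks for. The set of finite
  weight is the whole space.\<close>

lemma is_graphex_graphex_of_graphon:
  assumes W: "integrable_graphon N W"
  shows "is_graphex (graphex_of_graphon N W)"
proof -
  note W' = integrable_graphonD[OF W]
  interpret sigma_finite_measure N by (rule W'(1))
  interpret P: pair_sigma_finite N N by standard
  have g: "graphon N W" using W by (simp add: integrable_graphon_def)
  have "AE x in N. integrable N (\<lambda>y. W x y)"
    using P.AE_integrable_fst'[OF W'(4)] by simp
  then have ae: "AE x in N. integrable N (\<lambda>y. W y x)"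
  proof (rule AE_mp, intro AE_I2 impI)
    fix x assume "x \<in> space N" "integrable N (\<lambda>y. W x y)"
    then show "integrable N (\<lambda>y. W y x)"
      using W'(5) by (subst Bochner_Integration.integrable_cong[of N N _ "\<lambda>y. W x y"]) auto
  qed
  have "(\<integral>\<^sup>+z. ennreal (W (fst z) (snd z)) * indicator (space N \<times> space N) z \<partial>(N \<Otimes>\<^sub>M N)) < \<infinity>"
  proof -
    have "(\<integral>\<^sup>+z. ennreal (W (fst z) (snd z)) * indicator (space N \<times> space N) z \<partial>(N \<Otimes>\<^sub>M N))
        = (\<integral>\<^sup>+z. ennreal (W (fst z) (snd z)) \<partial>(N \<Otimes>\<^sub>M N))"
      by (intro nn_integral_cong) (auto simp: space_pair_measure)
    also have "\<dots> = ennreal (mass N W)"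
      unfolding mass_def using W'(6) by (intro nn_integral_eq_integral W'(4) AE_I2) (auto simp: space_pair_measure)
    finally show ?thesis by simp
  qed
  then have "weight_on (graphex_of_graphon N W) (space N) < \<infinity>"
    by (simp add: weight_on_def graphex_of_graphon_simps)
  then show ?thesis
    unfolding is_graphex_def graphex_of_graphon_simps using g ae by (auto intro!: bexI[of _ "space N"])
qed

lemma integrable_graphex_graphex_of_graphon:
  assumes "integrable_graphex (graphex_of_graphon N W)"
  shows "integrable_graphon N W"
proof -
  have g: "graphon N W" and w: "weight_on (graphex_of_graphon N W) (space N) < \<infinity>"
    using assms by (simp_all add: integrable_graphex_def is_graphex_def graphex_of_graphon_simps)
  have "(\<integral>\<^sup>+z. ennreal (W (fst z) (snd z)) \<partial>(N \<Otimes>\<^sub>M N))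
      = (\<integral>\<^sup>+z. ennreal (W (fst z) (snd z)) * indicator (space N \<times> space N) z \<partial>(N \<Otimes>\<^sub>M N))"
    by (intro nn_integral_cong) (auto simp: space_pair_measure)
  also have "\<dots> < \<infinity>"
    using w by (simp add: weight_on_def graphex_of_graphon_simps)
  finally have "integrable (N \<Otimes>\<^sub>M N) (\<lambda>z. W (fst z) (snd z))"
    using g by (intro integrableI_nonneg AE_I2) (auto simp: graphon_def case_prod_beta' space_pair_measure)
  then show ?thesis using g by (simp add: integrable_graphon_def case_prod_beta')
qed

text \<open>A kernel with values in [0, 1] dominates its square, and a degree bounded by
  \<open>l\<close> has its square dominated by \<open>l\<close> times itself. With unbounded degrees
  the marginal may fail to be square-integrable.\<close>

lemma L1_L2_of_bounded_degree:
  assumes W: "integrable_graphon N W" and l: "AE x in N. (\<integral>\<^sup>+y. ennreal (W x y) \<partial>N) \<le> ennreal l" and "0 \<le> l"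
  shows "L1_L2_graphex (graphex_of_graphon N W)"
proof -
  note W' = integrable_graphonD[OF W]
  interpret sigma_finite_measure N by (rule W'(1))
  interpret P: pair_sigma_finite N N by standard
  have Wp: "integrable (N \<Otimes>\<^sub>M N) (\<lambda>(x, y). W x y)" using W'(4) by (simp add: case_prod_beta')
  have W2: "integrable (N \<Otimes>\<^sub>M N) (\<lambda>z. (W (fst z) (snd z))\<^sup>2)"
  proof (rule Bochner_Integration.integrable_bound[OF W'(4)])
    show "AE z in N \<Otimes>\<^sub>M N. norm ((W (fst z) (snd z))\<^sup>2) \<le> norm (W (fst z) (snd z))"
      using W'(6,7) by (intro AE_I2) (auto simp: space_pair_measure power2_eq_square mult_left_le)
  qed (use W'(3) in measurable)
  have D: "integrable N (\<lambda>x. \<integral>y. W x y \<partial>N)" using P.integrable_fst'[OF W'(4)] by simp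
  have "AE x in N. (\<integral>y. W x y \<partial>N) \<le> l"
    using l by eventually_elim (use \<open>0 \<le> l\<close> in \<open>rule integral_real_bounded\<close>)
  then have "integrable N (\<lambda>x. (\<integral>y. W x y \<partial>N)\<^sup>2)"
  proof -
    assume a: "AE x in N. (\<integral>y. W x y \<partial>N) \<le> l"
    show ?thesis
    proof (rule Bochner_Integration.integrable_bound)
      show "integrable N (\<lambda>x. l * (\<integral>y. W x y \<partial>N))" using D by simp
      show "AE x in N. norm ((\<integral>y. W x y \<partial>N)\<^sup>2) \<le> norm (l * (\<integral>y. W x y \<partial>N))"
        using a AE_space
      proof eventually_elim
        fix x assume x: "(\<integral>y. W x y \<partial>N) \<le> l" "x \<in> space N"
        have "0 \<le> (\<integral>y. W x y \<partial>N)" using W'(6) x(2) by (intro integral_nonneg_AE AE_I2) auto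
        then show "norm ((\<integral>y. W x y \<partial>N)\<^sup>2) \<le> norm (l * (\<integral>y. W x y \<partial>N))"
          using x(1) \<open>0 \<le> l\<close> by (simp add: power2_eq_square mult_right_mono)
      qed
    qed (use D in measurable)
  qed
  then show ?thesis
    using is_graphex_graphex_of_graphon[OF W] Wp W2 D
    by (simp add: L1_L2_graphex_def in_L1_L2_def graphex_of_graphon_simps marginal_def[abs_def] case_prod_beta')
qed

lemma AE_extend_base:
  assumes [measurable]: "Measurable.pred (extend_base N) P" and "AE x in N. P (Inl x)" "\<And>r. P (Inr r)"
  shows "AE x in extend_base N. P x"
proof -
  let ?B = "{x\<in>space (extend_base N). \<not> P x}"
  have B[measurable]: "?B \<in> sets (extend_base N)" by measurable
  have "emeasure (extend_base N) ?B = (\<integral>\<^sup>+x. indicator ?B (Inl x) \<partial>N) + (\<integral>\<^sup>+r. indicator ?B (Inr r) \<partial>lborel)"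
    using nn_integral_extend_base[of "indicator ?B" N] by simp
  also have "(\<integral>\<^sup>+x. indicator ?B (Inl x) \<partial>N) = (\<integral>\<^sup>+x. 0 \<partial>N)"
    using assms(2) by (intro nn_integral_cong_AE) (auto elim!: eventually_mono)
  also have "(\<integral>\<^sup>+r. indicator ?B (Inr r :: 'a + real) \<partial>lborel) = (\<integral>\<^sup>+(r::real). 0 \<partial>lborel)"
    using assms(3) by (intro nn_integral_cong) auto
  finally show ?thesis using B by (intro AE_I[of _ _ ?B]) auto
qed

text \<open>
  In the coupling, deleting the points of large degree deletes parts of the mass of other points.
  This is why the mass that is left is described by a density and not by a subset.
\<close>
lemma truncated_graphon:
  fixes M :: "'a measure"
  defines "X \<equiv> extend_base M"
  assumes W: "integrable_graphon M W" and s\<rho>: "sets \<rho> = sets X" and w: "measure_within r X \<rho>"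
    and deg: "emeasure \<rho> {x\<in>space X. ennreal l < (\<integral>\<^sup>+y. ennreal (extend_kernel W x y) \<partial>X)} = 0"
  obtains N where "sets N = sets M" "integrable_graphon N W" "measure_within r M N"
    "\<And>E. E \<in> sets X \<Longrightarrow> emeasure \<rho> E \<le> emeasure (extend_base N) E"
    "AE x in N. (\<integral>\<^sup>+y. ennreal (W x y) \<partial>N) \<le> ennreal l"
    "mass N W = mass \<rho> (extend_kernel W)"
proof -
  note W' = integrable_graphonD[OF W]
  let ?K = "extend_kernel W"
  have sX: "sigma_finite_measure X" unfolding X_def by (rule sigma_finite_extend_base[OF W'(1)])
  interpret X: sigma_finite_measure X by (rule sX)
  interpret M: sigma_finite_measure M by (rule W'(1))
  have K[measurable]: "(\<lambda>z. ?K (fst z) (snd z)) \<in> borel_measurable (X \<Otimes>\<^sub>M X)"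
    using measurable_extend_kernel[OF W'(2)] by (simp add: X_def case_prod_beta')
  have Kp[measurable]: "(\<lambda>(x, y). ?K x y) \<in> borel_measurable (X \<Otimes>\<^sub>M X)"
    using K by (simp add: case_prod_beta')
  have [measurable]: "Inl \<in> measurable M X" "Inr \<in> measurable borel X"
    unfolding X_def by measurable
  obtain h :: "'a + real \<Rightarrow> real" where h[measurable]: "h \<in> borel_measurable X"
    and h01: "\<And>x. 0 \<le> h x" "\<And>x. h x \<le> 1" and \<rho>: "\<rho> = density X (\<lambda>x. ennreal (h x))"
    by (rule dominated_density[OF sX s\<rho> measure_within_le[OF w]]) (auto intro: that)
  \<comment> \<open>\<open>N\<close> keeps only the weights on the original space, and its extension
    carries full Lebesgue measure on the added line. So \<open>\<rho>\<close> is dominated by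
    \<open>extend_base N\<close> without having to equal it; the kernel masses still agree, since
    the kernel vanishes on the line.\<close>
  define k where "k x = h (Inl x)" for x
  have k[measurable]: "k \<in> borel_measurable M" unfolding k_def by measurable
  have k01: "0 \<le> k x" "k x \<le> 1" for x using h01 by (auto simp: k_def)
  define N where "N = density M (\<lambda>x. ennreal (k x))"
  have sN: "sets N = sets M" "space N = space M" by (simp_all add: N_def)
  have \<rho>E: "emeasure \<rho> E = (\<integral>\<^sup>+x. ennreal (k x) * indicator E (Inl x) \<partial>M)
      + (\<integral>\<^sup>+r. ennreal (h (Inr r)) * indicator E (Inr r) \<partial>lborel)" if [measurable]: "E \<in> sets X" for E
    unfolding \<rho> X_def by (subst emeasure_density, (simp_all add: X_def[symmetric])[2],
      subst nn_integral_extend_base) (simp_all add: X_def[symmetric] k_def)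
  have NI: "emeasure N B = emeasure \<rho> (Inl ` B)" if [measurable]: "B \<in> sets M" for B
  proof -
    have IB[measurable]: "Inl ` B \<in> sets X" unfolding X_def by measurable
    have "indicator (Inl ` B) (Inl x :: 'a + real) = (indicator B x :: ennreal)" for x
      by (auto split: split_indicator)
    moreover have "indicator (Inl ` B) (Inr r :: 'a + real) = (0 :: ennreal)" for r
      by (auto split: split_indicator)
    ultimately show ?thesis by (simp add: \<rho>E N_def emeasure_density)
  qed
  have le: "emeasure N B \<le> emeasure M B" if "B \<in> sets M" for B
    unfolding N_def using k01 that by (intro density_le) auto
  have within: "measure_within r M N"
    unfolding measure_within_def
  proof (intro conjI ballI sN(1) le)
    fix B assume B: "B \<in> sets M"
    then have "Inl ` B \<in> sets X" unfolding X_def by measurable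
    then have "emeasure X (Inl ` B) - ennreal r \<le> emeasure \<rho> (Inl ` B)"
      using w by (simp add: measure_within_def)
    then show "emeasure M B - ennreal r \<le> emeasure N B"
      using NI[OF B] emeasure_extend_base_Inl[OF B] by (simp add: X_def)
  qed
  have sfN: "sigma_finite_measure N" by (rule sigma_finite_measure_mono[OF W'(1) sN(1) le])
  have "integrable (N \<Otimes>\<^sub>M N) (\<lambda>z. W (fst z) (snd z))"
    by (rule integrable_mono_measure[OF sets_pair_measure_cong[OF sN(1) sN(1)] pair_measure_mono[OF W'(1) sfN sN(1) le] W'(4)])
  moreover have "(\<lambda>(x, y). W x y) \<in> borel_measurable (N \<Otimes>\<^sub>M N)"
    using W'(2) sets_pair_measure_cong[OF sN(1) sN(1)] by (simp cong: measurable_cong_sets)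
  ultimately have NW: "integrable_graphon N W"
    using sfN W'(5,6,7) by (auto simp: integrable_graphon_def graphon_def sN(2) case_prod_beta')
  have ext: "emeasure \<rho> E \<le> emeasure (extend_base N) E" if E[measurable]: "E \<in> sets X" for E
  proof -
    have [measurable]: "(\<lambda>x. indicator E (Inl x) :: ennreal) \<in> borel_measurable M" by measurable
    have E': "E \<in> sets (extend_base N)" using E sets_extend_base_cong[OF sN(1)] by (simp add: X_def)
    have "emeasure (extend_base N) E = (\<integral>\<^sup>+x. indicator E (Inl x) \<partial>N) + (\<integral>\<^sup>+r. indicator E (Inr r) \<partial>lborel)"
      using nn_integral_extend_base[of "indicator E" N] E' by simp
    also have "(\<integral>\<^sup>+x. indicator E (Inl x) \<partial>N) = (\<integral>\<^sup>+x. ennreal (k x) * indicator E (Inl x) \<partial>M)"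
      unfolding N_def by (rule nn_integral_density) measurable
    finally show ?thesis
      unfolding \<rho>E[OF E] using h01(2)
      by (auto intro!: add_left_mono nn_integral_mono split: split_indicator)
  qed
  have degN: "AE x in N. (\<integral>\<^sup>+y. ennreal (W x y) \<partial>N) \<le> ennreal l"
  proof -
    let ?B = "{x\<in>space M. ennreal l < (\<integral>\<^sup>+y. ennreal (?K (Inl x) y) \<partial>X)}"
    have B: "?B \<in> sets M" by measurable
    have C: "{x\<in>space X. ennreal l < (\<integral>\<^sup>+y. ennreal (?K x y) \<partial>X)} \<in> sets X" by measurable
    have "Inl ` space M \<subseteq> space X" by (auto simp: X_def space_extend_base)
    then have "emeasure N ?B \<le> emeasure \<rho> {x\<in>space X. ennreal l < (\<integral>\<^sup>+y. ennreal (?K x y) \<partial>X)}"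
      unfolding NI[OF B] using C by (intro emeasure_mono) (auto simp: s\<rho>)
    then have "emeasure N ?B = 0" using deg by simp
    then have "AE x in N. x \<notin> ?B" using B sN(1) by (intro AE_not_in) (simp add: null_sets_def)
    then show ?thesis using AE_space
    proof eventually_elim
      fix x assume nB: "x \<notin> ?B" and x: "x \<in> space N"
      have x'[measurable]: "Inl x \<in> space X" using x by (auto simp: X_def space_extend_base sN)
      have "(\<integral>\<^sup>+y. ennreal (W x y) \<partial>N) \<le> (\<integral>\<^sup>+y. ennreal (W x y) \<partial>M)"
        using le sN(1) by (intro nn_integral_mono_measure) (simp_all add: le_measure)
      also have "\<dots> = (\<integral>\<^sup>+y. ennreal (?K (Inl x) y) \<partial>X)"
        unfolding X_def by (subst nn_integral_extend_base) (simp_all add: X_def[symmetric], simp add: extend_kernel_def)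
      also have "\<dots> \<le> ennreal l" using nB x by (auto simp: sN(2) not_less)
      finally show "(\<integral>\<^sup>+y. ennreal (W x y) \<partial>N) \<le> ennreal l" .
    qed
  qed
  have "mass \<rho> ?K = (\<integral>z. h (fst z) * h (snd z) * ?K (fst z) (snd z) \<partial>(X \<Otimes>\<^sub>M X))"
    unfolding \<rho> by (rule mass_density(2)[OF sX K h h01])
  also have "\<dots> = (\<integral>z. k (fst z) * k (snd z) * W (fst z) (snd z) \<partial>(M \<Otimes>\<^sub>M M))"
  proof -
    have 0: "h (fst z) * h (snd z) * ?K (fst z) (snd z) = 0"
      if "z \<in> space (X \<Otimes>\<^sub>M X)" "z \<notin> Inl ` space M \<times> Inl ` space M" for z
      using that by (auto simp: X_def space_pair_measure space_extend_base extend_kernel_def)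
    have m: "(\<lambda>z. h (fst z) * h (snd z) * ?K (fst z) (snd z)) \<in> borel_measurable (X \<Otimes>\<^sub>M X)" by measurable
    show ?thesis
      using extend_integral(1)[OF W'(1), folded X_def, OF m 0] by (simp add: k_def extend_kernel_def)
  qed
  also have "\<dots> = mass N W" unfolding N_def by (rule mass_density(2)[OF W'(1,3) k k01, symmetric])
  finally have "mass N W = mass \<rho> ?K" by simp
  from that[OF sN(1) NW within ext degN this] show ?thesis .
qed

context coupled_graphons
begin

text \<open>On the coupling the difference of the kernels has degrees at most \<open>2 * l\<close>,
  so \<open>small_cut_kernel\<close> applies with \<open>\<Lambda> = 2 * l\<close>. The three
  conditions on \<open>c\<close> match the three terms of \<open>kernel_d\<close>: kernel norm,
  marginals and \<open>rho\<close>.\<close>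

lemma kernel_d_le:
  assumes cut: "cut_bounded \<mu> (\<lambda>z w. K1 z w - K2 z w) \<epsilon>" and l: "0 < l"
    and l1: "AE x in M1. (\<integral>\<^sup>+y. ennreal (W1 x y) \<partial>M1) \<le> ennreal l"
    and l2: "AE x in M2. (\<integral>\<^sup>+y. ennreal (W2 x y) \<partial>M2) \<le> ennreal l"
    and c: "root 3 (4 * \<epsilon> * (2 * l)) \<le> c" "sqrt (sqrt (2 * \<epsilon> * (2 * l))) \<le> c" "root 3 \<epsilon> \<le> c"
  shows "kernel_d (pullback fst \<mu> (extend_graphex (graphex_of_graphon M1 W1)))
    (pullback snd \<mu> (extend_graphex (graphex_of_graphon M2 W2))) \<le> ereal c"
proof -
  interpret \<mu>: sigma_finite_measure \<mu> by (rule sigma_finite_\<mu>)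
  interpret P: pair_sigma_finite \<mu> \<mu> by standard
  \<comment> \<open>Degrees on the coupling are the degrees of the extended kernel pulled back along
    \<open>p\<close>; points of the added line have degree 0.\<close>
  have deg: "AE z in \<mu>. (\<integral>\<^sup>+w. ennreal (extend_kernel W (p z) (p w)) \<partial>\<mu>) \<le> ennreal l"
    if W: "integrable_graphon M W" and lW: "AE x in M. (\<integral>\<^sup>+y. ennreal (W x y) \<partial>M) \<le> ennreal l"
      and p[measurable]: "p \<in> measurable \<mu> (extend_base M)" and d: "distr \<mu> (extend_base M) p = extend_base M"
    for M :: "'c measure" and W and p
  proof -
    let ?X = "extend_base M"
    interpret X: sigma_finite_measure ?X by (rule sigma_finite_extend_base[OF integrable_graphonD(1)[OF W]])
    have Kp[measurable]: "(\<lambda>(x, y). extend_kernel W x y) \<in> borel_measurable (?X \<Otimes>\<^sub>M ?X)"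
      by (rule measurable_extend_kernel[OF integrable_graphonD(2)[OF W]])
    have "AE x in ?X. (\<integral>\<^sup>+y. ennreal (extend_kernel W x y) \<partial>?X) \<le> ennreal l"
    proof (rule AE_extend_base)
      show "AE x in M. (\<integral>\<^sup>+y. ennreal (extend_kernel W (Inl x) y) \<partial>?X) \<le> ennreal l"
        using lW AE_space
      proof eventually_elim
        fix x assume x: "(\<integral>\<^sup>+y. ennreal (W x y) \<partial>M) \<le> ennreal l" "x \<in> space M"
        then have [measurable]: "Inl x \<in> space ?X" by (auto simp: space_extend_base)
        have "(\<integral>\<^sup>+y. ennreal (extend_kernel W (Inl x) y) \<partial>?X) = (\<integral>\<^sup>+y. ennreal (W x y) \<partial>M)"
          by (subst nn_integral_extend_base) (simp_all, simp add: extend_kernel_def)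
        then show "(\<integral>\<^sup>+y. ennreal (extend_kernel W (Inl x) y) \<partial>?X) \<le> ennreal l" using x(1) by simp
      qed
      show "Measurable.pred ?X (\<lambda>x. (\<integral>\<^sup>+y. ennreal (extend_kernel W x y) \<partial>?X) \<le> ennreal l)"
        by measurable
      show "(\<integral>\<^sup>+y. ennreal (extend_kernel W (Inr r) y) \<partial>?X) \<le> ennreal l" for r
        by (simp add: extend_kernel_def)
    qed
    then have "AE x in distr \<mu> ?X p. (\<integral>\<^sup>+y. ennreal (extend_kernel W x y) \<partial>?X) \<le> ennreal l" by (simp only: d)
    from AE_distrD[OF p this] AE_space show ?thesis
    proof eventually_elim
      fix z assume z: "(\<integral>\<^sup>+y. ennreal (extend_kernel W (p z) y) \<partial>?X) \<le> ennreal l" "z \<in> space \<mu>"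
      have [measurable]: "p z \<in> space ?X" using measurable_space[OF p z(2)] .
      have "(\<integral>\<^sup>+w. ennreal (extend_kernel W (p z) (p w)) \<partial>\<mu>) = (\<integral>\<^sup>+y. ennreal (extend_kernel W (p z) y) \<partial>distr \<mu> ?X p)"
        by (rule nn_integral_distr[symmetric]) measurable
      then show "(\<integral>\<^sup>+w. ennreal (extend_kernel W (p z) (p w)) \<partial>\<mu>) \<le> ennreal l" using z(1) by (simp only: d)
    qed
  qed
  note deg1 = deg[OF W1 l1 fst_measurable_\<mu> distr_fst] and deg2 = deg[OF W2 l2 snd_measurable_\<mu> distr_snd]
  have i1: "AE z in \<mu>. integrable \<mu> (\<lambda>w. K1 z w)" and i2: "AE z in \<mu>. integrable \<mu> (\<lambda>w. K2 z w)"
    using P.AE_integrable_fst'[OF K1_integral(1)] P.AE_integrable_fst'[OF K2_integral(1)] by simp_all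
  interpret S: small_cut_kernel \<mu> "\<lambda>z w. K1 z w - K2 z w" \<epsilon> "2 * l"
  proof unfold_locales
    show "integrable (\<mu> \<Otimes>\<^sub>M \<mu>) (\<lambda>z. K1 (fst z) (snd z) - K2 (fst z) (snd z))"
      by (intro Bochner_Integration.integrable_diff K1_integral(1) K2_integral(1))
    show "K1 z w - K2 z w = K1 w z - K2 w z" if "z \<in> space \<mu>" "w \<in> space \<mu>" for z w
      using K1_symmetric[OF that] K2_symmetric[OF that] by simp
    show "\<bar>K1 z w - K2 z w\<bar> \<le> 1" if "z \<in> space \<mu>" "w \<in> space \<mu>" for z w
      using K1_range[OF that] K2_range[OF that] by (simp add: abs_le_iff)
    show "cut_bounded \<mu> (\<lambda>z w. K1 z w - K2 z w) \<epsilon>" by (rule cut)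
    show "0 < 2 * l" using l by simp
    show "AE z in \<mu>. (\<integral>w. \<bar>K1 z w - K2 z w\<bar> \<partial>\<mu>) \<le> 2 * l"
      using deg1 deg2 i1 i2 AE_space
    proof eventually_elim
      fix z assume z: "(\<integral>\<^sup>+w. ennreal (K1 z w) \<partial>\<mu>) \<le> ennreal l" "(\<integral>\<^sup>+w. ennreal (K2 z w) \<partial>\<mu>) \<le> ennreal l"
        and i: "integrable \<mu> (K1 z)" "integrable \<mu> (K2 z)" and zs: "z \<in> space \<mu>"
      have "(\<integral>\<^sup>+w. ennreal \<bar>K1 z w - K2 z w\<bar> \<partial>\<mu>) \<le> (\<integral>\<^sup>+w. ennreal (K1 z w) + ennreal (K2 z w) \<partial>\<mu>)"
      proof (rule nn_integral_mono)
        fix w assume w: "w \<in> space \<mu>"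
        have "ennreal \<bar>K1 z w - K2 z w\<bar> \<le> ennreal (K1 z w + K2 z w)"
          using K1_range[OF zs w] K2_range[OF zs w] by (intro ennreal_leI) (simp add: abs_le_iff)
        also have "\<dots> = ennreal (K1 z w) + ennreal (K2 z w)"
          using K1_range[OF zs w] K2_range[OF zs w] by (intro ennreal_plus) auto
        finally show "ennreal \<bar>K1 z w - K2 z w\<bar> \<le> ennreal (K1 z w) + ennreal (K2 z w)" .
      qed
      also have "\<dots> = (\<integral>\<^sup>+w. ennreal (K1 z w) \<partial>\<mu>) + (\<integral>\<^sup>+w. ennreal (K2 z w) \<partial>\<mu>)"
        using i[THEN borel_measurable_integrable] by (intro nn_integral_add) auto
      also have "\<dots> \<le> ennreal l + ennreal l" using z by (rule add_mono)
      also have "\<dots> = ennreal (2 * l)" using l by (simp add: ennreal_plus[symmetric] del: ennreal_plus)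
      finally show "(\<integral>w. \<bar>K1 z w - K2 z w\<bar> \<partial>\<mu>) \<le> 2 * l"
        using l by (intro integral_real_bounded) auto
    qed
  qed
  let ?G1 = "pullback fst \<mu> (extend_graphex (graphex_of_graphon M1 W1))"
  let ?G2 = "pullback snd \<mu> (extend_graphex (graphex_of_graphon M2 W2))"
  have st1: "(\<lambda>x. case fst x of Inl x \<Rightarrow> star (graphex_of_graphon M1 W1) x | Inr _ \<Rightarrow> 0) = (\<lambda>x::('a + real) \<times> ('b + real). 0)"
    and st2: "(\<lambda>x. case snd x of Inl x \<Rightarrow> star (graphex_of_graphon M2 W2) x | Inr _ \<Rightarrow> 0) = (\<lambda>x::('a + real) \<times> ('b + real). 0)"
    by (auto simp: fun_eq_iff graphex_of_graphon_simps split: sum.splits)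
  have "kernel_norm \<mu> (\<lambda>z w. K1 z w - K2 z w) \<le> ereal c"
    using S.kernel_norm_le c(1) by (meson ereal_less_eq(3) order_trans)
  then have 1: "kernel_norm (base ?G1) (\<lambda>x y. kernel ?G1 x y - kernel ?G2 x y) \<le> ereal c"
    by (simp add: pullback_simps extend_graphex_simps graphex_of_graphon_simps)
  have mg: "marginal ?G1 z = (\<integral>w. K1 z w \<partial>\<mu>)" "marginal ?G2 z = (\<integral>w. K2 z w \<partial>\<mu>)" for z
    using fun_cong[OF st1, of z] fun_cong[OF st2, of z]
    by (simp_all add: marginal_def pullback_simps extend_graphex_simps graphex_of_graphon_simps(1,3,4))
  \<comment> \<open>The Bochner integrals of two sections may be subtracted where both are
    integrable, so the integrands agree almost everywhere.\<close>
  have "(\<integral>z. (marginal ?G1 z - marginal ?G2 z)\<^sup>2 \<partial>\<mu>) = (\<integral>z. (\<integral>w. K1 z w - K2 z w \<partial>\<mu>)\<^sup>2 \<partial>\<mu>)"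
  proof (rule integral_cong_AE)
    have [measurable]: "(\<lambda>(z, w). K1 z w) \<in> borel_measurable (\<mu> \<Otimes>\<^sub>M \<mu>)" "(\<lambda>(z, w). K2 z w) \<in> borel_measurable (\<mu> \<Otimes>\<^sub>M \<mu>)"
      using borel_measurable_integrable[OF K1_integral(1)] borel_measurable_integrable[OF K2_integral(1)]
      by (simp_all add: case_prod_beta')
    show "(\<lambda>z. (marginal ?G1 z - marginal ?G2 z)\<^sup>2) \<in> borel_measurable \<mu>" unfolding mg by measurable
    show "(\<lambda>z. (\<integral>w. K1 z w - K2 z w \<partial>\<mu>)\<^sup>2) \<in> borel_measurable \<mu>" by measurable
    show "AE z in \<mu>. (marginal ?G1 z - marginal ?G2 z)\<^sup>2 = (\<integral>w. K1 z w - K2 z w \<partial>\<mu>)\<^sup>2"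
      using i1 i2 by eventually_elim (simp add: mg)
  qed
  also have "\<dots> \<le> 2 * \<epsilon> * (2 * l)" by (rule S.degree_L2)
  finally have "sqrt (L2_norm \<mu> (\<lambda>x. marginal ?G1 x - marginal ?G2 x)) \<le> c"
    unfolding L2_norm_def using c(2) by (meson order_trans real_sqrt_le_mono)
  then have 2: "ereal (sqrt (L2_norm (base ?G1) (\<lambda>x. marginal ?G1 x - marginal ?G2 x))) \<le> ereal c"
    by (simp add: pullback_simps)
  have "rho ?G1 = mass M1 W1" "rho ?G2 = mass M2 W2"
    using K1_integral(3) K2_integral(3) st1 st2
    by (simp_all add: rho_def mass_def pullback_simps extend_graphex_simps graphex_of_graphon_simps(1,3,4) case_prod_beta')
  then have "root 3 \<bar>rho ?G1 - rho ?G2\<bar> \<le> root 3 \<epsilon>"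
    using mass_diff_le_cut[OF cut] by (intro real_root_le_mono) auto
  then have "root 3 \<bar>rho ?G1 - rho ?G2\<bar> \<le> c" using c(3) by (rule order_trans)
  then have 3: "ereal (root 3 \<bar>rho ?G1 - rho ?G2\<bar>) \<le> ereal c" by (simp only: ereal_less_eq)
  show ?thesis unfolding kernel_d_def using 1 2 3 by simp
qed

end

text \<open>Markov's inequality for the degree function, whose integral is the mass.\<close>

lemma high_degree_small:
  assumes W: "integrable_graphon M W" and K: "mass M W \<le> K" and l: "0 < l"
  defines "B \<equiv> {x\<in>space (extend_base M). ennreal l < (\<integral>\<^sup>+y. ennreal (extend_kernel W x y) \<partial>extend_base M)}"
  shows "B \<in> sets (extend_base M)" and "emeasure (extend_base M) B \<le> ennreal (K / l)"
proof -
  note W' = integrable_graphonD[OF W]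
  let ?X = "extend_base M" and ?K = "extend_kernel W"
  interpret X: sigma_finite_measure ?X by (rule sigma_finite_extend_base[OF W'(1)])
  have [measurable]: "(\<lambda>(x, y). ?K x y) \<in> borel_measurable (?X \<Otimes>\<^sub>M ?X)"
    by (rule measurable_extend_kernel[OF W'(2)])
  show B[measurable]: "B \<in> sets ?X" unfolding B_def by measurable
  have idm: "(\<lambda>x. x) \<in> measurable ?X ?X" by simp
  note mi = marginal_set_integral[OF W idm distr_id]
  have "ennreal l * emeasure ?X B = (\<integral>\<^sup>+x. ennreal l * indicator B x \<partial>?X)"
    by (simp add: nn_integral_cmult)
  also have "\<dots> \<le> (\<integral>\<^sup>+x. (\<integral>\<^sup>+y. ennreal (?K x y) \<partial>?X) \<partial>?X)"
    by (intro nn_integral_mono) (auto simp: B_def split: split_indicator)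
  also have "\<dots> = (\<integral>\<^sup>+z. ennreal (?K (fst z) (snd z)) \<partial>(?X \<Otimes>\<^sub>M ?X))"
    by (subst X.nn_integral_fst[symmetric]) (simp_all add: case_prod_beta'[symmetric])
  also have "\<dots> = ennreal (mass ?X ?K)"
    unfolding mass_def using extend_kernel_range[of M W] W'(6,7)
    by (intro nn_integral_eq_integral mi(1) AE_I2) (auto simp: space_pair_measure)
  also have "\<dots> \<le> ennreal K" using mi(3) K by (intro ennreal_leI) simp
  finally have "ennreal (1 / l) * (ennreal l * emeasure ?X B) \<le> ennreal (1 / l) * ennreal K"
    by (rule mult_left_mono) simp
  moreover have "ennreal (1 / l) * (ennreal l * emeasure ?X B) = emeasure ?X B"
    using l by (simp add: mult.assoc[symmetric] ennreal_mult[symmetric])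
  moreover have "ennreal (1 / l) * ennreal K = ennreal (K / l)"
    using l by (simp add: ennreal_mult'[symmetric])
  ultimately show "emeasure ?X B \<le> ennreal (K / l)" by simp
qed

context coupled_graphons
begin

text \<open>The pairs with a coordinate of degree above \<open>l\<close> have measure at most
  \<open>2 * K / l\<close> in the coupling, and deleting them lowers either marginal on any set by
  at most that much. What remains, \<open>\<nu>\<close>, keeps the cut bound
  \<open>\<epsilon>\<close> and is a partial coupling of the truncated measures, in which all
  degrees are at most \<open>l\<close>.\<close>

lemma weak_kernel_dist_le:
  assumes cut: "cut_bounded \<mu> (\<lambda>z w. K1 z w - K2 z w) \<epsilon>" and l: "0 < l"
    and K: "mass M1 W1 \<le> K" "mass M2 W2 \<le> K" "0 \<le> K" "2 * K / l \<le> c\<^sup>2"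
    and c: "root 3 (4 * \<epsilon> * (2 * l)) \<le> c" "sqrt (sqrt (2 * \<epsilon> * (2 * l))) \<le> c" "root 3 \<epsilon> \<le> c"
  shows "weak_kernel_dist (graphex_of_graphon M1 W1) (graphex_of_graphon M2 W2) \<le> ereal c"
proof -
  define B1 B2 where "B1 = {x\<in>space X1. ennreal l < (\<integral>\<^sup>+y. ennreal (extend_kernel W1 x y) \<partial>X1)}"
    and "B2 = {x\<in>space X2. ennreal l < (\<integral>\<^sup>+y. ennreal (extend_kernel W2 x y) \<partial>X2)}"
  note b1 = high_degree_small[OF W1 K(1) l, folded B1_def] and b2 = high_degree_small[OF W2 K(2) l, folded B2_def]
  define P1 P2 where "P1 = fst -` B1 \<inter> space \<mu>" and "P2 = snd -` B2 \<inter> space \<mu>"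
  have P[measurable]: "P1 \<in> sets \<mu>" "P2 \<in> sets \<mu>"
    unfolding P1_def P2_def by (intro measurable_sets[OF fst_measurable_\<mu> b1(1)] measurable_sets[OF snd_measurable_\<mu> b2(1)])+
  define Z where "Z = space \<mu> - (P1 \<union> P2)"
  have Z[measurable]: "Z \<in> sets \<mu>" unfolding Z_def by measurable
  have Pc: "emeasure \<mu> (P1 \<union> P2) \<le> ennreal (c\<^sup>2)"
  proof -
    have "emeasure \<mu> (P1 \<union> P2) \<le> emeasure \<mu> P1 + emeasure \<mu> P2" by (rule emeasure_subadditive) measurable
    also have "emeasure \<mu> P1 = emeasure X1 B1"
      unfolding P1_def using emeasure_distr[OF fst_measurable_\<mu> b1(1)] by (simp add: distr_fst)
    also have "emeasure \<mu> P2 = emeasure X2 B2"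
      unfolding P2_def using emeasure_distr[OF snd_measurable_\<mu> b2(1)] by (simp add: distr_snd)
    also have "emeasure X1 B1 + emeasure X2 B2 \<le> ennreal (K / l) + ennreal (K / l)"
      using b1(2) b2(2) by (rule add_mono)
    also have "\<dots> = ennreal (2 * K / l)"
      using K(3) l by (simp add: ennreal_plus[symmetric] del: ennreal_plus)
    also have "\<dots> \<le> ennreal (c\<^sup>2)" using K(4) by (rule ennreal_leI)
    finally show ?thesis .
  qed
  define \<nu> where "\<nu> = density \<mu> (indicator Z)"
  have s\<nu>: "sets \<nu> = sets \<mu>" by (simp add: \<nu>_def)
  have \<nu>d: "emeasure (distr \<nu> X p) B = emeasure \<mu> (Z \<inter> (p -` B \<inter> space \<mu>))"
    if p: "p \<in> measurable \<mu> X" and B: "B \<in> sets X" for p and X :: "'c measure" and B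
    using measurable_sets[OF p B] p B
    by (subst emeasure_distr) (simp_all add: \<nu>_def emeasure_restricted)
  have within: "measure_within (c\<^sup>2) X (distr \<nu> X p)"
    if p: "p \<in> measurable \<mu> X" and d: "distr \<mu> X p = X" for p and X :: "'c measure"
    unfolding measure_within_def
  proof (intro conjI ballI)
    fix B assume B: "B \<in> sets X"
    let ?E = "p -` B \<inter> space \<mu>"
    have E[measurable]: "?E \<in> sets \<mu>" by (rule measurable_sets[OF p B])
    have XB: "emeasure X B = emeasure \<mu> ?E" using emeasure_distr[OF p B] by (simp add: d)
    show "emeasure (distr \<nu> X p) B \<le> emeasure X B"
      unfolding \<nu>d[OF p B] XB by (rule emeasure_mono) auto
    have "emeasure \<mu> ?E \<le> emeasure \<mu> ((P1 \<union> P2) \<union> (Z \<inter> ?E))"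
      by (rule emeasure_mono) (auto simp: Z_def)
    also have "\<dots> \<le> emeasure \<mu> (P1 \<union> P2) + emeasure \<mu> (Z \<inter> ?E)" by (rule emeasure_subadditive) measurable
    also have "\<dots> \<le> ennreal (c\<^sup>2) + emeasure \<mu> (Z \<inter> ?E)" using Pc by (rule add_right_mono)
    finally show "emeasure X B - ennreal (c\<^sup>2) \<le> emeasure (distr \<nu> X p) B"
      unfolding \<nu>d[OF p B] XB by (simp add: ennreal_minus_le_iff)
  qed simp
  note w1 = within[OF fst_measurable_\<mu> distr_fst] and w2 = within[OF snd_measurable_\<mu> distr_snd]
  have "Z \<inter> P1 = {}" "Z \<inter> P2 = {}" by (auto simp: Z_def)
  then have deg1: "emeasure (distr \<nu> X1 fst) B1 = 0" and deg2: "emeasure (distr \<nu> X2 snd) B2 = 0"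
    unfolding \<nu>d[OF fst_measurable_\<mu> b1(1)] \<nu>d[OF snd_measurable_\<mu> b2(1)] P1_def P2_def by simp_all
  obtain N1 where N1: "sets N1 = sets M1" "integrable_graphon N1 W1" "measure_within (c\<^sup>2) M1 N1"
    "\<And>E. E \<in> sets X1 \<Longrightarrow> emeasure (distr \<nu> X1 fst) E \<le> emeasure (extend_base N1) E"
    "AE x in N1. (\<integral>\<^sup>+y. ennreal (W1 x y) \<partial>N1) \<le> ennreal l"
    "mass N1 W1 = mass (distr \<nu> X1 fst) (extend_kernel W1)"
    by (rule truncated_graphon[OF W1 sets_distr w1 deg1[unfolded B1_def]]) (rule that)
  obtain N2 where N2: "sets N2 = sets M2" "integrable_graphon N2 W2" "measure_within (c\<^sup>2) M2 N2"
    "\<And>E. E \<in> sets X2 \<Longrightarrow> emeasure (distr \<nu> X2 snd) E \<le> emeasure (extend_base N2) E"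
    "AE x in N2. (\<integral>\<^sup>+y. ennreal (W2 x y) \<partial>N2) \<le> ennreal l"
    "mass N2 W2 = mass (distr \<nu> X2 snd) (extend_kernel W2)"
    by (rule truncated_graphon[OF W2 sets_distr w2 deg2[unfolded B2_def]]) (rule that)
  have sX: "sets (extend_base N1) = sets X1" "sets (extend_base N2) = sets X2"
    by (rule sets_extend_base_cong[OF N1(1)], rule sets_extend_base_cong[OF N2(1)])
  have sets: "sets \<nu> = sets (extend_base N1 \<Otimes>\<^sub>M extend_base N2)"
    unfolding s\<nu> sets_\<mu> by (intro sets_pair_measure_cong sX[symmetric])
  have d1: "distr \<nu> (extend_base N1) fst = distr \<nu> X1 fst" and d2: "distr \<nu> (extend_base N2) snd = distr \<nu> X2 snd"
    by (intro distr_cong refl sX)+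
  have p\<nu>: "fst \<in> measurable \<nu> X1" "snd \<in> measurable \<nu> X2"
    using fst_measurable_\<mu> snd_measurable_\<mu> by (simp_all add: \<nu>_def)
  have sf: "sigma_finite_measure (distr \<nu> X1 fst)" "sigma_finite_measure (distr \<nu> X2 snd)"
    using measure_within_le[OF w1] measure_within_le[OF w2]
    by (auto intro!: sigma_finite_measure_mono[OF sigma_finite_X(1)] sigma_finite_measure_mono[OF sigma_finite_X(2)])
  have k1: "(\<lambda>z. extend_kernel W1 (fst z) (snd z)) \<in> borel_measurable (X1 \<Otimes>\<^sub>M X1)"
    and k2: "(\<lambda>z. extend_kernel W2 (fst z) (snd z)) \<in> borel_measurable (X2 \<Otimes>\<^sub>M X2)"
    using measurable_extend_kernel[OF integrable_graphonD(2)[OF W1]] measurable_extend_kernel[OF integrable_graphonD(2)[OF W2]]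
    by (simp_all add: case_prod_beta')
  \<comment> \<open>\<open>N1\<close> and \<open>N2\<close> have exactly the kernel masses of the
    marginals of \<open>\<nu>\<close>, so completing \<open>\<nu>\<close> to a coupling does not
    worsen the cut bound.\<close>
  have m1: "mass N1 W1 - mass \<nu> K1 \<le> 0" and m2: "mass N2 W2 - mass \<nu> K2 \<le> 0"
  proof -
    have "mass (distr \<nu> X1 fst) (extend_kernel W1) = mass \<nu> K1" "mass (distr \<nu> X2 snd) (extend_kernel W2) = mass \<nu> K2"
      unfolding mass_def pair_distr_integral(1)[OF sf(1) p\<nu>(1) k1] pair_distr_integral(1)[OF sf(2) p\<nu>(2) k2]
      by simp_all
    then show "mass N1 W1 - mass \<nu> K1 \<le> 0" "mass N2 W2 - mass \<nu> K2 \<le> 0" using N1(6) N2(6) by simp_all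
  qed
  have cut\<nu>: "cut_bounded \<nu> (\<lambda>z w. K1 z w - K2 z w) \<epsilon>"
    unfolding \<nu>_def using borel_measurable_integrable[OF K1_integral(1)] borel_measurable_integrable[OF K2_integral(1)]
    by (intro cut_bounded_indicator[OF sigma_finite_\<mu> Z _ cut]) simp
  have le1: "emeasure (distr \<nu> (extend_base N1) fst) E \<le> emeasure (extend_base N1) E" if "E \<in> sets (extend_base N1)" for E
    unfolding d1 using that sX(1) by (intro N1(4)) simp
  have le2: "emeasure (distr \<nu> (extend_base N2) snd) E \<le> emeasure (extend_base N2) E" if "E \<in> sets (extend_base N2)" for E
    unfolding d2 using that sX(2) by (intro N2(4)) simp
  obtain \<mu>' where \<mu>': "\<mu>' \<in> couplings (extend_base N1) (extend_base N2)"
    and cut': "cut_bounded \<mu>' (\<lambda>z w. K1 z w - K2 z w) (\<epsilon> + 0 + 0)"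
    using extend_partial_coupling[OF N1(2) N2(2) sets le1 le2 cut\<nu> m1 m2] by blast
  interpret C: coupled_graphons N1 W1 N2 W2 \<mu>'
    using N1(2) N2(2) \<mu>' by unfold_locales
  have "kernel_dist (graphex_of_graphon N1 W1) (graphex_of_graphon N2 W2) \<le> ereal c"
    unfolding kernel_dist_def kernel_dist_coupled_def
    using \<mu>' C.kernel_d_le[OF cut'[simplified] l N1(5) N2(5) c]
    by (intro INF_lower2[of \<mu>']) (simp_all add: extend_graphex_simps graphex_of_graphon_simps)
  moreover have "L1_L2_graphex (graphex_of_graphon N1 W1)" "L1_L2_graphex (graphex_of_graphon N2 W2)"
    using l by (intro L1_L2_of_bounded_degree[OF N1(2) N1(5)] L1_L2_of_bounded_degree[OF N2(2) N2(5)], simp)+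
  ultimately show ?thesis
    unfolding weak_kernel_dist_def using N1(3) N2(3)
    by (intro INF_lower2[of c]) (auto simp: graphex_of_graphon_base graphex_of_graphon_simps intro!: exI[of _ N1] exI[of _ N2])
qed

end

lemma weak_kernel_dist_nonneg: "0 \<le> weak_kernel_dist G1 G2"
  unfolding weak_kernel_dist_def
proof (rule INF_greatest)
  fix c assume "c \<in> {c. \<exists>M1 M2. L1_L2_graphex (G1\<lparr>base := M1\<rparr>) \<and> L1_L2_graphex (G2\<lparr>base := M2\<rparr>) \<and>
      measure_within (c\<^sup>2) (base G1) M1 \<and> measure_within (c\<^sup>2) (base G2) M2 \<and>
      kernel_dist (G1\<lparr>base := M1\<rparr>) (G2\<lparr>base := M2\<rparr>) \<le> ereal c}"
  then show "0 \<le> ereal c" using kernel_dist_nonneg order_trans by blast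
qed

lemma cut_convergent_imp_kernel_convergent:
  assumes W: "\<And>n. integrable_graphon (\<Omega> n) (W n)" and U: "integrable_graphon M U"
    and lim: "(\<lambda>n. cut_dist (\<Omega> n) (W n) M U) \<longlonglongrightarrow> 0"
  shows "(\<lambda>n. weak_kernel_dist (graphex_of_graphon (\<Omega> n) (W n)) (graphex_of_graphon M U)) \<longlonglongrightarrow> 0"
proof (rule order_tendstoI)
  fix a :: ereal assume "a < 0"
  then show "eventually (\<lambda>n. a < weak_kernel_dist (graphex_of_graphon (\<Omega> n) (W n)) (graphex_of_graphon M U)) sequentially"
    using weak_kernel_dist_nonneg by (intro always_eventually allI) (rule less_le_trans)
next
  fix a :: ereal assume "0 < a"
  then obtain c :: real where "0 < ereal c" and ca: "ereal c < a" using ereal_dense2 by blast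
  then have c: "0 < c" by simp
  \<comment> \<open>A common bound for the masses of the limit and of all graphons at cut distance
    less than \<open>\<epsilon> \<le> 1\<close>.\<close>
  define K where "K = mass M U + 1"
  have "0 \<le> mass M U"
    unfolding mass_def using integrable_graphonD(6)[OF U]
    by (intro integral_nonneg_AE AE_I2) (auto simp: space_pair_measure)
  then have K: "1 \<le> K" by (simp add: K_def)
  \<comment> \<open>The degree threshold at which the measure removed is at most
    \<open>c\<^sup>2\<close>.\<close>
  define l where "l = 2 * K / c\<^sup>2"
  have l: "0 < l" "2 * K / l \<le> c\<^sup>2" using K c by (simp_all add: l_def)
  \<comment> \<open>In order, the four bounds serve the common mass bound \<open>K\<close>, the
    \<open>rho\<close> term, the kernel norm and the marginal term.\<close>
  define \<epsilon> where "\<epsilon> = min (min 1 (c ^ 3)) (min (c ^ 3 / (8 * l)) (c ^ 4 / (4 * l)))"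
  have \<epsilon>: "0 < \<epsilon>" "\<epsilon> \<le> 1" "\<epsilon> \<le> c ^ 3" "\<epsilon> \<le> c ^ 3 / (8 * l)" "\<epsilon> \<le> c ^ 4 / (4 * l)"
    using c l(1) by (simp_all add: \<epsilon>_def)
  have r3: "root 3 x \<le> c" if "x \<le> c ^ 3" for x
  proof -
    have "root 3 x \<le> root 3 (c ^ 3)" using that by (intro real_root_le_mono) auto
    then show ?thesis using c by (simp add: real_root_power_cancel)
  qed
  have c1: "root 3 (4 * \<epsilon> * (2 * l)) \<le> c"
    using \<epsilon>(4) l(1) by (intro r3) (simp add: field_simps)
  have c2: "sqrt (sqrt (2 * \<epsilon> * (2 * l))) \<le> c"
  proof -
    have "2 * \<epsilon> * (2 * l) \<le> (c\<^sup>2)\<^sup>2"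
      using \<epsilon>(5) l(1) by (simp add: field_simps flip: power_mult)
    then have "sqrt (2 * \<epsilon> * (2 * l)) \<le> c\<^sup>2" by (intro real_le_lsqrt) auto
    then have "sqrt (sqrt (2 * \<epsilon> * (2 * l))) \<le> sqrt (c\<^sup>2)" by (rule real_sqrt_le_mono)
    then show ?thesis using c by simp
  qed
  have c3: "root 3 \<epsilon> \<le> c" by (rule r3[OF \<epsilon>(3)])
  have "eventually (\<lambda>n. cut_dist (\<Omega> n) (W n) M U < ereal \<epsilon>) sequentially"
    using lim \<epsilon>(1) by (intro order_tendstoD(2)[of _ 0]) auto
  then show "eventually (\<lambda>n. weak_kernel_dist (graphex_of_graphon (\<Omega> n) (W n)) (graphex_of_graphon M U) < a) sequentially"
  proof eventually_elim
    fix n assume "cut_dist (\<Omega> n) (W n) M U < ereal \<epsilon>"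
    then obtain \<mu> where \<mu>: "\<mu> \<in> couplings (extend_base (\<Omega> n)) (extend_base M)"
      "cut_bounded \<mu> (\<lambda>z w. extend_kernel (W n) (fst z) (fst w) - extend_kernel U (snd z) (snd w)) \<epsilon>"
      by (rule cut_dist_less)
    interpret coupled_graphons "\<Omega> n" "W n" M U \<mu>
      using W[of n] U \<mu>(1) by unfold_locales
    have "mass (\<Omega> n) (W n) \<le> K" "mass M U \<le> K"
      using mass_diff_le_cut[OF \<mu>(2)] \<epsilon>(2) by (simp_all add: K_def)
    then have "weak_kernel_dist (graphex_of_graphon (\<Omega> n) (W n)) (graphex_of_graphon M U) \<le> ereal c"
      using K by (intro weak_kernel_dist_le[OF \<mu>(2) l(1) _ _ _ l(2) c1 c2 c3]) auto
    then show "weak_kernel_dist (graphex_of_graphon (\<Omega> n) (W n)) (graphex_of_graphon M U) < a"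
      using ca by (rule le_less_trans)
  qed
qed

theorem theorem2p28:
  fixes \<Omega> :: "nat \<Rightarrow> 'a measure"
    and W :: "nat \<Rightarrow> 'a \<Rightarrow> 'a \<Rightarrow> real"
  assumes "\<And>n. integrable_graphex (graphex_of_graphon (\<Omega> n) (W n))"
  shows
    "((\<exists>(M :: 'b measure) U. integrable_graphon M U \<and>
         (\<lambda>n. cut_dist (\<Omega> n) (W n) M U) \<longlonglongrightarrow> 0)
      \<longleftrightarrow>
      uniformly_tail_regular (range (\<lambda>n. (\<Omega> n, W n))) \<and>
      (\<exists>(M :: 'b measure) U. is_graphex (graphex_of_graphon M U) \<and>
         (\<lambda>n. weak_kernel_dist (graphex_of_graphon (\<Omega> n) (W n)) (graphex_of_graphon M U))
           \<longlonglongrightarrow> 0))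
     \<and>
     (uniformly_tail_regular (range (\<lambda>n. (\<Omega> n, W n))) \<and>
      (\<exists>(M :: 'b measure) U. is_graphex (graphex_of_graphon M U) \<and>
         (\<lambda>n. weak_kernel_dist (graphex_of_graphon (\<Omega> n) (W n)) (graphex_of_graphon M U))
           \<longlonglongrightarrow> 0)
      \<longleftrightarrow>
      uniformly_tail_regular (range (\<lambda>n. (\<Omega> n, W n))) \<and>
      (\<exists>G :: 'b graphex. is_graphex G \<and>
         (\<lambda>n. weak_kernel_dist (graphex_of_graphon (\<Omega> n) (W n)) G) \<longlonglongrightarrow> 0))"
    (is "(?cut \<longleftrightarrow> ?utr \<and> ?graphon) \<and> (?utr \<and> ?graphon \<longleftrightarrow> ?utr \<and> ?graphex)")
proof -
  have W: "integrable_graphon (\<Omega> n) (W n)" for n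
    using assms by (rule integrable_graphex_graphex_of_graphon)
  have 12: "?utr \<and> ?graphon" if cut: ?cut
  proof -
    obtain M :: "'b measure" and U where U: "integrable_graphon M U"
      and lim: "(\<lambda>n. cut_dist (\<Omega> n) (W n) M U) \<longlonglongrightarrow> 0"
      using cut by blast
    show ?thesis
      using cut_convergent_tail_regular[OF W U lim] cut_convergent_imp_kernel_convergent[OF W U lim]
        is_graphex_graphex_of_graphon[OF U] by blast
  qed
  \<comment> \<open>The witnesses are the base and the kernel of \<open>G\<close>; its star and
    isolated part are dropped. That (3) implies (2) is obtained through (1).\<close>
  have 31: ?cut if utr: ?utr and graphex: ?graphex
  proof -
    obtain G :: "'b graphex" where G: "is_graphex G"
      and lim: "(\<lambda>n. weak_kernel_dist (graphex_of_graphon (\<Omega> n) (W n)) G) \<longlonglongrightarrow> 0"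
      using graphex by blast
    show ?thesis
      using kernel_convergent_imp_cut_convergent[OF W G utr lim] by blast
  qed
  have 23: ?graphex if ?graphon using that by blast
  show ?thesis using 12 31 23 by blast
qed

end
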